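(* Let $\mathbf{K}$ be a nondiscrete locally compact field. Then the locally compact group $A_4(\mathbf{K})$ has a quadratic Dehn function, i.e. it is compactly presented and its Dehn function $\delta$ satisfies $\delta(n)=O(n^2)$ as $n\to\infty$.
   Context: For a commutative ring $R$, $A_4(R)$ denotes the group of upper triangular $4\times 4$ matrices over $R$ with diagonal $(1,t_{22},t_{33},1)$, where $t_{22},t_{33}\in R^\times$, and with arbitrary entries $x_{ij}\in R$ for $i<j$. For $R=\mathbf{K}$ a locally compact field it carries its usual locally compact topology. Dehn function: let $G$ be a locally compact group generated by a compact symmetric subset $S$, let $F_S$ be the free group on $S$ and $K_S$ the kernel of the natural homomorphism $F_S\to G$. For $r\geq 1$ let $\mathcal{R}_r$ be the set of elements of $K_S$ of word length at most $r$. $G$ is compactly presented if for some $r$ the set $\mathcal{R}_r$ normally generates $K_S$, i.e. $G=\langle S\mid\mathcal{R}_r\rangle$. Fix such an $r$. The area $\alpha(w)$ of $w\in K_S$ is its word length with respect to the union of all $F_S$-conjugates of $\mathcal{R}_r$, and the Dehn function is $\delta(n)=\sup\{\alpha(w): w\in K_S,\ |w|_S\le n\}$, which takes finite values. Its asymptotic behavior does not depend on the choice of $S$ and $r$. If $G$ is not compactly presented, the Dehn function is by convention identically infinite. *)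

theory Defs
  imports
    "HOL-Analysis.Analysis"
    "HOL-Algebra.Coset"
    "HOL-Algebra.Generated_Groups"
    "HOL-Library.Extended_Nat"
    "HOL-Library.Landau_Symbols"
begin

section \<open>Free groups\<close>

text \<open>
  A letter \<^term>\<open>(s, False)\<close> stands for the free generator \<open>s\<close> and \<^term>\<open>(s, True)\<close> for its
  formal inverse.  Elements of the free group are reduced words.  When \<open>S\<close> is a symmetric subset of
  a group, the formal inverse of \<open>s\<close> and the generator given by the inverse of \<open>s\<close> in that group are
  different elements of the free group on \<open>S\<close>.
\<close>

type_synonym 'a word = "('a \<times> bool) list"

definition inv_letter :: "'a \<times> bool \<Rightarrow> 'a \<times> bool" where
  "inv_letter x = (fst x, \<not> snd x)"

definition reduced :: "'a word \<Rightarrow> bool" where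
  "reduced w \<longleftrightarrow> successively (\<lambda>x y. y \<noteq> inv_letter x) w"

fun cancel_Cons :: "'a \<times> bool \<Rightarrow> 'a word \<Rightarrow> 'a word" where
  "cancel_Cons x [] = [x]"
| "cancel_Cons x (y # w) = (if y = inv_letter x then w else x # y # w)"

definition free_group :: "'a set \<Rightarrow> 'a word monoid" where
  "free_group S =
    \<lparr>carrier = {w. set w \<subseteq> S \<times> UNIV \<and> reduced w}, mult = (\<lambda>u v. foldr cancel_Cons u v), one = []\<rparr>"

definition free_gens :: "'a set \<Rightarrow> 'a word set" where
  "free_gens S = (\<lambda>s. [(s, False)]) ` S"

definition eval_word :: "('a, 'm) monoid_scheme \<Rightarrow> 'a word \<Rightarrow> 'a" where
  "eval_word G w = foldr (\<lambda>(s, b) g. (if b then inv\<^bsub>G\<^esub> s else s) \<otimes>\<^bsub>G\<^esub> g) w \<one>\<^bsub>G\<^esub>"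

lemma inv_letter_inv_letter [simp]: "inv_letter (inv_letter x) = x"
  by (simp add: inv_letter_def)

lemma reduced_Nil [simp]: "reduced []"
  by (simp add: reduced_def)

lemma reduced_Cons:
  "reduced (x # w) \<longleftrightarrow> reduced w \<and> (w \<noteq> [] \<longrightarrow> hd w \<noteq> inv_letter x)"
  by (cases w) (auto simp: reduced_def)

lemma reduced_cancel_Cons: "reduced w \<Longrightarrow> reduced (cancel_Cons x w)"
  by (cases w) (auto simp: reduced_Cons)

lemma set_cancel_Cons: "set (cancel_Cons x w) \<subseteq> insert x (set w)"
  by (cases w) auto

lemma cancel_Cons_inv:
  "reduced w \<Longrightarrow> cancel_Cons (inv_letter x) (cancel_Cons x w) = w"
  by (cases w rule: remdups_adj.cases) (auto simp: reduced_Cons)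

lemma reduced_foldr: "reduced v \<Longrightarrow> reduced (foldr cancel_Cons u v)"
  by (induction u) (auto intro: reduced_cancel_Cons)

lemma set_foldr: "set (foldr cancel_Cons u v) \<subseteq> set u \<union> set v"
proof (induction u)
  case (Cons a u)
  then show ?case using set_cancel_Cons[of a "foldr cancel_Cons u v"] by auto
qed auto

lemma foldr_cancel_Cons_Cons:
  assumes "reduced w"
  shows "foldr cancel_Cons (cancel_Cons x u) w = cancel_Cons x (foldr cancel_Cons u w)"
proof (cases u)
  case (Cons y v)
  then show ?thesis
    using cancel_Cons_inv[OF reduced_foldr[OF assms], of "inv_letter x" v] by auto
qed simp

lemma foldr_cancel_Cons_assoc:
  assumes "reduced w"
  shows "foldr cancel_Cons (foldr cancel_Cons u v) w = foldr cancel_Cons u (foldr cancel_Cons v w)"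
  by (induction u) (auto simp: foldr_cancel_Cons_Cons[OF assms])

lemma foldr_cancel_Cons_Nil: "reduced u \<Longrightarrow> foldr cancel_Cons u [] = u"
proof (induction u)
  case (Cons a u)
  then show ?case by (cases u) (auto simp: reduced_Cons)
qed simp

lemma free_group_left_inverse:
  "foldr cancel_Cons (foldr cancel_Cons (rev (map inv_letter u)) []) u = []" if "reduced u"
proof -
  have "foldr cancel_Cons (rev (map inv_letter u)) u = []"
    using that
  proof (induction u)
    case (Cons a u)
    then show ?case by (simp add: reduced_Cons)
  qed simp
  then show ?thesis
    using foldr_cancel_Cons_assoc[OF that, of "rev (map inv_letter u)" "[]"] by simp
qed

lemma group_free_group: "group (free_group S)"
proof (rule groupI)
  fix x y assume "x \<in> carrier (free_group S)" "y \<in> carrier (free_group S)"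
  then show "x \<otimes>\<^bsub>free_group S\<^esub> y \<in> carrier (free_group S)"
    using set_foldr[of x y] by (auto simp: free_group_def reduced_foldr)
next
  fix x assume x: "x \<in> carrier (free_group S)"
  let ?y = "foldr cancel_Cons (rev (map inv_letter x)) []"
  have "set ?y \<subseteq> S \<times> UNIV"
    using x set_foldr[of "rev (map inv_letter x)" "[]"]
    by (fastforce simp: free_group_def inv_letter_def)
  then show "\<exists>y\<in>carrier (free_group S). y \<otimes>\<^bsub>free_group S\<^esub> x = \<one>\<^bsub>free_group S\<^esub>"
    using x free_group_left_inverse[of x]
    by (intro bexI[of _ ?y]) (auto simp: free_group_def reduced_foldr)
qed (auto simp: free_group_def foldr_cancel_Cons_assoc)

lemma eval_word_closed:
  assumes "group G" "fst ` set w \<subseteq> carrier G"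
  shows "eval_word G w \<in> carrier G"
  using assms(2)
proof (induction w)
  case Nil
  then show ?case using assms(1) by (simp add: eval_word_def group.is_monoid)
next
  case (Cons a w)
  interpret group G by fact
  from Cons show ?case by (cases a) (auto simp: eval_word_def)
qed

lemma eval_word_cancel_Cons:
  assumes "group G" "fst ` set (x # w) \<subseteq> carrier G"
  shows "eval_word G (cancel_Cons x w) = eval_word G (x # w)"
proof (cases w)
  case (Cons y v)
  interpret group G by fact
  have "eval_word G v \<in> carrier G"
    using assms Cons by (intro eval_word_closed) auto
  then show ?thesis
    using assms(2) Cons by (cases x) (auto simp: eval_word_def inv_letter_def m_assoc[symmetric])
qed simp

lemma eval_word_hom:
  assumes "group G" "S \<subseteq> carrier G"
  shows "eval_word G \<in> hom (free_group S) G"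
proof -
  interpret group G by fact
  have closed: "eval_word G w \<in> carrier G" if "set w \<subseteq> S \<times> UNIV" for w
    using that assms(2) by (intro eval_word_closed[OF assms(1)]) auto
  have "eval_word G (foldr cancel_Cons u v) = eval_word G u \<otimes>\<^bsub>G\<^esub> eval_word G v"
    if "set u \<subseteq> S \<times> UNIV" "set v \<subseteq> S \<times> UNIV" for u v
    using that(1)
  proof (induction u)
    case Nil
    then show ?case using closed[OF that(2)] by (simp add: eval_word_def)
  next
    case (Cons x u)
    have *: "eval_word G (y # w) =
        (if snd y then inv\<^bsub>G\<^esub> fst y else fst y) \<otimes>\<^bsub>G\<^esub> eval_word G w" for y w
      by (cases y) (simp add: eval_word_def)
    have "fst ` set (x # foldr cancel_Cons u v) \<subseteq> carrier G"
      using set_foldr[of u v] Cons.prems that(2) assms(2) by fastforce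
    then have "eval_word G (foldr cancel_Cons (x # u) v) = eval_word G (x # foldr cancel_Cons u v)"
      using eval_word_cancel_Cons[OF assms(1)] by simp
    also have "\<dots> = eval_word G (x # u) \<otimes>\<^bsub>G\<^esub> eval_word G v"
      using Cons closed[of u] closed[OF that(2)] assms(2) by (auto simp: * m_assoc)
    finally show ?case .
  qed
  then show ?thesis
    using closed by (auto simp: hom_def free_group_def)
qed

section \<open>Compact presentations and Dehn functions\<close>

text \<open>Word length takes the value \<open>\<infinity>\<close> (an infimum over the empty set) off the generated subgroup.\<close>

definition word_length :: "('a, 'm) monoid_scheme \<Rightarrow> 'a set \<Rightarrow> 'a \<Rightarrow> enat" where
  "word_length G X g =
    (INF xs \<in> {xs. set xs \<subseteq> X \<union> m_inv G ` X \<and> foldr (mult G) xs \<one>\<^bsub>G\<^esub> = g}. enat (length xs))"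

lemma word_length_free_group:
  assumes "w \<in> carrier (free_group S)"
  shows "word_length (free_group S) (free_gens S) w = enat (length w)"
proof (rule antisym)
  let ?F = "free_group S"
  let ?X = "free_gens S \<union> m_inv ?F ` free_gens S"
  interpret F: group ?F by (rule group_free_group)
  have inv: "inv\<^bsub>?F\<^esub> [(s, False)] = [(s, True)]" if "s \<in> S" for s
    using that by (intro F.inv_equality) (auto simp: free_group_def inv_letter_def reduced_Cons)
  have "set (map (\<lambda>x. [x]) w) \<subseteq> ?X"
  proof
    fix u assume "u \<in> set (map (\<lambda>x. [x]) w)"
    then obtain s b where "u = [(s, b)]" "s \<in> S"
      using assms by (force simp: free_group_def)
    then show "u \<in> ?X"
      using inv[of s] by (cases b) (force simp: free_gens_def)+
  qed
  moreover have "foldr (mult ?F) (map (\<lambda>x. [x]) w) \<one>\<^bsub>?F\<^esub> = w"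
    using assms foldr_cancel_Cons_Nil[of w]
    by (simp add: free_group_def foldr_map comp_def)
  ultimately show "word_length ?F (free_gens S) w \<le> enat (length w)"
    unfolding word_length_def by (intro INF_lower2[of "map (\<lambda>x. [x]) w"]) auto
  have "length (foldr (mult ?F) xs \<one>\<^bsub>?F\<^esub>) \<le> length xs" if "set xs \<subseteq> ?X" for xs
    using that
  proof (induction xs)
    case (Cons u xs)
    then obtain x where u: "u = [x]"
      using inv by (auto simp: free_gens_def)
    have "length (cancel_Cons x v) \<le> Suc (length v)" for v
      by (cases v) auto
    from this[of "foldr (mult ?F) xs \<one>\<^bsub>?F\<^esub>"] Cons u show ?case
      by (simp add: free_group_def)
  qed (simp add: free_group_def)
  then show "enat (length w) \<le> word_length ?F (free_gens S) w"
    unfolding word_length_def by (intro INF_greatest) auto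
qed

definition compact_gen_set :: "('a, 'm) monoid_scheme \<Rightarrow> 'a topology \<Rightarrow> 'a set \<Rightarrow> bool" where
  "compact_gen_set G T S \<longleftrightarrow>
    S \<subseteq> carrier G \<and> compactin T S \<and> (\<forall>s\<in>S. inv\<^bsub>G\<^esub> s \<in> S) \<and> generate G S = carrier G"

definition rel_kernel :: "('a, 'm) monoid_scheme \<Rightarrow> 'a set \<Rightarrow> 'a word set" where
  "rel_kernel G S = kernel (free_group S) G (eval_word G)"

definition relators :: "('a, 'm) monoid_scheme \<Rightarrow> 'a set \<Rightarrow> nat \<Rightarrow> 'a word set" where
  "relators G S r =
    {w \<in> rel_kernel G S. word_length (free_group S) (free_gens S) w \<le> enat r}"

definition conj_relators :: "('a, 'm) monoid_scheme \<Rightarrow> 'a set \<Rightarrow> nat \<Rightarrow> 'a word set" where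
  "conj_relators G S r =
    (\<Union>f \<in> carrier (free_group S).
      (\<lambda>w. f \<otimes>\<^bsub>free_group S\<^esub> w \<otimes>\<^bsub>free_group S\<^esub> inv\<^bsub>free_group S\<^esub> f) ` relators G S r)"

definition presented_by :: "('a, 'm) monoid_scheme \<Rightarrow> 'a set \<Rightarrow> nat \<Rightarrow> bool" where
  "presented_by G S r \<longleftrightarrow> generate (free_group S) (conj_relators G S r) = rel_kernel G S"

definition compactly_presented :: "('a, 'm) monoid_scheme \<Rightarrow> 'a topology \<Rightarrow> bool" where
  "compactly_presented G T \<longleftrightarrow> (\<exists>S. compact_gen_set G T S \<and> (\<exists>r\<ge>1. presented_by G S r))"

definition area :: "('a, 'm) monoid_scheme \<Rightarrow> 'a set \<Rightarrow> nat \<Rightarrow> 'a word \<Rightarrow> enat" where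
  "area G S r w = word_length (free_group S) (conj_relators G S r) w"

definition dehn_function :: "('a, 'm) monoid_scheme \<Rightarrow> 'a set \<Rightarrow> nat \<Rightarrow> nat \<Rightarrow> enat" where
  "dehn_function G S r n =
    (SUP w \<in> {w \<in> rel_kernel G S. word_length (free_group S) (free_gens S) w \<le> enat n}. area G S r w)"

definition at_most_quadratic :: "(nat \<Rightarrow> enat) \<Rightarrow> bool" where
  "at_most_quadratic d \<longleftrightarrow>
    (\<forall>n. d n \<noteq> \<infinity>) \<and> (\<lambda>n. real (the_enat (d n))) \<in> O(\<lambda>n. real n ^ 2)"

text \<open>
  The Dehn function depends on \<open>S\<close> and \<open>r\<close>.  The bound is required for every compact symmetric
  generating set \<open>S\<close> and every sufficiently large \<open>r\<close>.  One cannot ask for it for every \<open>r\<close> with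
  \<^term>\<open>presented_by G S r\<close>: if \<open>S\<close> is not a neighbourhood of the identity, the relators of length at
  most a small \<open>r\<close> may normally generate the kernel with unbounded areas for relations of a fixed
  length.
\<close>

definition quadratic_dehn_function :: "('a, 'm) monoid_scheme \<Rightarrow> 'a topology \<Rightarrow> bool" where
  "quadratic_dehn_function G T \<longleftrightarrow>
    compactly_presented G T \<and>
    (\<forall>S. compact_gen_set G T S \<longrightarrow>
      (\<exists>r0\<ge>1. \<forall>r\<ge>r0. presented_by G S r \<and> at_most_quadratic (dehn_function G S r)))"

section \<open>The groups $A_4(R)$\<close>

text \<open>
  Rows and columns are indexed by \<open>1, 2, 3, 4 :: 4\<close>.  The entries below the diagonal are listed
  explicitly because the order of the type \<open>4\<close>, in which \<open>4 = 0\<close>, is not the one wanted here.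
\<close>

definition A4_carrier :: "('a::comm_ring_1 ^ 4 ^ 4) set" where
  "A4_carrier =
    {A. A $ 1 $ 1 = 1 \<and> A $ 2 $ 2 dvd 1 \<and> A $ 3 $ 3 dvd 1 \<and> A $ 4 $ 4 = 1 \<and>
        A $ 2 $ 1 = 0 \<and> A $ 3 $ 1 = 0 \<and> A $ 3 $ 2 = 0 \<and>
        A $ 4 $ 1 = 0 \<and> A $ 4 $ 2 = 0 \<and> A $ 4 $ 3 = 0}"

definition A4 :: "('a::comm_ring_1 ^ 4 ^ 4) monoid" where
  "A4 = \<lparr>carrier = A4_carrier, mult = (**), one = mat 1\<rparr>"

lemma group_A4: "group (A4 :: ('a::comm_ring_1 ^ 4 ^ 4) monoid)"
proof (rule groupI)
  fix A B :: "'a ^ 4 ^ 4"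
  assume "A \<in> carrier A4" "B \<in> carrier A4"
  then show "A \<otimes>\<^bsub>A4\<^esub> B \<in> carrier A4"
    by (auto simp: A4_def A4_carrier_def matrix_matrix_mult_def sum_4
             intro: mult_dvd_mono[where b = 1 and d = 1, simplified])
next
  fix A :: "'a ^ 4 ^ 4"
  assume A: "A \<in> carrier A4"
  then have "A $ 2 $ 2 dvd 1" "A $ 3 $ 3 dvd 1"
    by (auto simp: A4_def A4_carrier_def)
  then obtain d e where de: "A $ 2 $ 2 * d = 1" "A $ 3 $ 3 * e = 1"
    unfolding dvd_def by metis
  let ?B = "\<chi> i j.
      if i = 1 then
        if j = 1 then 1
        else if j = 2 then - (A $ 1 $ 2 * d)
        else if j = 3 then A $ 1 $ 2 * d * A $ 2 $ 3 * e - A $ 1 $ 3 * e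
        else A $ 1 $ 2 * d * A $ 2 $ 4 + A $ 1 $ 3 * e * A $ 3 $ 4
          - A $ 1 $ 2 * d * A $ 2 $ 3 * e * A $ 3 $ 4 - A $ 1 $ 4
      else if i = 2 then
        if j = 1 then 0 else if j = 2 then d else if j = 3 then - (d * A $ 2 $ 3 * e)
        else d * A $ 2 $ 3 * e * A $ 3 $ 4 - d * A $ 2 $ 4
      else if i = 3 then
        if j = 3 then e else if j = 4 then - (e * A $ 3 $ 4) else 0
      else if j = 4 then 1 else 0 :: 'a ^ 4 ^ 4"
  have "d dvd 1" "e dvd 1"
    using de by (metis dvd_triv_right)+
  then have "?B \<in> carrier A4"
    by (simp add: A4_def A4_carrier_def)
  moreover have red: "d * A $ 2 $ 2 = 1" "e * A $ 3 $ 3 = 1" "d * (x * A $ 2 $ 2) = x"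
      "e * (x * A $ 3 $ 3) = x" "e * (x * (y * A $ 3 $ 3)) = x * y" for x y
  proof -
    show *: "d * A $ 2 $ 2 = 1" "e * A $ 3 $ 3 = 1"
      using de by (simp_all add: mult.commute)
    have "d * (x * A $ 2 $ 2) = x * (d * A $ 2 $ 2)" "e * (x * A $ 3 $ 3) = x * (e * A $ 3 $ 3)"
      "e * (x * (y * A $ 3 $ 3)) = x * (y * (e * A $ 3 $ 3))"
      by (simp_all only: ac_simps)
    then show "d * (x * A $ 2 $ 2) = x" "e * (x * A $ 3 $ 3) = x" "e * (x * (y * A $ 3 $ 3)) = x * y"
      by (simp_all add: *)
  qed
  have "?B \<otimes>\<^bsub>A4\<^esub> A = \<one>\<^bsub>A4\<^esub>"
    using A by (simp add: A4_def A4_carrier_def matrix_matrix_mult_def mat_def vec_eq_iff forall_4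
        sum_4 algebra_simps red)
  ultimately show "\<exists>B\<in>carrier A4. B \<otimes>\<^bsub>A4\<^esub> A = \<one>\<^bsub>A4\<^esub>" by blast
qed (auto simp: A4_def A4_carrier_def matrix_mul_assoc, auto simp: mat_def)

definition A4_topology :: "('a::{comm_ring_1, topological_space} ^ 4 ^ 4) topology" where
  "A4_topology = subtopology euclidean A4_carrier"

end

theory Submission
  imports Defs "HOL-Library.Function_Algebras"
begin

text \<open>
  Write \<open>e\<^sub>i\<^sub>j(x)\<close> for the elementary unipotent matrices and let \<open>D\<close> be the group of the diagonal
  matrices of \<open>A\<^sub>4\<close>.  The entry at \<open>(i,j)\<close> is multiplied by a character of \<open>D\<close> under conjugation, and a
  set of positions is \<^emph>\<open>tame\<close> if a single diagonal matrix contracts all of them.  The tame sets that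
  matter are \<open>{12,13,23}\<close>, \<open>{23,24,34}\<close>, \<open>{13,23,24}\<close> and \<open>{12,34}\<close>.  Only the corner \<open>14\<close> has the trivial
  character and lies in no tame set.

  The proof rests on three facts.

  \<^item> \<^emph>\<open>Tame relations have quadratic area.\<close>  The element \<open>e\<^sub>i\<^sub>j(x)\<close> is spelled as \<open>t\<^sup>m s t\<^sup>-\<^sup>m\<close>, where \<open>t\<close> is
    diagonal and expands the position \<open>(i,j)\<close>, \<open>s = e\<^sub>i\<^sub>j(v)\<close> is a bounded element, and \<open>m\<close> grows like the logarithm of \<open>x\<close>.
    Conjugating such a word by a diagonal word of length \<open>n\<close> costs \<open>O(n\<^sup>2)\<close>
    (lemma \<open>HH_EE\<close>).  A relation between elements at the positions of one tame set can therefore be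
    contracted to a relation between bounded elements, which has bounded length
    (lemmas \<open>EE_commute\<close>, \<open>EE_bracket\<close>, \<open>EE_add\<close>).

  \<^item> \<^emph>\<open>The tame relations imply all the others.\<close>  Since \<open>e\<^sub>1\<^sub>2\<close> and \<open>e\<^sub>3\<^sub>4\<close> commute, a form of the
    Hall-Witt identity shows that \<open>[e\<^sub>1\<^sub>2(x), e\<^sub>2\<^sub>4(y)]\<close> and \<open>[e\<^sub>1\<^sub>3(x), e\<^sub>3\<^sub>4(y)]\<close> depend only on \<open>xy\<close>,
    agree, and are central (Abels).  This uses a bounded number of tame relations whose parameters
    are polynomials in the given ones (locale \<open>unipotent_amalgam\<close>, theorem \<open>unip_mult\<close>).  Hence normal forms of
    matrices of logarithmic size \<open>n\<close> can be multiplied at cost \<open>O(n\<^sup>2)\<close> (theorem \<open>triangle_area\<close>).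

  \<^item> \<^emph>\<open>Triangles suffice\<close> (Gromov).  Cut a word of length \<open>n\<close> into halves again and again and fill the
    triangles between the normal forms.  The costs \<open>2\<^sup>k C (n/2\<^sup>k)\<^sup>2\<close> sum to \<open>O(n\<^sup>2)\<close>
    (lemma \<open>area_of_combing\<close>).

  Constants are not tracked in the first two facts.  Instead, consider families of words indexed by a set with a
  length function \<open>len\<close>, modulo the families whose area is \<open>O(len\<^sup>2)\<close>.  These classes form a group
  \<open>\<Gamma>\<close>.  The families \<open>x\<close> of field elements with logarithmic size \<open>O(len)\<close> form a ring, and the two facts
  become exact equations in \<open>\<Gamma>\<close> with parameters in that ring.  Applied to the family of \<^emph>\<open>all\<close> triangles,
  the equations give uniform constants.

  The field enters only through a contracting element \<open>\<mu>\<close> and a compact set \<open>V\<close> into which the powers of \<open>\<mu>\<close>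
  carry every compact set (lemma \<open>scaled_field_exists\<close>).  An arbitrary compact generating set \<open>S\<close> is handled by Baire's theorem:
  the bounded elements \<open>s\<close> are products of a bounded number of elements of \<open>S\<close>
  (locale \<open>compactly_generated\<close>).
\<close>

section \<open>Contractions of a locally compact field\<close>

lemma continuous_on_times_pair:
  "continuous_on UNIV (\<lambda>p::'k::{comm_ring_1, topological_semigroup_mult} \<times> 'k. fst p * snd p)"
  unfolding continuous_on_def by (intro ballI tendsto_mult tendsto_fst tendsto_snd tendsto_ident_at)

lemma continuous_on_mult_topological:
  fixes f g :: "_ \<Rightarrow> 'k::{comm_ring_1, topological_semigroup_mult}"
  shows "continuous_on A f \<Longrightarrow> continuous_on A g \<Longrightarrow> continuous_on A (\<lambda>x. f x * g x)"
  unfolding continuous_on_def by (auto intro: tendsto_mult)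

lemma nhds_mult_compact:
  fixes B U :: "'k::{comm_ring_1, topological_semigroup_mult} set"
  assumes "compact B" "open U" "0 \<in> U"
  obtains W where "open W" "0 \<in> W" "\<And>w b. w \<in> W \<Longrightarrow> b \<in> B \<Longrightarrow> w * b \<in> U"
proof -
  have op: "open ((\<lambda>p::'k\<times>'k. fst p * snd p) -` U)"
    using continuous_on_open_vimage[of UNIV "\<lambda>p::'k\<times>'k. fst p * snd p"]
      continuous_on_times_pair assms(2) by auto
  have "{0} \<times> B \<subseteq> (\<lambda>p. fst p * snd p) -` U"
    using assms(3) by auto
  from Elementary_Topology.tube_lemma[OF assms(1) op this]
  have "\<exists>W. open W \<and> 0 \<in> W \<and> W \<times> B \<subseteq> (\<lambda>p. fst p * snd p) -` U"
    by blast
  then show thesis using that by (fastforce simp: subset_iff)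
qed

lemma compact_sums_topological:
  fixes A B :: "'k::topological_ab_group_add set"
  assumes "compact A" "compact B"
  shows "compact {x + y | x y. x \<in> A \<and> y \<in> B}"
proof -
  have "{x + y | x y. x \<in> A \<and> y \<in> B} = (\<lambda>p. fst p + snd p) ` (A \<times> B)"
    by force
  moreover have "continuous_on (A \<times> B) (\<lambda>p. fst p + snd p)"
    unfolding continuous_on_def by (intro ballI tendsto_add tendsto_fst tendsto_snd tendsto_ident_at)
  ultimately show ?thesis
    using compact_continuous_image compact_Times[OF assms] by metis
qed

lemma compact_mults_topological:
  fixes A B :: "'k::{comm_ring_1, topological_semigroup_mult} set"
  assumes "compact A" "compact B"
  shows "compact {x * y | x y. x \<in> A \<and> y \<in> B}"
proof -
  have "{x * y | x y. x \<in> A \<and> y \<in> B} = (\<lambda>p. fst p * snd p) ` (A \<times> B)"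
    by force
  then show ?thesis
    using compact_continuous_image[OF continuous_on_subset[OF continuous_on_times_pair]]
      compact_Times[OF assms] by (metis subset_UNIV)
qed

lemma nondiscrete_imp_not_open_0:
  assumes "(euclidean :: 'k::{comm_ring_1, topological_ab_group_add} topology) \<noteq> discrete_topology UNIV"
  shows "\<not> open {0::'k}"
proof
  assume op: "open {0::'k}"
  have "open {a}" for a :: 'k
  proof -
    have "open ((\<lambda>x. x - a) -` {0})"
      by (rule open_vimage[OF op]) (intro continuous_intros)
    moreover have "(\<lambda>x. x - a) -` {0} = {a}" by auto
    ultimately show ?thesis by simp
  qed
  then have "euclidean = discrete_topology (UNIV :: 'k set)"
    by (metis discrete_topology_unique open_openin topspace_euclidean UNIV_I)
  with assms show False by simp
qed

text \<open>
  Choose \<open>V\<close> compact with \<open>1 \<notin> V\<close>, and \<open>\<mu> \<noteq> 0\<close> so small that \<open>\<mu>V \<subseteq> V\<close>.  The powers of \<open>\<mu>\<close> accumulate at some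
  \<open>h \<in> V\<close>.  If \<open>h\<close> were not \<open>0\<close>, quotients of powers close to \<open>h\<close> would be positive powers of \<open>\<mu>\<close>, hence in \<open>V\<close>,
  and close to \<open>1\<close>, which is not in \<open>V\<close>.  So some powers are arbitrarily small, and then so are all later ones.
\<close>

lemma topologically_nilpotent_element:
  assumes inverse_continuous:
    "continuous_on (UNIV - {0}) (inverse :: 'k::{field, t2_space, topological_ab_group_add, topological_semigroup_mult} \<Rightarrow> 'k)"
    and locally_compact: "locally_compact_space (euclidean :: 'k topology)"
    and nondiscrete: "(euclidean :: 'k topology) \<noteq> discrete_topology UNIV"
  obtains \<mu> :: "'k::{field, t2_space, topological_ab_group_add, topological_semigroup_mult}" and V U :: "'k::{field, t2_space, topological_ab_group_add, topological_semigroup_mult} set"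
  where "\<mu> \<noteq> 0" "(\<lambda>n. \<mu> ^ n) \<longlonglongrightarrow> 0" "compact V" "open U" "0 \<in> U" "U \<subseteq> V"
proof -
  have "\<exists>U K. openin euclidean U \<and> compactin euclidean K \<and> (0::'k) \<in> U \<and> U \<subseteq> K"
    using locally_compact unfolding locally_compact_space_def topspace_euclidean by blast
  then obtain U0 K0 where U0: "open U0" "compact K0" "(0::'k) \<in> U0" "U0 \<subseteq> K0"
    by (metis compactin_euclidean_iff open_openin)
  obtain U1 U2 where U12: "open U1" "open U2" "(0::'k) \<in> U1" "1 \<in> U2" "U1 \<inter> U2 = {}"
    using hausdorff[of "0::'k" 1] by auto
  define V where "V = K0 - U2"
  define U where "U = U0 \<inter> U1"
  have V: "compact V" "open U" "0 \<in> U" "U \<subseteq> V" "1 \<notin> V"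
    using U0 U12 by (auto simp: V_def U_def intro: compact_diff)
  obtain W where W: "open W" "0 \<in> W" "\<And>w b. w \<in> W \<Longrightarrow> b \<in> V \<Longrightarrow> w * b \<in> U"
    using nhds_mult_compact[OF V(1-3)] by blast
  have "\<not> open {0::'k}"
    by (rule nondiscrete_imp_not_open_0[OF nondiscrete])
  then have "W \<inter> U \<noteq> {0}"
    using W(1) V(2) by (metis open_Int)
  then obtain \<mu> where \<mu>: "\<mu> \<in> W" "\<mu> \<in> U" "\<mu> \<noteq> 0"
    using W(2) V(3) by auto
  have pow: "\<mu> ^ Suc n \<in> V" for n
    using \<mu> W(3) V(4) by (induction n) auto
  \<comment> \<open>A cluster point of the sequence of powers, obtained by compactness.\<close>
  define F where "F = filtermap (\<lambda>n. \<mu> ^ Suc n) sequentially"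
  have "F \<noteq> bot" "eventually (\<lambda>x. x \<in> V) F"
    using pow by (auto simp: F_def filtermap_bot_iff eventually_filtermap)
  then obtain h where h: "h \<in> V" "inf (nhds h) F \<noteq> bot"
    using V(1) unfolding compact_filter by blast
  have freq: "\<exists>n\<ge>m. \<mu> ^ Suc n \<in> A" if "open A" "h \<in> A" for A m
  proof (rule ccontr)
    assume "\<not> ?thesis"
    then have "eventually (\<lambda>x. x \<notin> A) F"
      unfolding F_def eventually_filtermap eventually_sequentially by auto
    moreover have "eventually (\<lambda>x. x \<in> A) (nhds h)"
      using that by (simp add: eventually_nhds_in_open)
    ultimately have "eventually (\<lambda>x. False) (inf (nhds h) F)"
      unfolding eventually_inf by blast
    with h(2) show False by (simp add: trivial_limit_def)
  qed
  have h0: "h = 0"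
  proof (rule ccontr)
    assume "h \<noteq> 0"
    let ?f = "\<lambda>p::'k \<times> 'k. fst p * inverse (snd p)"
    let ?D = "UNIV \<times> (UNIV - {0::'k})"
    have "open ?D" by (intro open_Times) auto
    have "continuous_on ?D (\<lambda>p. inverse (snd p))"
      by (rule continuous_on_compose2[OF inverse_continuous]) (auto intro: continuous_intros)
    then have "continuous_on ?D ?f"
      by (intro continuous_on_mult_topological continuous_on_fst continuous_on_id)
    moreover have "open (- V)"
      using V(1) compact_imp_closed by blast
    ultimately have "open (?f -` (- V) \<inter> ?D)"
      using continuous_on_open_vimage[OF \<open>open ?D\<close>] by blast
    moreover have "(h, h) \<in> ?f -` (- V) \<inter> ?D"
      using \<open>h \<noteq> 0\<close> V(5) by auto
    ultimately obtain A B where AB': "open A" "open B" "(h, h) \<in> A \<times> B" "A \<times> B \<subseteq> ?f -` (- V) \<inter> ?D"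
      by (rule open_prod_elim)
    then have AB: "open A" "open B" "h \<in> A" "h \<in> B" "A \<times> B \<subseteq> ?f -` (- V) \<inter> ?D"
      by auto
    obtain n where n: "\<mu> ^ Suc n \<in> B" using freq[OF AB(2,4)] by blast
    obtain m where m: "m \<ge> Suc n" "\<mu> ^ Suc m \<in> A" using freq[OF AB(1,3)] by blast
    have "\<mu> ^ Suc m * inverse (\<mu> ^ Suc n) \<notin> V"
      using n m AB(5) by fastforce
    moreover have "\<mu> ^ Suc m * inverse (\<mu> ^ Suc n) = \<mu> ^ (m - n)"
      using m(1) \<mu>(3) by (simp add: field_simps power_add[symmetric] flip: power_Suc)
    moreover have "m - n = Suc (m - Suc n)" using m(1) by simp
    ultimately show False using pow by metis
  qed
  have "(\<lambda>n. \<mu> ^ n) \<longlonglongrightarrow> 0"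
  proof (rule topological_tendstoI)
    fix N assume N: "open N" "(0::'k) \<in> N"
    have "compact (insert 1 V)" using V(1) by (rule compact_insert)
    then obtain W' where W': "open W'" "0 \<in> W'" "\<And>w b. w \<in> W' \<Longrightarrow> b \<in> insert 1 V \<Longrightarrow> w * b \<in> N"
      using nhds_mult_compact[OF _ N] by blast
    obtain k where k: "\<mu> ^ Suc k \<in> W'" using freq[of W'] W'(1,2) h0 by blast
    have "\<mu> ^ n \<in> N" if "n \<ge> Suc k" for n
    proof -
      have "\<mu> ^ n = \<mu> ^ Suc k * \<mu> ^ (n - Suc k)"
        using that by (metis le_add_diff_inverse power_add)
      moreover have "\<mu> ^ (n - Suc k) \<in> insert 1 V"
        using pow by (cases "n - Suc k") auto
      ultimately show ?thesis using W'(3) k by metis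
    qed
    then show "\<forall>\<^sub>F n in sequentially. \<mu> ^ n \<in> N"
      unfolding eventually_sequentially by blast
  qed
  then show thesis using that[OF \<mu>(3) _ V(1-4)] by blast
qed

text \<open>
  The set \<open>\<mu>\<^sup>-\<^sup>n V\<close> plays the role of the ball of logarithmic radius \<open>n\<close>.  The last two assumptions say
  that \<open>\<mu>\<close> really contracts and that every nonzero element is, up to a bounded factor, a power of \<open>\<mu>\<close>; a single
  constant \<open>\<kappa>\<close> measures both bounds.
\<close>

locale scaled_field =
  fixes V :: "'k::field set" and \<mu> :: 'k and \<kappa> :: nat
  assumes mu_nz: "\<mu> \<noteq> 0"
    and one_V: "1 \<in> V"
    and minus_V: "x \<in> V \<Longrightarrow> - x \<in> V"
    and mu_V: "x \<in> V \<Longrightarrow> \<mu> * x \<in> V"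
    and add_V: "x \<in> V \<Longrightarrow> y \<in> V \<Longrightarrow> \<mu> * (x + y) \<in> V"
    and mult_V: "x \<in> V \<Longrightarrow> y \<in> V \<Longrightarrow> \<mu> * (x * y) \<in> V"
    and absorb_V: "\<exists>n. \<mu> ^ n * x \<in> V"
    and powers_V: "inverse \<mu> ^ n \<in> V \<Longrightarrow> n \<le> \<kappa>"
    and polar: "x \<noteq> 0 \<Longrightarrow> \<exists>k c. x = \<mu> powi k * c \<and> \<mu> ^ \<kappa> * c \<in> V \<and> \<mu> ^ \<kappa> * inverse c \<in> V"

text \<open>
  A high power \<open>\<mu>\<close> of a topologically nilpotent element maps the compact set of all \<open>x\<close>, \<open>x + y\<close>, \<open>xy\<close> with
  \<open>x, y \<in> V\<close> into \<open>V\<close>.  The polar decomposition takes \<open>c\<close> in the shell \<open>V - \<mu>V\<close>, which is contained in a compact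
  set that avoids \<open>0\<close>, so the inverses are bounded too.
\<close>

lemma scaled_field_exists:
  assumes inverse_continuous:
    "continuous_on (UNIV - {0}) (inverse :: 'k::{field, t2_space, topological_ab_group_add, topological_semigroup_mult} \<Rightarrow> 'k)"
    and locally_compact: "locally_compact_space (euclidean :: 'k topology)"
    and nondiscrete: "(euclidean :: 'k topology) \<noteq> discrete_topology UNIV"
  obtains V :: "'k::{field, t2_space, topological_ab_group_add, topological_semigroup_mult} set" and \<mu> :: "'k::{field, t2_space, topological_ab_group_add, topological_semigroup_mult}" and \<kappa>
  where "scaled_field V \<mu> \<kappa>" "compact V"
    "\<And>B. compact B \<Longrightarrow> \<exists>n. \<forall>b\<in>B. \<mu> ^ n * b \<in> V"
proof -
  obtain \<mu>0 :: 'k and V0 U :: "'k set" where mu0: "\<mu>0 \<noteq> 0" "(\<lambda>n. \<mu>0 ^ n) \<longlonglongrightarrow> 0" "compact V0" "open U" "0 \<in> U" "U \<subseteq> V0"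
    using topologically_nilpotent_element[OF assms] by blast
  define V where "V = insert 1 (insert (-1) (V0 \<union> uminus ` V0))"
  have "compact (uminus ` V0)"
    by (rule compact_continuous_image[OF _ mu0(3)]) (intro continuous_intros)
  then have V: "compact V" "U \<subseteq> V" "1 \<in> V"
    using mu0 by (auto simp: V_def intro!: compact_insert compact_Un)
  have minus: "- x \<in> V" if x: "x \<in> V" for x
  proof -
    consider "x = 1" | "x = -1" | "x \<in> V0" | y where "y \<in> V0" "x = - y"
      using x unfolding V_def insert_iff Un_iff image_iff by blast
    then show ?thesis
      by cases (simp_all add: V_def)
  qed
  define E where "E = V \<union> {x + y | x y. x \<in> V \<and> y \<in> V} \<union> {x * y | x y. x \<in> V \<and> y \<in> V}"
  have "compact E"
    unfolding E_def
    by (rule compact_Un[OF compact_Un[OF V(1) compact_sums_topological[OF V(1) V(1)]]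
          compact_mults_topological[OF V(1) V(1)]])
  have small: "\<exists>n0. \<forall>n\<ge>n0. \<forall>b\<in>B. \<mu>0 ^ n * b \<in> N" if BN: "compact B" "open N" "0 \<in> N" for B N
  proof -
    obtain W where W: "open W" "0 \<in> W" "\<And>w b. w \<in> W \<Longrightarrow> b \<in> B \<Longrightarrow> w * b \<in> N"
      using nhds_mult_compact[OF BN] by blast
    have "\<forall>\<^sub>F n in sequentially. \<mu>0 ^ n \<in> W"
      using topological_tendstoD[OF mu0(2) W(1,2)] .
    then show ?thesis
      unfolding eventually_sequentially using W(3) by blast
  qed
  obtain m0 where m0: "\<And>n b. n \<ge> m0 \<Longrightarrow> b \<in> E \<Longrightarrow> \<mu>0 ^ n * b \<in> U"
    using small[OF \<open>compact E\<close> mu0(4,5)] by blast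
  define \<mu> where "\<mu> = \<mu>0 ^ Suc m0"
  have mu: "\<mu> \<noteq> 0" using mu0 by (simp add: \<mu>_def)
  have pow: "\<mu> ^ n = \<mu>0 ^ (Suc m0 * n)" for n
    by (simp add: \<mu>_def power_mult[symmetric] del: power_Suc)
  have small': "\<exists>n0. \<forall>n\<ge>n0. \<forall>b\<in>B. \<mu> ^ n * b \<in> N" if BN: "compact B" "open N" "0 \<in> N" for B N
  proof -
    obtain n0 where n0: "\<And>n b. n \<ge> n0 \<Longrightarrow> b \<in> B \<Longrightarrow> \<mu>0 ^ n * b \<in> N" using small[OF BN] by blast
    have "\<mu> ^ n * b \<in> N" if "n \<ge> n0" "b \<in> B" for n b
      using n0[of "Suc m0 * n" b] that unfolding pow by (simp add: trans_le_add1)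
    then show ?thesis by blast
  qed
  have E: "\<mu> * b \<in> V" if "b \<in> E" for b
    using m0[of "Suc m0" b] that V(2) unfolding \<mu>_def by (meson le_SucI order_refl subsetD)
  have bounded: "\<exists>n. \<forall>b\<in>B. \<mu> ^ n * b \<in> V" if "compact B" for B
    using small'[OF that mu0(4,5)] V(2) by blast
  have muV: "\<mu> * x \<in> V" if "x \<in> V" for x using E[unfolded E_def] that by blast
  have mono: "\<mu> ^ (n + k) * x \<in> V" if "\<mu> ^ n * x \<in> V" for n k x
    using that by (induction k) (auto dest: muV simp: mult.assoc)
  have avoid: "\<exists>n0. \<forall>n\<ge>n0. inverse \<mu> ^ n * x \<notin> V" if x: "x \<noteq> 0" for x
  proof -
    obtain n0 where n0: "\<And>n b. n \<ge> n0 \<Longrightarrow> b \<in> V \<Longrightarrow> \<mu> ^ n * b \<in> - {x}"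
      using small'[OF V(1) open_Compl[OF closed_singleton, of x]] x by auto
    have "inverse \<mu> ^ n * x \<notin> V" if "n \<ge> n0" for n
      using n0[OF that, of "inverse \<mu> ^ n * x"] mu by (auto simp: field_simps)
    then show ?thesis by blast
  qed
  obtain k1 where k1: "\<And>n. n \<ge> k1 \<Longrightarrow> inverse \<mu> ^ n * 1 \<notin> V" using avoid[of 1] by auto
  \<comment> \<open>Contains the shell \<open>V - \<mu>V\<close>; removing \<open>\<mu>U\<close>, which is open, leaves a compact set.\<close>
  define Q where "Q = V - (\<lambda>c. inverse \<mu> * c) -` U"
  have cont: "continuous_on UNIV (\<lambda>c. inverse \<mu> * c)"
    by (rule continuous_on_mult_topological[OF continuous_on_const continuous_on_id])
  have "open ((\<lambda>c. inverse \<mu> * c) -` U)"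
    by (rule open_vimage[OF mu0(4) cont])
  then have "compact Q" unfolding Q_def by (rule compact_diff[OF V(1)])
  have "0 \<notin> Q" using mu0(5) by (simp add: Q_def)
  then have "Q \<subseteq> UNIV - {0}" by blast
  have "compact (inverse ` Q)"
    by (rule compact_continuous_image[OF continuous_on_subset[OF inverse_continuous \<open>Q \<subseteq> UNIV - {0}\<close>] \<open>compact Q\<close>])
  then obtain k2 where k2: "\<And>c. c \<in> Q \<Longrightarrow> \<mu> ^ k2 * inverse c \<in> V"
    using bounded[OF \<open>compact (inverse ` Q)\<close>] by auto
  define \<kappa> where "\<kappa> = k1 + k2"
  have "scaled_field V \<mu> \<kappa>"
  proof
    show "\<mu> \<noteq> 0" by fact
    show "1 \<in> V" by fact
    show "- x \<in> V" if "x \<in> V" for x using minus that .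
    show "\<mu> * x \<in> V" if "x \<in> V" for x using muV that .
    show "\<mu> * (x + y) \<in> V" if "x \<in> V" "y \<in> V" for x y using E[unfolded E_def] that by blast
    show "\<mu> * (x * y) \<in> V" if "x \<in> V" "y \<in> V" for x y using E[unfolded E_def] that by blast
    show "\<exists>n. \<mu> ^ n * x \<in> V" for x using bounded[of "{x}"] by auto
    show "n \<le> \<kappa>" if "inverse \<mu> ^ n \<in> V" for n
      using k1[of n] that by (cases "n \<ge> k1") (auto simp: \<kappa>_def)
  next
    fix x :: 'k assume x: "x \<noteq> 0"
    obtain N where N: "inverse \<mu> ^ N * x \<notin> V" using avoid[OF x] by blast
    \<comment> \<open>Shifting by \<open>N\<close> makes the exponent sought a natural number.\<close>
    define y where "y = inverse \<mu> ^ N * x"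
    define n where "n = (LEAST n. \<mu> ^ n * y \<in> V)"
    have n: "\<mu> ^ n * y \<in> V" unfolding n_def by (rule LeastI_ex) (use bounded[of "{y}"] in auto)
    have "n \<noteq> 0"
    proof
      assume "n = 0"
      with n N show False by (simp add: y_def)
    qed
    then obtain n' where n': "n = Suc n'" by (cases n) auto
    have "\<mu> ^ n' * y \<notin> V" using not_less_Least[of n' "\<lambda>n. \<mu> ^ n * y \<in> V"] n' n_def by auto
    moreover have "inverse \<mu> * (\<mu> ^ n * y) = \<mu> ^ n' * y" using mu n' by (simp add: field_simps)
    ultimately have "inverse \<mu> * (\<mu> ^ n * y) \<notin> U" using V(2) by (metis subsetD)
    then have Q: "\<mu> ^ n * y \<in> Q" using n by (simp add: Q_def)
    let ?c = "\<mu> ^ n * y"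
    have "x = \<mu> powi (int N - int n) * ?c"
      using mu by (simp add: y_def power_int_diff field_simps)
    moreover have "\<mu> ^ \<kappa> * ?c \<in> V" using mono[of 0 ?c \<kappa>] n by simp
    moreover have "\<mu> ^ \<kappa> * inverse ?c \<in> V" using mono[OF k2[OF Q], of k1] by (simp add: \<kappa>_def add.commute)
    ultimately show "\<exists>k c. x = \<mu> powi k * c \<and> \<mu> ^ \<kappa> * c \<in> V \<and> \<mu> ^ \<kappa> * inverse c \<in> V" by blast
  qed
  then show thesis using that[OF _ V(1)] bounded by blast
qed

section \<open>Amalgams of unipotent groups\<close>

context group
begin

text \<open>
  Turns an equation for a product of two elements into a rewrite rule for right-nested products.
\<close>

lemma m_assoc_subst: "a \<otimes> b = c \<Longrightarrow> a \<in> carrier G \<Longrightarrow> b \<in> carrier G \<Longrightarrow> k \<in> carrier G \<Longrightarrow> a \<otimes> (b \<otimes> k) = c \<otimes> k"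
  by (simp add: m_assoc[symmetric])

lemma commute_inv:
  assumes "a \<otimes> b = b \<otimes> a" "a \<in> carrier G" "b \<in> carrier G"
  shows "a \<otimes> inv b = inv b \<otimes> a"
proof -
  have "inv b \<otimes> (a \<otimes> b) = a"
    using assms by (simp add: m_assoc[symmetric])
  then have "a \<otimes> inv b = inv b \<otimes> (a \<otimes> b) \<otimes> inv b"
    by simp
  also have "\<dots> = inv b \<otimes> a"
    using assms(2,3) by (simp add: m_assoc)
  finally show ?thesis .
qed

lemma commute_mult:
  assumes "a \<otimes> b = b \<otimes> a" "a \<otimes> c = c \<otimes> a" "a \<in> carrier G" "b \<in> carrier G" "c \<in> carrier G"
  shows "a \<otimes> (b \<otimes> c) = (b \<otimes> c) \<otimes> a"
  using assms by (metis m_assoc)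

lemma commute_commutator:
  assumes "a \<otimes> b = b \<otimes> a" "a \<otimes> c = c \<otimes> a" "a \<in> carrier G" "b \<in> carrier G" "c \<in> carrier G"
  shows "a \<otimes> (b \<otimes> c \<otimes> inv b \<otimes> inv c) = (b \<otimes> c \<otimes> inv b \<otimes> inv c) \<otimes> a"
  using assms by (intro commute_mult commute_inv) auto

end

text \<open>
  The five subgroups \<open>e\<^sub>i\<^sub>j\<close> with the relations of the tame subsets of positions.  The maps are constrained on
  \<open>R\<close> only, because in the application \<open>R\<close> consists of the families of field elements of bounded growth.
\<close>

locale unipotent_amalgam = group \<Gamma> for \<Gamma> (structure) +
  fixes R :: "'r::comm_ring_1 set" and e12 e13 e23 e24 e34 :: "'r \<Rightarrow> 'g"
  assumes R_one: "1 \<in> R"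
    and R_add: "x \<in> R \<Longrightarrow> y \<in> R \<Longrightarrow> x + y \<in> R"
    and R_mult: "x \<in> R \<Longrightarrow> y \<in> R \<Longrightarrow> x * y \<in> R"
    and closed: "e12 x \<in> carrier \<Gamma>" "e13 x \<in> carrier \<Gamma>" "e23 x \<in> carrier \<Gamma>"
      "e24 x \<in> carrier \<Gamma>" "e34 x \<in> carrier \<Gamma>"
    and add12: "x \<in> R \<Longrightarrow> y \<in> R \<Longrightarrow> e12 x \<otimes> e12 y = e12 (x + y)"
    and add13: "x \<in> R \<Longrightarrow> y \<in> R \<Longrightarrow> e13 x \<otimes> e13 y = e13 (x + y)"
    and add23: "x \<in> R \<Longrightarrow> y \<in> R \<Longrightarrow> e23 x \<otimes> e23 y = e23 (x + y)"
    and add24: "x \<in> R \<Longrightarrow> y \<in> R \<Longrightarrow> e24 x \<otimes> e24 y = e24 (x + y)"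
    and add34: "x \<in> R \<Longrightarrow> y \<in> R \<Longrightarrow> e34 x \<otimes> e34 y = e34 (x + y)"
    and comm1223: "x \<in> R \<Longrightarrow> y \<in> R \<Longrightarrow> e12 x \<otimes> e23 y = e13 (x * y) \<otimes> (e23 y \<otimes> e12 x)"
    and comm2334: "x \<in> R \<Longrightarrow> y \<in> R \<Longrightarrow> e23 x \<otimes> e34 y = e24 (x * y) \<otimes> (e34 y \<otimes> e23 x)"
    and comm1213: "x \<in> R \<Longrightarrow> y \<in> R \<Longrightarrow> e12 x \<otimes> e13 y = e13 y \<otimes> e12 x"
    and comm1234: "x \<in> R \<Longrightarrow> y \<in> R \<Longrightarrow> e12 x \<otimes> e34 y = e34 y \<otimes> e12 x"
    and comm2313: "x \<in> R \<Longrightarrow> y \<in> R \<Longrightarrow> e23 x \<otimes> e13 y = e13 y \<otimes> e23 x"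
    and comm2324: "x \<in> R \<Longrightarrow> y \<in> R \<Longrightarrow> e23 x \<otimes> e24 y = e24 y \<otimes> e23 x"
    and comm1324: "x \<in> R \<Longrightarrow> y \<in> R \<Longrightarrow> e13 x \<otimes> e24 y = e24 y \<otimes> e13 x"
    and comm3424: "x \<in> R \<Longrightarrow> y \<in> R \<Longrightarrow> e34 x \<otimes> e24 y = e24 y \<otimes> e34 x"
begin

lemmas R_closed [simp] = R_one R_add R_mult
lemmas [simp] = closed

text \<open>
  The corner is not given; it is the commutator of \<open>e\<^sub>1\<^sub>3(x)\<close> and \<open>e\<^sub>3\<^sub>4(1)\<close>.
\<close>

definition e14 :: "'r \<Rightarrow> 'g" where
  "e14 x = e13 x \<otimes> e34 1 \<otimes> inv (e13 x) \<otimes> inv (e34 1)"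

lemma e14_closed [simp]: "e14 x \<in> carrier \<Gamma>"
  by (simp add: e14_def)

text \<open>
  Conjugate \<open>[e\<^sub>2\<^sub>3(y), e\<^sub>3\<^sub>4(z)] = e\<^sub>2\<^sub>4(yz)\<close> by \<open>e\<^sub>1\<^sub>2(x)\<close>, which fixes \<open>e\<^sub>3\<^sub>4(z)\<close> and multiplies \<open>e\<^sub>2\<^sub>3(y)\<close> by
  \<open>e\<^sub>1\<^sub>3(xy)\<close>.  This is the relation that links the two commutators which should give the corner:
  \<open>[e\<^sub>1\<^sub>2(x), e\<^sub>2\<^sub>4(yz)]\<close> is governed by \<open>[e\<^sub>1\<^sub>3(xy), e\<^sub>3\<^sub>4(z)]\<close>.
\<close>

lemma hall_witt:
  assumes [simp]: "x \<in> R" "y \<in> R" "z \<in> R"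
  shows "e12 x \<otimes> e24 (y * z) =
    e24 (y * z) \<otimes> ((e13 (x * y) \<otimes> e34 z \<otimes> inv (e13 (x * y)) \<otimes> inv (e34 z)) \<otimes> e12 x)"
    (is "_ = _ \<otimes> (?c \<otimes> _)")
proof -
  let ?w = "e12 x \<otimes> (e23 y \<otimes> e34 z)"
  have "?w = e13 (x * y) \<otimes> (e23 y \<otimes> (e34 z \<otimes> e12 x))"
    by (simp add: m_assoc m_assoc_subst[OF comm1223] comm1234)
  also have "\<dots> = e24 (y * z) \<otimes> (e13 (x * y) \<otimes> (e34 z \<otimes> (e23 y \<otimes> e12 x)))"
    by (simp add: m_assoc m_assoc_subst[OF comm2334] m_assoc_subst[OF comm1324])
  also have "e23 y \<otimes> e12 x = inv (e13 (x * y)) \<otimes> (e12 x \<otimes> e23 y)"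
    by (simp add: comm1223 m_assoc[symmetric])
  also have "e24 (y * z) \<otimes> (e13 (x * y) \<otimes> (e34 z \<otimes> (inv (e13 (x * y)) \<otimes> (e12 x \<otimes> e23 y))))
    = e24 (y * z) \<otimes> ((?c \<otimes> e12 x) \<otimes> (e34 z \<otimes> e23 y))"
    by (simp add: m_assoc m_assoc_subst[OF comm1234]) (simp add: m_assoc[symmetric])
  finally have *: "?w = (e24 (y * z) \<otimes> (?c \<otimes> e12 x)) \<otimes> (e34 z \<otimes> e23 y)"
    by (simp add: m_assoc)
  have "?w = (e12 x \<otimes> e24 (y * z)) \<otimes> (e34 z \<otimes> e23 y)"
    by (simp add: m_assoc comm2334)
  with * show ?thesis
    by (metis (no_types, lifting) closed m_closed inv_closed right_cancel)
qed

text \<open>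
  The left side of \<open>hall_witt\<close> depends on \<open>y\<close> and \<open>z\<close> through \<open>yz\<close> only, so the parameters \<open>(1, z)\<close> and \<open>(z, 1)\<close> give
  the same commutator.
\<close>

lemma commutator1334:
  assumes [simp]: "x \<in> R" "z \<in> R"
  shows "e13 x \<otimes> e34 z \<otimes> inv (e13 x) \<otimes> inv (e34 z) = e14 (x * z)" (is "?c = _")
proof -
  have "e24 z \<otimes> (?c \<otimes> e12 x) = e24 z \<otimes> (e14 (x * z) \<otimes> e12 x)"
    using hall_witt[of x 1 z] hall_witt[of x z 1] by (simp add: e14_def)
  then show ?thesis by simp
qed

lemma comm1334: "x \<in> R \<Longrightarrow> y \<in> R \<Longrightarrow> e13 x \<otimes> e34 y = e14 (x * y) \<otimes> (e34 y \<otimes> e13 x)"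
  by (simp add: commutator1334[symmetric] m_assoc) (simp add: m_assoc[symmetric])

lemma comm1224_aux:
  assumes [simp]: "x \<in> R" "y \<in> R"
  shows "e12 x \<otimes> e24 y = e24 y \<otimes> (e14 (x * y) \<otimes> e12 x)"
  using hall_witt[of x y 1] by (simp add: e14_def)

lemma comm1214: "x \<in> R \<Longrightarrow> y \<in> R \<Longrightarrow> e12 x \<otimes> e14 y = e14 y \<otimes> e12 x"
  unfolding e14_def by (rule commute_commutator) (simp_all add: comm1213 comm1234)

lemma comm2414: "x \<in> R \<Longrightarrow> y \<in> R \<Longrightarrow> e24 x \<otimes> e14 y = e14 y \<otimes> e24 x"
  unfolding e14_def by (rule commute_commutator) (simp_all add: comm1324 comm3424)

text \<open>
  The two descriptions of the corner, by \<open>e\<^sub>1\<^sub>3, e\<^sub>3\<^sub>4\<close> and by \<open>e\<^sub>1\<^sub>2, e\<^sub>2\<^sub>4\<close>, together show that it is central: every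
  \<open>e\<^sub>i\<^sub>j\<close> except \<open>e\<^sub>2\<^sub>3\<close> commutes with both factors of one of the two commutators.
\<close>

lemma e14_alt: "x \<in> R \<Longrightarrow> e14 x = inv (e24 x) \<otimes> (e12 1 \<otimes> (e24 x \<otimes> inv (e12 1)))"
  using comm1224_aux[of 1 x] by (simp add: m_assoc_subst[OF comm1224_aux[of 1 x]] m_assoc) (simp add: m_assoc[symmetric])

lemma comm3414: "x \<in> R \<Longrightarrow> y \<in> R \<Longrightarrow> e34 x \<otimes> e14 y = e14 y \<otimes> e34 x"
  unfolding e14_alt by (intro commute_mult commute_inv) (simp_all add: comm1234 comm3424)

lemma comm1314: "x \<in> R \<Longrightarrow> y \<in> R \<Longrightarrow> e13 x \<otimes> e14 y = e14 y \<otimes> e13 x"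
  unfolding e14_alt by (intro commute_mult commute_inv) (simp_all add: comm1213 comm1324)

lemma comm1224: "x \<in> R \<Longrightarrow> y \<in> R \<Longrightarrow> e12 x \<otimes> e24 y = e14 (x * y) \<otimes> (e24 y \<otimes> e12 x)"
  using m_assoc_subst[OF comm2414[of y "x * y"], of "e12 x"] by (simp add: comm1224_aux m_assoc)

text \<open>
  Conjugation by \<open>e\<^sub>2\<^sub>3(x)\<close> fixes \<open>e\<^sub>1\<^sub>3(y)\<close> and multiplies \<open>e\<^sub>3\<^sub>4(1)\<close> by \<open>e\<^sub>2\<^sub>4(x)\<close>, which commutes with \<open>e\<^sub>1\<^sub>3(y)\<close> and with the
  corner.
\<close>

lemma comm2314:
  assumes [simp]: "x \<in> R" "y \<in> R"
  shows "e23 x \<otimes> e14 y = e14 y \<otimes> e23 x"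
proof -
  have "e23 x \<otimes> (e13 y \<otimes> e34 1) = e23 x \<otimes> (e14 y \<otimes> (e34 1 \<otimes> e13 y))"
    using comm1334[of y 1] by simp
  moreover have "e23 x \<otimes> (e13 y \<otimes> e34 1) = e14 y \<otimes> e23 x \<otimes> (e34 1 \<otimes> e13 y)"
    using comm2334[of x 1]
    by (simp add: m_assoc m_assoc_subst[OF comm2313] m_assoc_subst[OF comm2334] m_assoc_subst[OF comm1324]
        m_assoc_subst[OF comm1334] m_assoc_subst[OF comm2414] comm2313)
  ultimately have "e23 x \<otimes> e14 y \<otimes> (e34 1 \<otimes> e13 y) = e14 y \<otimes> e23 x \<otimes> (e34 1 \<otimes> e13 y)"
    by (simp add: m_assoc)
  then show ?thesis by (metis closed e14_closed m_closed right_cancel)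
qed

lemma add14:
  assumes [simp]: "x \<in> R" "y \<in> R"
  shows "e14 x \<otimes> e14 y = e14 (x + y)"
proof -
  have "e13 (x + y) \<otimes> e34 1 = e13 x \<otimes> (e13 y \<otimes> e34 1)"
    by (simp add: add13[symmetric] m_assoc)
  also have "\<dots> = e14 y \<otimes> (e14 x \<otimes> (e34 1 \<otimes> (e13 x \<otimes> e13 y)))"
    using comm1334[of y 1] comm1334[of x 1]
    by (simp add: m_assoc m_assoc_subst[OF comm1334[of x 1]] m_assoc_subst[OF comm1314])
  also have "e14 y \<otimes> (e14 x \<otimes> (e34 1 \<otimes> (e13 x \<otimes> e13 y))) = (e14 y \<otimes> e14 x) \<otimes> (e34 1 \<otimes> e13 (x + y))"
    by (simp add: add13 m_assoc)
  finally have "(e14 y \<otimes> e14 x) \<otimes> (e34 1 \<otimes> e13 (x + y)) = e14 (x + y) \<otimes> (e34 1 \<otimes> e13 (x + y))"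
    using comm1334[of "x + y" 1] by simp
  then have "e14 y \<otimes> e14 x = e14 (x + y)"
    by (metis closed e14_closed m_closed right_cancel)
  moreover have "e14 x \<otimes> e14 y = e14 y \<otimes> e14 x"
    unfolding e14_def[of y]
    by (rule commute_commutator) (simp_all add: comm1314 comm3414)
  ultimately show ?thesis by simp
qed


text \<open>
  With the columns in decreasing order the parameters of the normal form are the matrix entries themselves.
\<close>

definition unip :: "'r \<Rightarrow> 'r \<Rightarrow> 'r \<Rightarrow> 'r \<Rightarrow> 'r \<Rightarrow> 'r \<Rightarrow> 'g" where
  "unip a b c d f g = e14 a \<otimes> (e24 b \<otimes> (e34 c \<otimes> (e13 d \<otimes> (e23 f \<otimes> e12 g))))"

text \<open>
  A rewrite system that sorts products into the order of \<open>unip\<close>: each rule moves a factor that stands too far left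
  across its neighbour, or merges two factors.
\<close>

lemmas straighten =
  comm1214 comm2314 comm1314 comm2414 comm3414
  comm1224 comm1234 comm1213 comm1223 comm2324 comm2334 comm2313 comm1324 comm1334 comm3424
  add12 add13 add23 add24 add34 add14

lemmas straighten_assoc = straighten[THEN m_assoc_subst]

theorem unip_mult:
  assumes [simp]: "a \<in> R" "b \<in> R" "c \<in> R" "d \<in> R" "f \<in> R" "g \<in> R"
    "a' \<in> R" "b' \<in> R" "c' \<in> R" "d' \<in> R" "f' \<in> R" "g' \<in> R"
  shows "unip a b c d f g \<otimes> unip a' b' c' d' f' g' =
    unip (a + a' + g * b' + d * c') (b + b' + f * c') (c + c') (d + d' + g * f') (f + f') (g + g')"
  by (simp add: unip_def m_assoc straighten straighten_assoc algebra_simps)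

end

section \<open>Areas of relations and the asymptotic group\<close>

locale presentation = G: group G for G :: "('g, 'm) monoid_scheme" +
  fixes S :: "'g set"
  assumes S_carrier: "S \<subseteq> carrier G"
begin

abbreviation F :: "'g word monoid" where "F \<equiv> free_group S"

abbreviation word_mult :: "'g word \<Rightarrow> 'g word \<Rightarrow> 'g word" (infixl "\<cdot>" 70) where
  "u \<cdot> v \<equiv> u \<otimes>\<^bsub>F\<^esub> v"

sublocale F: group F
  by (rule group_free_group)

lemma eval_closed [simp]: "w \<in> carrier F \<Longrightarrow> eval_word G w \<in> carrier G"
  using eval_word_hom[OF G.is_group S_carrier] by (auto simp: hom_def)

lemma eval_mult: "u \<in> carrier F \<Longrightarrow> v \<in> carrier F \<Longrightarrow> eval_word G (u \<cdot> v) = eval_word G u \<otimes>\<^bsub>G\<^esub> eval_word G v"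
  using eval_word_hom[OF G.is_group S_carrier] by (auto simp: hom_def)

sublocale ev: group_hom F G "eval_word G"
  by (intro group_hom.intro F.is_group G.is_group group_hom_axioms.intro eval_word_hom S_carrier)

lemma rel_kernel_iff: "w \<in> rel_kernel G S \<longleftrightarrow> w \<in> carrier F \<and> eval_word G w = \<one>\<^bsub>G\<^esub>"
  by (auto simp: rel_kernel_def kernel_def)

lemma relators_iff: "w \<in> relators G S r \<longleftrightarrow> w \<in> rel_kernel G S \<and> length w \<le> r"
  by (auto simp: relators_def rel_kernel_iff word_length_free_group)

lemma length_mult_le: "length (u \<cdot> v) \<le> length u + length v"
proof -
  have "length (cancel_Cons x w) \<le> Suc (length w)" for x and w :: "'g word"
    by (cases w) auto
  then have "length (foldr cancel_Cons u v) \<le> length u + length v"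
    by (induction u) (auto intro: le_trans)
  then show ?thesis by (simp add: free_group_def)
qed

lemma length_inv_le:
  assumes "w \<in> carrier F"
  shows "length (inv\<^bsub>F\<^esub> w) \<le> length w"
proof -
  let ?v = "foldr cancel_Cons (rev (map inv_letter w)) []"
  have w: "reduced w" "set w \<subseteq> S \<times> UNIV"
    using assms by (auto simp: free_group_def)
  have "set ?v \<subseteq> S \<times> UNIV"
    using w set_foldr[of "rev (map inv_letter w)" "[]"] by (fastforce simp: inv_letter_def)
  then have v: "?v \<in> carrier F" by (simp add: free_group_def reduced_foldr)
  moreover have "?v \<cdot> w = \<one>\<^bsub>F\<^esub>"
    using free_group_left_inverse[OF w(1)] by (simp add: free_group_def)
  ultimately have "inv\<^bsub>F\<^esub> w = ?v"
    using F.inv_equality assms by blast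
  moreover have "length ?v \<le> length (rev (map inv_letter w)) + length ([] :: 'g word)"
    using length_mult_le[of "rev (map inv_letter w)" "[]"] by (simp add: free_group_def)
  ultimately show ?thesis by simp
qed

lemma relators_inv: "w \<in> relators G S r \<Longrightarrow> inv\<^bsub>F\<^esub> w \<in> relators G S r"
  by (auto simp: relators_iff rel_kernel_iff ev.hom_inv intro: le_trans[OF length_inv_le])

lemma conj_relators_closed: "c \<in> conj_relators G S r \<Longrightarrow> c \<in> carrier F"
  by (auto simp: conj_relators_def relators_iff rel_kernel_iff)

lemma conj_relators_inv:
  assumes "c \<in> conj_relators G S r"
  shows "inv\<^bsub>F\<^esub> c \<in> conj_relators G S r"
proof -
  obtain f w where f: "f \<in> carrier F" "w \<in> relators G S r" "c = f \<cdot> w \<cdot> inv\<^bsub>F\<^esub> f"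
    using assms by (auto simp: conj_relators_def)
  moreover have "w \<in> carrier F" using f(2) by (simp add: relators_iff rel_kernel_iff)
  ultimately have "inv\<^bsub>F\<^esub> c = f \<cdot> inv\<^bsub>F\<^esub> w \<cdot> inv\<^bsub>F\<^esub> f"
    by (simp add: F.inv_mult_group F.m_assoc)
  then show ?thesis
    using f(1) relators_inv[OF f(2)] by (auto simp: conj_relators_def)
qed

lemma conj_relators_conj:
  assumes "c \<in> conj_relators G S r" "g \<in> carrier F"
  shows "g \<cdot> c \<cdot> inv\<^bsub>F\<^esub> g \<in> conj_relators G S r"
proof -
  obtain f w where f: "f \<in> carrier F" "w \<in> relators G S r" "c = f \<cdot> w \<cdot> inv\<^bsub>F\<^esub> f"
    using assms by (auto simp: conj_relators_def)
  moreover have "w \<in> carrier F" using f(2) by (simp add: relators_iff rel_kernel_iff)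
  ultimately have "g \<cdot> c \<cdot> inv\<^bsub>F\<^esub> g = (g \<cdot> f) \<cdot> w \<cdot> inv\<^bsub>F\<^esub> (g \<cdot> f)"
    using assms(2) by (simp add: F.inv_mult_group F.m_assoc)
  moreover have "g \<cdot> f \<in> carrier F" using f assms by simp
  ultimately show ?thesis
    using f(2) unfolding conj_relators_def by blast
qed

text \<open>
  An upper bound for the area, in a form suited to induction.
\<close>

inductive area_le :: "nat \<Rightarrow> nat \<Rightarrow> 'g word \<Rightarrow> bool" for r where
  one: "area_le r a \<one>\<^bsub>F\<^esub>"
| step: "c \<in> conj_relators G S r \<Longrightarrow> area_le r a w \<Longrightarrow> area_le r (Suc a) (c \<cdot> w)"

lemma area_le_closed: "area_le r a w \<Longrightarrow> w \<in> carrier F"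
  by (induction rule: area_le.induct) (auto intro: conj_relators_closed)

lemma area_le_imp: "area_le r a w \<Longrightarrow> area G S r w \<le> enat a"
proof -
  assume "area_le r a w"
  then have "\<exists>xs. set xs \<subseteq> conj_relators G S r \<and> length xs \<le> a \<and> foldr (mult F) xs \<one>\<^bsub>F\<^esub> = w"
  proof induction
    case (step c a w)
    then obtain xs where "set xs \<subseteq> conj_relators G S r" "length xs \<le> a" "foldr (mult F) xs \<one>\<^bsub>F\<^esub> = w"
      by blast
    then show ?case using step by (intro exI[of _ "c # xs"]) auto
  qed (auto intro: exI[of _ "[]"])
  then obtain xs where xs: "set xs \<subseteq> conj_relators G S r" "length xs \<le> a" "foldr (mult F) xs \<one>\<^bsub>F\<^esub> = w"
    by blast
  then have "area G S r w \<le> enat (length xs)"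
    unfolding area_def word_length_def by (intro INF_lower) auto
  also have "\<dots> \<le> enat a" using xs by simp
  finally show ?thesis .
qed

lemma area_le_imp_generate: "area_le r a w \<Longrightarrow> w \<in> generate F (conj_relators G S r)"
  by (induction rule: area_le.induct) (auto intro: generate.intros)

lemma area_le_mono: "area_le r a w \<Longrightarrow> r \<le> r' \<Longrightarrow> a \<le> a' \<Longrightarrow> area_le r' a' w"
proof (induction arbitrary: a' rule: area_le.induct)
  case (step c a w)
  from step.prems obtain b where b: "a' = Suc b" "a \<le> b" by (cases a') auto
  have "c \<in> conj_relators G S r'"
    using step by (fastforce simp: conj_relators_def relators_iff)
  then show ?case using step b by (auto intro: area_le.step)
qed (rule area_le.one)

lemma area_le_mult:
  "area_le r a u \<Longrightarrow> area_le r b v \<Longrightarrow> area_le r (a + b) (u \<cdot> v)"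
proof (induction rule: area_le.induct)
  case (one a)
  then show ?case using area_le_mono[of r b v r "a + b"] area_le_closed[of r b v] by simp
next
  case (step c a w)
  then show ?case
    using area_le.step[of c r "a + b" "w \<cdot> v"] conj_relators_closed[of c r]
      area_le_closed[of r a w] area_le_closed[of r b v]
    by (simp add: F.m_assoc)
qed

lemma area_le_conj_relator: "c \<in> conj_relators G S r \<Longrightarrow> area_le r 1 c"
  using area_le.step[OF _ area_le.one, of c r 0] conj_relators_closed[of c r] by simp

lemma area_le_inv: "area_le r a u \<Longrightarrow> area_le r a (inv\<^bsub>F\<^esub> u)"
proof (induction rule: area_le.induct)
  case (step c a w)
  then have "inv\<^bsub>F\<^esub> (c \<cdot> w) = inv\<^bsub>F\<^esub> w \<cdot> inv\<^bsub>F\<^esub> c"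
    using conj_relators_closed[of c r] area_le_closed[of r a w] by (simp add: F.inv_mult_group)
  then show ?case
    using area_le_mult[OF step.IH area_le_conj_relator[OF conj_relators_inv[OF step.hyps(1)]]] by simp
qed (simp add: area_le.one)

lemma area_le_conj:
  "area_le r a u \<Longrightarrow> g \<in> carrier F \<Longrightarrow> area_le r a (g \<cdot> u \<cdot> inv\<^bsub>F\<^esub> g)"
proof (induction rule: area_le.induct)
  case (step c a w)
  then have "g \<cdot> (c \<cdot> w) \<cdot> inv\<^bsub>F\<^esub> g
      = (g \<cdot> c \<cdot> inv\<^bsub>F\<^esub> g) \<cdot> (g \<cdot> w \<cdot> inv\<^bsub>F\<^esub> g)"
    using conj_relators_closed[of c r] area_le_closed[of r a w]
    by (simp add: F.m_assoc) (simp add: F.m_assoc[symmetric])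
  then show ?case
    using area_le.step[OF conj_relators_conj[OF step.hyps(1) step.prems] step.IH[OF step.prems]] by simp
qed (simp add: area_le.one)

lemma relators_area_le:
  assumes "w \<in> rel_kernel G S" "length w \<le> r"
  shows "area_le r 1 w"
proof -
  have "w \<in> conj_relators G S r"
    unfolding conj_relators_def
    by (rule UN_I[of "\<one>\<^bsub>F\<^esub>"]) (use assms in \<open>auto simp: relators_iff rel_kernel_iff intro!: image_eqI[of _ _ w]\<close>)
  then show ?thesis by (rule area_le_conj_relator)
qed

text \<open>
  The word \<open>u\<close> can be turned into \<open>v\<close> by at most \<open>a\<close> applications of relators of length at most \<open>r\<close>.  In products
  the costs add up, because a conjugate of a relator costs no more than the relator.
\<close>

definition close :: "nat \<Rightarrow> nat \<Rightarrow> 'g word \<Rightarrow> 'g word \<Rightarrow> bool" where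
  "close r a u v \<longleftrightarrow> u \<in> carrier F \<and> v \<in> carrier F \<and> area_le r a (u \<cdot> inv\<^bsub>F\<^esub> v)"

lemma close_refl: "u \<in> carrier F \<Longrightarrow> close r a u u"
  by (simp add: close_def area_le.one)

lemma close_mono: "close r a u v \<Longrightarrow> r \<le> r' \<Longrightarrow> a \<le> a' \<Longrightarrow> close r' a' u v"
  by (auto simp: close_def intro: area_le_mono)

lemma close_sym: "close r a u v \<Longrightarrow> close r a v u"
  using area_le_inv[of r a "u \<cdot> inv\<^bsub>F\<^esub> v"] by (auto simp: close_def F.inv_mult_group)

lemma close_trans:
  assumes "close r a u v" "close r b v w"
  shows "close r (a + b) u w"
proof -
  have "(u \<cdot> inv\<^bsub>F\<^esub> v) \<cdot> (v \<cdot> inv\<^bsub>F\<^esub> w) = u \<cdot> inv\<^bsub>F\<^esub> w"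
    using assms by (simp add: close_def F.m_assoc) (simp add: F.m_assoc[symmetric])
  then show ?thesis
    using area_le_mult[of r a "u \<cdot> inv\<^bsub>F\<^esub> v" b "v \<cdot> inv\<^bsub>F\<^esub> w"] assms by (simp add: close_def)
qed

lemma close_mult:
  assumes "close r a u u'" "close r b v v'"
  shows "close r (a + b) (u \<cdot> v) (u' \<cdot> v')"
proof -
  have [simp]: "u \<in> carrier F" "u' \<in> carrier F" "v \<in> carrier F" "v' \<in> carrier F"
    using assms by (auto simp: close_def)
  have "(u \<cdot> v) \<cdot> inv\<^bsub>F\<^esub> (u' \<cdot> v')
      = (u \<cdot> (v \<cdot> inv\<^bsub>F\<^esub> v') \<cdot> inv\<^bsub>F\<^esub> u) \<cdot> (u \<cdot> inv\<^bsub>F\<^esub> u')"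
    by (simp add: F.m_assoc F.inv_mult_group) (simp add: F.m_assoc[symmetric])
  moreover have "area_le r (b + a) \<dots>"
    using assms by (intro area_le_mult area_le_conj) (auto simp: close_def)
  ultimately show ?thesis by (simp add: close_def add.commute)
qed

lemma close_mult_left: "close r a v v' \<Longrightarrow> u \<in> carrier F \<Longrightarrow> close r a (u \<cdot> v) (u \<cdot> v')"
  using close_mult[OF close_refl[of u r 0]] by fastforce

lemma close_mult_right: "close r a u u' \<Longrightarrow> v \<in> carrier F \<Longrightarrow> close r a (u \<cdot> v) (u' \<cdot> v)"
  using close_mult[OF _ close_refl[of v r 0]] by fastforce

lemma close_relation:
  assumes "u \<in> carrier F" "v \<in> carrier F" "eval_word G u = eval_word G v" "length u + length v \<le> r"
  shows "close r 1 u v"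
proof -
  have "u \<cdot> inv\<^bsub>F\<^esub> v \<in> rel_kernel G S"
    using assms by (simp add: rel_kernel_iff eval_mult ev.hom_inv)
  moreover have "length (u \<cdot> inv\<^bsub>F\<^esub> v) \<le> r"
    using length_mult_le[of u "inv\<^bsub>F\<^esub> v"] length_inv_le[OF assms(2)] assms(4) by linarith
  ultimately show ?thesis
    using assms relators_area_le by (simp add: close_def)
qed

lemma close_intertwine_inv:
  assumes "close r a (u \<cdot> w) (w' \<cdot> u)" "u \<in> carrier F" "w \<in> carrier F" "w' \<in> carrier F"
  shows "close r a (inv\<^bsub>F\<^esub> u \<cdot> w') (w \<cdot> inv\<^bsub>F\<^esub> u)"
proof -
  have "close r a (inv\<^bsub>F\<^esub> u \<cdot> ((w' \<cdot> u) \<cdot> inv\<^bsub>F\<^esub> u)) (inv\<^bsub>F\<^esub> u \<cdot> ((u \<cdot> w) \<cdot> inv\<^bsub>F\<^esub> u))"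
    using close_sym[OF assms(1)] assms(2) by (intro close_mult_left close_mult_right) auto
  moreover have "inv\<^bsub>F\<^esub> u \<cdot> ((w' \<cdot> u) \<cdot> inv\<^bsub>F\<^esub> u) = inv\<^bsub>F\<^esub> u \<cdot> w'"
    using assms(2-) by (simp add: F.m_assoc)
  moreover have "inv\<^bsub>F\<^esub> u \<cdot> ((u \<cdot> w) \<cdot> inv\<^bsub>F\<^esub> u) = w \<cdot> inv\<^bsub>F\<^esub> u"
    using assms(2-) by (simp add: F.m_assoc[symmetric])
  ultimately show ?thesis by simp
qed

lemma close_intertwine_nat:
  assumes "\<And>j. j < n \<Longrightarrow> close r a (u \<cdot> w j) (w (Suc j) \<cdot> u)"
    and "u \<in> carrier F" "\<And>j. j \<le> n \<Longrightarrow> w j \<in> carrier F"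
  shows "close r (n * a) (u [^]\<^bsub>F\<^esub> n \<cdot> w 0) (w n \<cdot> u [^]\<^bsub>F\<^esub> n)"
  using assms
proof (induction n)
  case 0
  then show ?case by (simp add: close_refl)
next
  case (Suc n)
  have "close r (n * a) (u \<cdot> (u [^]\<^bsub>F\<^esub> n \<cdot> w 0)) (u \<cdot> (w n \<cdot> u [^]\<^bsub>F\<^esub> n))"
    using Suc by (intro close_mult_left Suc.IH) auto
  moreover have "close r a ((u \<cdot> w n) \<cdot> u [^]\<^bsub>F\<^esub> n) ((w (Suc n) \<cdot> u) \<cdot> u [^]\<^bsub>F\<^esub> n)"
    using Suc by (intro close_mult_right) auto
  moreover have "(u \<cdot> w n) \<cdot> u [^]\<^bsub>F\<^esub> n = u \<cdot> (w n \<cdot> u [^]\<^bsub>F\<^esub> n)"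
    using Suc.prems by (simp add: F.m_assoc)
  ultimately have "close r (n * a + a) (u \<cdot> (u [^]\<^bsub>F\<^esub> n \<cdot> w 0)) ((w (Suc n) \<cdot> u) \<cdot> u [^]\<^bsub>F\<^esub> n)"
    using close_trans by metis
  moreover have "u [^]\<^bsub>F\<^esub> Suc n = u \<cdot> u [^]\<^bsub>F\<^esub> n"
    using Suc.prems(2) by (rule F.nat_pow_Suc2)
  ultimately show ?case
    using Suc.prems by (simp add: F.m_assoc add.commute del: F.nat_pow_Suc nat_pow_Suc)
qed

text \<open>
  Moving \<open>u\<^sup>k\<close> across \<open>w 0\<close> letter by letter.  The intermediate words \<open>w j\<close> are only used for \<open>j\<close> between \<open>0\<close> and
  \<open>k\<close>, which matters later: outside this range they need not spell bounded elements.
\<close>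

lemma close_intertwine_int:
  fixes k :: int
  assumes "\<And>j. {j, j + 1} \<subseteq> {min 0 k..max 0 k} \<Longrightarrow> close r a (u \<cdot> w j) (w (j + 1) \<cdot> u)"
    and "u \<in> carrier F" "\<And>j. j \<in> {min 0 k..max 0 k} \<Longrightarrow> w j \<in> carrier F"
  shows "close r (nat \<bar>k\<bar> * a) (u [^]\<^bsub>F\<^esub> k \<cdot> w 0) (w k \<cdot> u [^]\<^bsub>F\<^esub> k)"
proof (cases "k \<ge> 0")
  case True
  then obtain n where n: "k = int n" using nonneg_int_cases by blast
  have "close r (n * a) (u [^]\<^bsub>F\<^esub> n \<cdot> w (int 0)) (w (int n) \<cdot> u [^]\<^bsub>F\<^esub> n)"
    by (rule close_intertwine_nat[where w = "\<lambda>j. w (int j)"])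
      (use assms(1)[of "int j" for j] assms n in \<open>auto simp: add.commute\<close>)
  then show ?thesis by (simp add: n int_pow_int)
next
  case False
  then obtain n where n: "k = - int n" by (metis nonpos_int_cases linear)
  have "close r a (inv\<^bsub>F\<^esub> u \<cdot> w (- int j)) (w (- int (Suc j)) \<cdot> inv\<^bsub>F\<^esub> u)" if "j < n" for j
  proof (rule close_intertwine_inv)
    show "close r a (u \<cdot> w (- int (Suc j))) (w (- int j) \<cdot> u)"
      using assms(1)[of "- int (Suc j)"] that n by simp
  qed (use assms that n in auto)
  then have "close r (n * a) (inv\<^bsub>F\<^esub> u [^]\<^bsub>F\<^esub> n \<cdot> w (- int 0)) (w (- int n) \<cdot> inv\<^bsub>F\<^esub> u [^]\<^bsub>F\<^esub> n)"
    by (intro close_intertwine_nat[where w = "\<lambda>j. w (- int j)"]) (use assms n in auto)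
  then show ?thesis
    using assms(2) by (simp add: n F.int_pow_neg_int F.nat_pow_inv)
qed

lemma close_commute_powers:
  fixes k l :: int
  assumes "close r a (u \<cdot> v) (v \<cdot> u)" "u \<in> carrier F" "v \<in> carrier F"
  shows "close r (nat \<bar>k\<bar> * (nat \<bar>l\<bar> * a)) (u [^]\<^bsub>F\<^esub> k \<cdot> v [^]\<^bsub>F\<^esub> l) (v [^]\<^bsub>F\<^esub> l \<cdot> u [^]\<^bsub>F\<^esub> k)"
proof -
  have "close r (nat \<bar>l\<bar> * a) (v [^]\<^bsub>F\<^esub> l \<cdot> u) (u \<cdot> v [^]\<^bsub>F\<^esub> l)"
    by (rule close_intertwine_int[where w = "\<lambda>_. u"]) (use assms close_sym in auto)
  then show ?thesis
    by (intro close_intertwine_int[where w = "\<lambda>_. v [^]\<^bsub>F\<^esub> l"]) (use assms close_sym in auto)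
qed

end

definition fun_group :: "('g, 'm) monoid_scheme \<Rightarrow> ('i \<Rightarrow> 'g) monoid" where
  "fun_group G = \<lparr>carrier = {f. \<forall>i. f i \<in> carrier G}, mult = (\<lambda>f g i. f i \<otimes>\<^bsub>G\<^esub> g i), one = (\<lambda>_. \<one>\<^bsub>G\<^esub>)\<rparr>"

lemma group_fun_group: "group G \<Longrightarrow> group (fun_group G :: ('i \<Rightarrow> 'g) monoid)"
proof -
  assume "group G"
  then interpret group G .
  show ?thesis
  proof (rule groupI)
    fix f :: "'i \<Rightarrow> 'g" assume "f \<in> carrier (fun_group G)"
    then show "\<exists>g\<in>carrier (fun_group G). g \<otimes>\<^bsub>fun_group G\<^esub> f = \<one>\<^bsub>fun_group G\<^esub>"
      by (intro bexI[of _ "\<lambda>i. inv\<^bsub>G\<^esub> (f i)"]) (auto simp: fun_group_def)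
  qed (auto simp: fun_group_def m_assoc)
qed

lemma (in group) inv_fun_group:
  assumes "f \<in> carrier (fun_group G :: ('i \<Rightarrow> 'a) monoid)"
  shows "inv\<^bsub>fun_group G\<^esub> f = (\<lambda>i. inv f i)"
  using assms
  by (intro group.inv_equality[OF group_fun_group[OF is_group]]) (auto simp: fun_group_def)

text \<open>
  The index \<open>i\<close> runs over configurations of words and \<open>len i\<close> is the scale at which configuration \<open>i\<close> lives.
\<close>

locale scaled_presentation = presentation G S for G :: "('g, 'm) monoid_scheme" and S +
  fixes len :: "'i \<Rightarrow> nat"
  assumes len_pos: "1 \<le> len i"
begin

abbreviation FF :: "('i \<Rightarrow> 'g word) monoid" where "FF \<equiv> fun_group F"

sublocale FF: group FF
  by (rule group_fun_group[OF F.is_group])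

text \<open>
  The bound \<open>r\<close> on the length of the relators may depend on the family, so relations between words of bounded
  length are negligible whatever the bound is.  Conjugation by arbitrarily
  long words does not change areas, so the set is normal in the group of \<^emph>\<open>all\<close> families.
\<close>

definition negligible :: "('i \<Rightarrow> 'g word) set" where
  "negligible = {f. \<exists>r C. \<forall>i. area_le r (C * (len i)\<^sup>2) (f i)}"

lemma negligible_normal: "negligible \<lhd> FF"
proof (rule FF.normal_invI)
  show "subgroup negligible FF"
  proof (rule FF.subgroupI)
    show "negligible \<subseteq> carrier FF"
      by (auto simp: negligible_def fun_group_def intro: area_le_closed)
    show "negligible \<noteq> {}"
      using area_le.one by (force simp: negligible_def)
  next
    fix f assume f: "f \<in> negligible"
    then have "f \<in> carrier FF"
      by (auto simp: negligible_def fun_group_def intro: area_le_closed)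
    then show "inv\<^bsub>FF\<^esub> f \<in> negligible"
      using f by (auto simp: negligible_def F.inv_fun_group intro: area_le_inv)
  next
    fix f g assume "f \<in> negligible" "g \<in> negligible"
    then obtain r C r' C' where fg: "\<And>i. area_le r (C * (len i)\<^sup>2) (f i)" "\<And>i. area_le r' (C' * (len i)\<^sup>2) (g i)"
      by (auto simp: negligible_def)
    have "area_le (max r r') ((C + C') * (len i)\<^sup>2) (f i \<cdot> g i)" for i
      unfolding add_mult_distrib
      by (intro area_le_mult area_le_mono[OF fg(1)] area_le_mono[OF fg(2)]) auto
    then show "f \<otimes>\<^bsub>FF\<^esub> g \<in> negligible"
      by (auto simp: negligible_def fun_group_def)
  qed
next
  fix g f assume "g \<in> carrier FF" "f \<in> negligible"
  then show "g \<otimes>\<^bsub>FF\<^esub> f \<otimes>\<^bsub>FF\<^esub> inv\<^bsub>FF\<^esub> g \<in> negligible"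
    by (auto simp: negligible_def F.inv_fun_group) (auto simp: fun_group_def, blast intro: area_le_conj)
qed

definition \<Gamma> :: "('i \<Rightarrow> 'g word) set monoid" where
  "\<Gamma> = FF Mod negligible"

definition cls :: "('i \<Rightarrow> 'g word) \<Rightarrow> ('i \<Rightarrow> 'g word) set" where
  "cls f = negligible #>\<^bsub>FF\<^esub> f"

sublocale \<Gamma>: group \<Gamma>
  unfolding \<Gamma>_def by (rule normal.factorgroup_is_group[OF negligible_normal])

lemma cls_closed: "(\<And>i. f i \<in> carrier F) \<Longrightarrow> cls f \<in> carrier \<Gamma>"
  unfolding \<Gamma>_def cls_def carrier_FactGroup by (auto simp: fun_group_def)

lemma cls_mult:
  "(\<And>i. f i \<in> carrier F) \<Longrightarrow> (\<And>i. g i \<in> carrier F) \<Longrightarrow> cls f \<otimes>\<^bsub>\<Gamma>\<^esub> cls g = cls (\<lambda>i. f i \<cdot> g i)"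
  using normal.rcos_sum[OF negligible_normal, of f g]
  by (simp add: \<Gamma>_def cls_def fun_group_def)

lemma cls_one: "cls (\<lambda>_. \<one>\<^bsub>F\<^esub>) = \<one>\<^bsub>\<Gamma>\<^esub>"
proof -
  have c: "cls (\<lambda>_. \<one>\<^bsub>F\<^esub>) \<in> carrier \<Gamma>" by (rule cls_closed) simp
  have "cls (\<lambda>_. \<one>\<^bsub>F\<^esub>) \<otimes>\<^bsub>\<Gamma>\<^esub> cls (\<lambda>_. \<one>\<^bsub>F\<^esub>) = cls (\<lambda>_. \<one>\<^bsub>F\<^esub>)"
    by (subst cls_mult) auto
  then show ?thesis using c by (metis \<Gamma>.r_cancel_one)
qed

lemma cls_inv:
  assumes "\<And>i. f i \<in> carrier F"
  shows "inv\<^bsub>\<Gamma>\<^esub> (cls f) = cls (\<lambda>i. inv\<^bsub>F\<^esub> f i)"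
proof (rule \<Gamma>.inv_equality)
  show "cls (\<lambda>i. inv\<^bsub>F\<^esub> f i) \<otimes>\<^bsub>\<Gamma>\<^esub> cls f = \<one>\<^bsub>\<Gamma>\<^esub>"
    using assms by (subst cls_mult) (auto simp: cls_one)
qed (use assms in \<open>auto intro: cls_closed\<close>)

lemma cls_eqI:
  assumes "\<And>i. close r (C * (len i)\<^sup>2) (f i) (g i)"
  shows "cls f = cls g"
proof -
  have "f \<in> carrier FF" "g \<in> carrier FF"
    using assms by (auto simp: fun_group_def close_def)
  moreover have "f \<otimes>\<^bsub>FF\<^esub> inv\<^bsub>FF\<^esub> g \<in> negligible"
    using assms calculation by (auto simp: negligible_def F.inv_fun_group) (auto simp: fun_group_def close_def)
  moreover have "subgroup negligible FF"
    using negligible_normal normal_imp_subgroup by blast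
  ultimately have "f \<in> negligible #>\<^bsub>FF\<^esub> g"
    by (simp add: subgroup.rcos_module[OF _ FF.is_group])
  then show ?thesis
    unfolding cls_def
    using FF.repr_independence[OF _ \<open>g \<in> carrier FF\<close> \<open>subgroup negligible FF\<close>] by blast
qed

lemma cls_eqD:
  assumes "cls f = cls g" "\<And>i. f i \<in> carrier F" "\<And>i. g i \<in> carrier F"
  obtains r C where "\<And>i. close r (C * (len i)\<^sup>2) (f i) (g i)"
proof -
  have fg: "f \<in> carrier FF" "g \<in> carrier FF"
    using assms by (auto simp: fun_group_def)
  have sg: "subgroup negligible FF"
    using negligible_normal normal_imp_subgroup by blast
  have "f \<in> negligible #>\<^bsub>FF\<^esub> g"
    using FF.rcos_self[OF fg(1) sg] assms(1) by (simp add: cls_def)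
  then have "f \<otimes>\<^bsub>FF\<^esub> inv\<^bsub>FF\<^esub> g \<in> negligible"
    using fg by (simp add: subgroup.rcos_module[OF sg FF.is_group])
  then show thesis
    using that fg assms(2,3) by (auto simp: negligible_def F.inv_fun_group close_def) (auto simp: fun_group_def)
qed

text \<open>
  Relations between words of bounded length are free of charge in \<open>\<Gamma>\<close>.
\<close>

lemma cls_relation:
  assumes "\<And>i. f i \<in> carrier F" "\<And>i. g i \<in> carrier F" "\<And>i. eval_word G (f i) = eval_word G (g i)"
    and "\<And>i. length (f i) \<le> L" "\<And>i. length (g i) \<le> L"
  shows "cls f = cls g"
proof (rule cls_eqI)
  fix i
  have "close (2 * L) 1 (f i) (g i)"
    using assms(4)[of i] assms(5)[of i] by (intro close_relation assms) simp
  then show "close (2 * L) (1 * (len i)\<^sup>2) (f i) (g i)"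
    by (rule close_mono) (use len_pos[of i] in auto)
qed

end

section \<open>Root subgroups and diagonal matrices\<close>

datatype posroot = R12 | R13 | R23 | R24 | R34

fun root_pos :: "posroot \<Rightarrow> 4 \<times> 4" where
  "root_pos R12 = (1, 2)" | "root_pos R13 = (1, 3)" | "root_pos R23 = (2, 3)"
| "root_pos R24 = (2, 4)" | "root_pos R34 = (3, 4)"

type_synonym 'k mat4 = "'k ^ 4 ^ 4"

definition elmat :: "posroot \<Rightarrow> 'k \<Rightarrow> 'k::field ^ 4 ^ 4" where
  "elmat \<rho> x = (\<chi> i j. if i = j then 1 else if (i, j) = root_pos \<rho> then x else 0)"

definition dgmat :: "'k \<Rightarrow> 'k \<Rightarrow> 'k::field ^ 4 ^ 4" where
  "dgmat a b = (\<chi> i j. if i = j then if i = 2 then a else if i = 3 then b else 1 else 0)"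

text \<open>
  The character by which the matrix \<open>diag(1,a,b,1)\<close> acts on the entry at a position; \<open>w1\<close> and \<open>w2\<close> are its exponents in
  \<open>a\<close> and \<open>b\<close>.
\<close>

fun wt :: "posroot \<Rightarrow> 'k \<Rightarrow> 'k \<Rightarrow> 'k::field" where
  "wt R12 a b = inverse a" | "wt R13 a b = inverse b" | "wt R23 a b = a * inverse b"
| "wt R24 a b = a" | "wt R34 a b = b"

fun w1 :: "posroot \<Rightarrow> int" where
  "w1 R12 = -1" | "w1 R13 = 0" | "w1 R23 = 1" | "w1 R24 = 1" | "w1 R34 = 0"

fun w2 :: "posroot \<Rightarrow> int" where
  "w2 R12 = 0" | "w2 R13 = -1" | "w2 R23 = -1" | "w2 R24 = 0" | "w2 R34 = 1"

lemma wt_mult: "wt \<rho> (a * a') (b * b') = wt \<rho> a b * wt \<rho> a' b'"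
  by (cases \<rho>) (auto simp: field_simps)

lemma wt_one [simp]: "wt \<rho> 1 1 = 1"
  by (cases \<rho>) auto

lemma wt_nonzero: "a \<noteq> 0 \<Longrightarrow> b \<noteq> 0 \<Longrightarrow> wt \<rho> a b \<noteq> 0"
  by (cases \<rho>) auto

lemma wt_powi: "\<mu> \<noteq> 0 \<Longrightarrow> wt \<rho> (\<mu> powi k) (\<mu> powi l) = \<mu> powi (w1 \<rho> * k + w2 \<rho> * l)"
  by (cases \<rho>) (auto simp: power_int_minus power_int_diff field_simps)

lemmas mat4_simps = matrix_matrix_mult_def vec_eq_iff forall_4 sum_4 dgmat_def elmat_def

lemma dgmat_mult: "dgmat a b ** dgmat a' b' = dgmat (a * a') (b * b')"
  by (simp add: mat4_simps)

lemma dgmat_elmat: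
  assumes "a \<noteq> 0" "b \<noteq> 0"
  shows "dgmat a b ** elmat \<rho> x = elmat \<rho> (wt \<rho> a b * x) ** dgmat a b"
  using assms by (cases \<rho>) (simp_all add: mat4_simps)

lemma elmat_add: "elmat \<rho> x ** elmat \<rho> y = elmat \<rho> (x + y)"
  by (cases \<rho>) (simp_all add: mat4_simps)

lemma elmat_zero: "elmat \<rho> 0 = mat 1" "dgmat 1 1 = mat 1"
  by (simp_all add: mat4_simps mat_def)

lemma elmat_relations:
  "elmat R12 x ** elmat R23 y = elmat R13 (x * y) ** (elmat R23 y ** elmat R12 x)"
  "elmat R23 x ** elmat R34 y = elmat R24 (x * y) ** (elmat R34 y ** elmat R23 x)"
  "elmat R12 x ** elmat R13 y = elmat R13 y ** elmat R12 x"
  "elmat R12 x ** elmat R34 y = elmat R34 y ** elmat R12 x"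
  "elmat R23 x ** elmat R13 y = elmat R13 y ** elmat R23 x"
  "elmat R23 x ** elmat R24 y = elmat R24 y ** elmat R23 x"
  "elmat R13 x ** elmat R24 y = elmat R24 y ** elmat R13 x"
  "elmat R34 x ** elmat R24 y = elmat R24 y ** elmat R34 x"
  by (simp_all add: mat4_simps)

lemma elmat_in_A4 [simp]: "elmat \<rho> x \<in> carrier A4"
  by (cases \<rho>) (simp_all add: A4_def A4_carrier_def elmat_def)

lemma dgmat_in_A4: "a \<noteq> 0 \<Longrightarrow> b \<noteq> 0 \<Longrightarrow> dgmat a b \<in> carrier A4"
  by (simp add: A4_def A4_carrier_def dgmat_def dvd_field_iff)

lemma A4_mult [simp]: "A \<otimes>\<^bsub>A4\<^esub> B = A ** B"
  by (simp add: A4_def)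

lemma A4_one [simp]: "\<one>\<^bsub>A4\<^esub> = mat 1"
  by (simp add: A4_def)

context scaled_field
begin

text \<open>
  The element \<open>x\<close> has logarithmic size at most \<open>n\<close>.
\<close>

definition bnd :: "nat \<Rightarrow> 'k \<Rightarrow> bool" where
  "bnd n x \<longleftrightarrow> \<mu> ^ n * x \<in> V"

lemma bnd_0 [simp]: "bnd 0 x \<longleftrightarrow> x \<in> V"
  by (simp add: bnd_def)

lemma bnd_Suc: "bnd n x \<Longrightarrow> bnd (Suc n) x"
  using mu_V by (simp add: bnd_def mult.assoc)

lemma bnd_mono: "bnd n x \<Longrightarrow> n \<le> m \<Longrightarrow> bnd m x"
  by (rule dec_induct[of n m "\<lambda>k. bnd k x"]) (auto intro: bnd_Suc)

lemma bnd_one [simp]: "bnd n 1"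
  using bnd_mono[of 0 1 n] one_V by simp

lemma zero_V: "0 \<in> V"
  using add_V[OF one_V minus_V[OF one_V]] by simp

lemma bnd_zero [simp]: "bnd n 0"
  by (simp add: bnd_def zero_V)

lemma bnd_add:
  assumes "bnd n x" "bnd m y"
  shows "bnd (n + m + 1) (x + y)"
proof -
  have "bnd (n + m) x" "bnd (n + m) y" using assms bnd_mono by auto
  then have "\<mu> * (\<mu> ^ (n + m) * x + \<mu> ^ (n + m) * y) \<in> V"
    unfolding bnd_def by (rule add_V)
  then show ?thesis by (simp add: bnd_def distrib_left mult.assoc)
qed

lemma bnd_mult:
  assumes "bnd n x" "bnd m y"
  shows "bnd (n + m + 1) (x * y)"
  using mult_V[of "\<mu> ^ n * x" "\<mu> ^ m * y"] assms by (simp add: bnd_def power_add ac_simps)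

lemma bnd_exists: "\<exists>n. bnd n x"
  using absorb_V by (simp add: bnd_def)

lemma bnd_inverse_power: "bnd n (inverse \<mu> ^ k) \<Longrightarrow> k \<le> n + \<kappa>"
proof (rule ccontr)
  assume "bnd n (inverse \<mu> ^ k)" "\<not> k \<le> n + \<kappa>"
  moreover then have "\<mu> ^ n * inverse \<mu> ^ k = inverse \<mu> ^ (k - n)"
    using mu_nz by (simp add: power_diff field_simps)
  ultimately show False using powers_V[of "k - n"] by (simp add: bnd_def)
qed

lemma bnd_powi: "bnd (nat \<bar>k\<bar>) (\<mu> powi k)"
proof (cases "k \<ge> 0")
  case True
  then obtain n where "k = int n" using nonneg_int_cases by blast
  moreover have "bnd n (\<mu> ^ n)"
    using bnd_mono[of 0 1 "n + n"] one_V by (simp add: bnd_def power_add)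
  ultimately show ?thesis by simp
next
  case False
  then obtain n where "k = - int n" by (metis nonpos_int_cases linear)
  then show ?thesis using mu_nz one_V by (simp add: bnd_def power_int_minus)
qed

text \<open>
  Wide enough to contain \<open>\<mu>\<close>, its inverse and the factors \<open>c\<close> of the polar decomposition; in a topological field it is
  compact (lemma \<open>compact_units\<close>).
\<close>

definition units :: "'k set" where
  "units = {c. c \<noteq> 0 \<and> bnd (Suc \<kappa>) c \<and> bnd (Suc \<kappa>) (inverse c)}"

lemma powi_units:
  assumes "\<bar>k\<bar> \<le> 1"
  shows "\<mu> powi k \<in> units"
proof -
  have "bnd (Suc \<kappa>) (\<mu> powi l)" if "\<bar>l\<bar> \<le> 1" for l
    by (rule bnd_mono[OF bnd_powi]) (use that in auto)
  from this[of k] this[of "- k"] assms show ?thesis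
    using mu_nz by (auto simp: units_def power_int_minus)
qed

lemma mu_units: "\<mu> \<in> units" "1 \<in> units"
  using powi_units[of 1] powi_units[of 0] by auto

lemma polar_units: "x \<noteq> 0 \<Longrightarrow> \<exists>k c. x = \<mu> powi k * c \<and> c \<in> units"
  using polar[of x] by (fastforce simp: units_def bnd_def[symmetric] intro: bnd_Suc)

definition pk :: "'k \<Rightarrow> int" where "pk x = (SOME k. \<exists>c. x = \<mu> powi k * c \<and> c \<in> units)"
definition pc :: "'k \<Rightarrow> 'k" where "pc x = x / \<mu> powi (pk x)"

lemma pk_pc:
  assumes "x \<noteq> 0"
  shows "x = \<mu> powi (pk x) * pc x" "pc x \<in> units"
proof -
  obtain c where c: "x = \<mu> powi (pk x) * c" "c \<in> units"
    using someI_ex[OF polar_units[OF assms]] unfolding pk_def by blast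
  moreover have "pc x = c" using mu_nz c(1) unfolding pc_def by (metis nonzero_mult_div_cancel_left power_int_not_zero)
  ultimately show "x = \<mu> powi (pk x) * pc x" "pc x \<in> units" by auto
qed

text \<open>
  The exponent in a polar decomposition is controlled by the sizes of the element and its inverse.
\<close>

lemma exponent_bound:
  assumes "bnd n (\<mu> powi k * c)" "bnd n (inverse (\<mu> powi k * c))" "c \<noteq> 0" "bnd m c" "bnd m (inverse c)"
  shows "\<bar>k\<bar> \<le> int (n + m + 1 + \<kappa>)"
proof -
  have "bnd (n + m + 1) (\<mu> powi k * c * inverse c)" "bnd (n + m + 1) (inverse (\<mu> powi k * c) * c)"
    by (rule bnd_mult[OF assms(1,5)], rule bnd_mult[OF assms(2,4)])
  then have b: "bnd (n + m + 1) (\<mu> powi k)" "bnd (n + m + 1) (\<mu> powi - k)"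
    using assms(3) mu_nz by (auto simp: field_simps power_int_minus)
  show ?thesis
  proof (cases "k \<ge> 0")
    case True
    then obtain j where "k = int j" using nonneg_int_cases by blast
    then show ?thesis using b(2) bnd_inverse_power[of "n + m + 1" j] by (simp add: power_int_minus power_inverse)
  next
    case False
    then obtain j where "k = - int j" by (metis nonpos_int_cases linear)
    then show ?thesis using b(1) bnd_inverse_power[of "n + m + 1" j] by (simp add: power_int_minus power_inverse)
  qed
qed

lemma wt_bnd:
  assumes "bnd n a" "bnd n (inverse a)" "bnd n b" "bnd n (inverse b)"
  shows "bnd (2 * n + 1) (wt \<rho> a b)"
  using assms bnd_mult[of n a n "inverse b"]
  by (cases \<rho>) (auto simp: mult_2 intro: bnd_mono)

definition level :: "'k \<Rightarrow> nat" where "level x = (LEAST n. bnd n x)"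

lemma bnd_level: "bnd (level x) x"
  unfolding level_def by (rule LeastI_ex[OF bnd_exists])

lemma level_le: "bnd n x \<Longrightarrow> level x \<le> n"
  unfolding level_def by (rule Least_le)

definition bounded_mat :: "nat \<Rightarrow> 'k mat4 \<Rightarrow> bool" where
  "bounded_mat n A \<longleftrightarrow> A \<in> carrier A4 \<and> (\<forall>i j. bnd n (A $ i $ j)) \<and>
    bnd n (inverse (A $ 2 $ 2)) \<and> bnd n (inverse (A $ 3 $ 3))"

end

section \<open>Words for the elements of the group\<close>

text \<open>
  Exponents such that \<open>diag(1,\<mu>\<^sup>c\<^sup>p,\<mu>\<^sup>c\<^sup>q,1)\<close> multiplies the entry at the given position by \<open>\<mu>\<close>.
\<close>

fun cp :: "posroot \<Rightarrow> int" where
  "cp R12 = -1" | "cp R13 = 0" | "cp R23 = 1" | "cp R24 = 1" | "cp R34 = 0"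

fun cq :: "posroot \<Rightarrow> int" where
  "cq R12 = 0" | "cq R13 = -1" | "cq R23 = 0" | "cq R24 = 0" | "cq R34 = 1"

interpretation A4: group "A4 :: ('k::field ^ 4 ^ 4) monoid"
  by (rule group_A4)

lemma inv_elmat: "inv\<^bsub>A4\<^esub> (elmat \<rho> x) = elmat \<rho> (- x)"
  by (rule A4.inv_equality) (simp_all add: elmat_add elmat_zero)

lemma inv_dgmat: "a \<noteq> 0 \<Longrightarrow> b \<noteq> 0 \<Longrightarrow> inv\<^bsub>A4\<^esub> (dgmat a b) = dgmat (inverse a) (inverse b)"
  by (rule A4.inv_equality) (simp_all add: dgmat_mult elmat_zero dgmat_in_A4)

lemma dgmat_nat_pow: "dgmat a b [^]\<^bsub>A4\<^esub> (n::nat) = dgmat (a ^ n) (b ^ n)"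
  by (induction n) (simp_all add: elmat_zero dgmat_mult mult.commute)

lemma dgmat_int_pow: "a \<noteq> 0 \<Longrightarrow> b \<noteq> 0 \<Longrightarrow> dgmat a b [^]\<^bsub>A4\<^esub> (k::int) = dgmat (a powi k) (b powi k)"
  by (cases k rule: int_cases2)
    (simp_all add: int_pow_int dgmat_nat_pow A4.int_pow_neg_int dgmat_in_A4 inv_dgmat power_int_minus)

lemma elmat_commutator:
  "elmat R13 x ** elmat R34 1 ** inv\<^bsub>A4\<^esub> (elmat R13 x) ** inv\<^bsub>A4\<^esub> (elmat R34 1) =
    (\<chi> i j. if i = j then 1 else if i = 1 \<and> j = 4 then x else 0)"
  unfolding inv_elmat by (simp add: mat4_simps)

lemma A4_normal_form:
  assumes "g \<in> carrier (A4 :: ('k::field ^ 4 ^ 4) monoid)"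
  shows "((\<chi> i j. if i = j then 1 else if i = 1 \<and> j = 4 then g $ 1 $ 4 else 0) **
      (elmat R24 (g $ 2 $ 4) ** (elmat R34 (g $ 3 $ 4) ** (elmat R13 (g $ 1 $ 3 / g $ 3 $ 3) **
      (elmat R23 (g $ 2 $ 3 / g $ 3 $ 3) ** elmat R12 (g $ 1 $ 2 / g $ 2 $ 2)))))) **
      dgmat (g $ 2 $ 2) (g $ 3 $ 3) = g"
  using assms by (simp add: mat4_simps A4_def A4_carrier_def dvd_field_iff)

text \<open>
  All that is needed of the generating set \<open>S\<close>: the bounded elementary and diagonal matrices are products of a
  bounded number of generators.
\<close>

locale abels_words = scaled_field V \<mu> \<kappa> + presentation "A4 :: 'k mat4 monoid" S
  for V :: "'k::field set" and \<mu> \<kappa> S +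
  fixes N :: nat
  assumes spelled_elmat: "v \<in> V \<Longrightarrow> \<exists>w\<in>carrier (free_group S). eval_word A4 w = elmat \<rho> v \<and> length w \<le> N"
    and spelled_dgmat: "a \<in> units \<Longrightarrow> b \<in> units \<Longrightarrow>
      \<exists>w\<in>carrier (free_group S). eval_word A4 w = dgmat a b \<and> length w \<le> N"
begin

definition spelled :: "'k mat4 \<Rightarrow> bool" where
  "spelled \<sigma> \<longleftrightarrow> (\<exists>w\<in>carrier F. eval_word A4 w = \<sigma> \<and> length w \<le> N)"

text \<open>
  A word in the generators that is treated as a single letter.  The default value makes it a word of length at most
  \<open>N\<close> for every matrix, so that membership and length need no side conditions.
\<close>

definition lett :: "'k mat4 \<Rightarrow> 'k mat4 word" where
  "lett \<sigma> = (if spelled \<sigma> then SOME w. w \<in> carrier F \<and> eval_word A4 w = \<sigma> \<and> length w \<le> N else \<one>\<^bsub>F\<^esub>)"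

lemma lett_spec:
  assumes "spelled \<sigma>"
  shows "lett \<sigma> \<in> carrier F \<and> eval_word A4 (lett \<sigma>) = \<sigma> \<and> length (lett \<sigma>) \<le> N"
proof -
  have "\<exists>w. w \<in> carrier F \<and> eval_word A4 w = \<sigma> \<and> length w \<le> N"
    using assms by (auto simp: spelled_def)
  from someI_ex[OF this] show ?thesis using assms by (simp add: lett_def)
qed

lemma lett_closed [simp]: "lett \<sigma> \<in> carrier F"
  using lett_spec[of \<sigma>] by (cases "spelled \<sigma>") (auto simp: lett_def)

lemma lett_length: "length (lett \<sigma>) \<le> N"
  using lett_spec[of \<sigma>] by (cases "spelled \<sigma>") (auto simp: lett_def free_group_def)

lemma eval_lett_elmat [simp]: "v \<in> V \<Longrightarrow> eval_word A4 (lett (elmat \<rho> v)) = elmat \<rho> v"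
  using lett_spec spelled_elmat by (auto simp: spelled_def)

lemma eval_lett_dgmat [simp]: "a \<in> units \<Longrightarrow> b \<in> units \<Longrightarrow> eval_word A4 (lett (dgmat a b)) = dgmat a b"
  using lett_spec spelled_dgmat by (auto simp: spelled_def)

definition wA :: "'k mat4 word" where "wA = lett (dgmat \<mu> 1)"
definition wB :: "'k mat4 word" where "wB = lett (dgmat 1 \<mu>)"

lemma wAB [simp]: "wA \<in> carrier F" "wB \<in> carrier F"
  "eval_word A4 wA = dgmat \<mu> 1" "eval_word A4 wB = dgmat 1 \<mu>" "length wA \<le> N" "length wB \<le> N"
  by (simp_all add: wA_def wB_def mu_units lett_length)

definition hword :: "int \<Rightarrow> int \<Rightarrow> 'k \<Rightarrow> 'k \<Rightarrow> 'k mat4 word" where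
  "hword k l c d = wA [^]\<^bsub>F\<^esub> k \<cdot> wB [^]\<^bsub>F\<^esub> l \<cdot> lett (dgmat c d)"

text \<open>
  The word for \<open>diag(1,a,b,1)\<close>: powers of the words for \<open>diag(1,\<mu>,1,1)\<close> and \<open>diag(1,1,\<mu>,1)\<close>, followed by one bounded
  letter.
\<close>

definition H :: "'k \<Rightarrow> 'k \<Rightarrow> 'k mat4 word" where
  "H a b = hword (pk a) (pk b) (pc a) (pc b)"

definition Tw :: "posroot \<Rightarrow> nat \<Rightarrow> 'k mat4 word" where
  "Tw \<rho> m = hword (- cp \<rho> * int m) (- cq \<rho> * int m) 1 1"

text \<open>
  The word \<open>t\<^sup>m s t\<^sup>-\<^sup>m\<close> for an elementary matrix, where \<open>t\<close> multiplies the entry by the inverse of \<open>\<mu>\<close>.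
\<close>

definition E :: "posroot \<Rightarrow> 'k \<Rightarrow> 'k mat4 word" where
  "E \<rho> x = Tw \<rho> (level x) \<cdot> lett (elmat \<rho> (\<mu> ^ level x * x)) \<cdot> inv\<^bsub>F\<^esub> (Tw \<rho> (level x))"

definition corner :: "'k \<Rightarrow> 'k mat4 word" where
  "corner x = E R13 x \<cdot> E R34 1 \<cdot> inv\<^bsub>F\<^esub> (E R13 x) \<cdot> inv\<^bsub>F\<^esub> (E R34 1)"

text \<open>
  The combing by normal forms; the corner is spelled as the commutator that represents it in \<open>unipotent_amalgam\<close>.
\<close>

definition \<omega> :: "'k mat4 \<Rightarrow> 'k mat4 word" where
  "\<omega> g = (corner (g $ 1 $ 4) \<cdot> (E R24 (g $ 2 $ 4) \<cdot> (E R34 (g $ 3 $ 4) \<cdot>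
      (E R13 (g $ 1 $ 3 / g $ 3 $ 3) \<cdot> (E R23 (g $ 2 $ 3 / g $ 3 $ 3) \<cdot>
      E R12 (g $ 1 $ 2 / g $ 2 $ 2)))))) \<cdot> H (g $ 2 $ 2) (g $ 3 $ 3)"

lemma words_closed [simp]:
  "hword k l c d \<in> carrier F" "H a b \<in> carrier F" "Tw \<rho> m \<in> carrier F" "E \<rho> x \<in> carrier F"
  "corner x \<in> carrier F" "\<omega> g \<in> carrier F"
  by (simp_all add: hword_def H_def Tw_def E_def corner_def \<omega>_def)

lemma eval_hword:
  assumes "c \<in> units" "d \<in> units"
  shows "eval_word A4 (hword k l c d) = dgmat (\<mu> powi k * c) (\<mu> powi l * d)"
  using assms mu_nz by (simp add: hword_def eval_mult ev.hom_int_pow dgmat_int_pow dgmat_mult)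

lemma eval_H: "a \<noteq> 0 \<Longrightarrow> b \<noteq> 0 \<Longrightarrow> eval_word A4 (H a b) = dgmat a b"
  using pk_pc[of a] pk_pc[of b] by (simp add: H_def eval_hword)

lemma dgmat_conj_elmat:
  assumes "a \<noteq> 0" "b \<noteq> 0"
  shows "dgmat a b ** elmat \<rho> x ** inv\<^bsub>A4\<^esub> (dgmat a b) = elmat \<rho> (wt \<rho> a b * x)"
proof -
  have "elmat \<rho> (wt \<rho> a b * x) ** dgmat a b ** inv\<^bsub>A4\<^esub> (dgmat a b) =
    elmat \<rho> (wt \<rho> a b * x) ** (dgmat a b \<otimes>\<^bsub>A4\<^esub> inv\<^bsub>A4\<^esub> (dgmat a b))"
    by (simp add: matrix_mul_assoc)
  then show ?thesis using assms by (simp add: dgmat_elmat A4.r_inv dgmat_in_A4 del: A4_mult)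
qed

lemma wt_contract: "wt \<rho> (\<mu> powi (cp \<rho> * k)) (\<mu> powi (cq \<rho> * k)) = \<mu> powi k"
  using mu_nz by (cases \<rho>) (simp_all add: power_int_minus)

lemma eval_E: "eval_word A4 (E \<rho> x) = elmat \<rho> x"
proof -
  let ?m = "level x"
  have "\<mu> ^ ?m * x \<in> V" using bnd_level by (simp add: bnd_def)
  moreover have "wt \<rho> (\<mu> powi (- cp \<rho> * int ?m)) (\<mu> powi (- cq \<rho> * int ?m)) = \<mu> powi (- int ?m)"
    using wt_contract[of \<rho> "- int ?m"] by simp
  ultimately show ?thesis
    using mu_nz
    by (simp add: E_def eval_mult ev.hom_inv Tw_def eval_hword mu_units dgmat_conj_elmat power_int_minus
        mult.assoc[symmetric])
qed

lemma eval_\<omega>: "g \<in> carrier A4 \<Longrightarrow> eval_word A4 (\<omega> g) = g"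
proof -
  assume g: "g \<in> carrier A4"
  then have "g $ 2 $ 2 \<noteq> 0" "g $ 3 $ 3 \<noteq> 0"
    by (auto simp: A4_def A4_carrier_def dvd_field_iff)
  then show ?thesis
    using A4_normal_form[OF g]
    by (simp add: \<omega>_def corner_def eval_mult eval_E eval_H ev.hom_inv elmat_commutator[simplified])
qed

lemma length_nat_pow_le: "length (u [^]\<^bsub>F\<^esub> (n::nat)) \<le> n * length u"
proof (induction n)
  case (Suc n)
  then show ?case using length_mult_le[of "u [^]\<^bsub>F\<^esub> n" u] by simp
qed (simp add: free_group_def)

lemma length_int_pow_le: "u \<in> carrier F \<Longrightarrow> length (u [^]\<^bsub>F\<^esub> (k::int)) \<le> nat \<bar>k\<bar> * length u"
  using length_nat_pow_le[of u]
  by (cases k rule: int_cases2)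
    (auto simp: int_pow_int F.int_pow_neg_int intro: le_trans[OF length_inv_le])

lemma hword_length: "length (hword k l c d) \<le> (nat \<bar>k\<bar> + nat \<bar>l\<bar> + 1) * N"
proof -
  have "length (wA [^]\<^bsub>F\<^esub> k) \<le> nat \<bar>k\<bar> * N" "length (wB [^]\<^bsub>F\<^esub> l) \<le> nat \<bar>l\<bar> * N"
    by (rule le_trans[OF length_int_pow_le]; simp)+
  then show ?thesis
    using length_mult_le[of "wA [^]\<^bsub>F\<^esub> k \<cdot> wB [^]\<^bsub>F\<^esub> l" "lett (dgmat c d)"]
      length_mult_le[of "wA [^]\<^bsub>F\<^esub> k" "wB [^]\<^bsub>F\<^esub> l"] lett_length[of "dgmat c d"]
    by (simp add: hword_def algebra_simps)
qed

lemma H_length: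
  assumes "a \<noteq> 0" "b \<noteq> 0" "bnd n a" "bnd n (inverse a)" "bnd n b" "bnd n (inverse b)"
  shows "length (H a b) \<le> (2 * (n + 2 * \<kappa> + 3) + 1) * N"
proof -
  have "nat \<bar>pk x\<bar> \<le> n + Suc \<kappa> + 1 + \<kappa>" if "x \<noteq> 0" "bnd n x" "bnd n (inverse x)" for x
    using exponent_bound[of n "pk x" "pc x" "Suc \<kappa>"] pk_pc[OF that(1)] that
    unfolding nat_le_iff by (auto simp: units_def)
  note pk = this
  have "p + q + 1 \<le> 2 * (n + 2 * \<kappa> + 3) + 1"
    if "p \<le> n + Suc \<kappa> + 1 + \<kappa>" "q \<le> n + Suc \<kappa> + 1 + \<kappa>" for p q
    using that by presburger
  from this[OF pk[OF assms(1,3,4)] pk[OF assms(2,5,6)]] have "nat \<bar>pk a\<bar> + nat \<bar>pk b\<bar> + 1 \<le> 2 * (n + 2 * \<kappa> + 3) + 1" .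
  then show ?thesis
    unfolding H_def by (meson hword_length le_trans mult_le_mono1)
qed

lemma E_length:
  assumes "bnd n x"
  shows "length (E \<rho> x) \<le> (2 * n + 3) * N"
proof -
  have T: "length (Tw \<rho> (level x)) \<le> (n + 1) * N"
  proof -
    have "nat \<bar>- cp \<rho> * int (level x)\<bar> + nat \<bar>- cq \<rho> * int (level x)\<bar> + 1 \<le> n + 1"
      using level_le[OF assms] by (cases \<rho>) auto
    then show ?thesis unfolding Tw_def by (meson hword_length le_trans mult_le_mono1)
  qed
  have "length (E \<rho> x) \<le> length (Tw \<rho> (level x)) + N + length (Tw \<rho> (level x))"
    unfolding E_def
    by (intro le_trans[OF length_mult_le] add_mono lett_length length_inv_le order_refl) simp
  then show ?thesis using T by (simp add: algebra_simps)
qed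

lemma \<omega>_length: "\<exists>L. \<forall>g. bounded_mat n g \<longrightarrow> length (\<omega> g) \<le> L"
proof -
  define K where "K = (2 * (2 * n + 1) + 3) * N"
  have E: "length (E \<rho> x) \<le> K" if "bnd (2 * n + 1) x" for \<rho> x
    using E_length[OF that] by (simp add: K_def)
  have "length (\<omega> g) \<le> (4 * K + (K + (K + (K + (K + K))))) + (2 * (n + 2 * \<kappa> + 3) + 1) * N"
    if g: "bounded_mat n g" for g
  proof -
    have nz: "g $ 2 $ 2 \<noteq> 0" "g $ 3 $ 3 \<noteq> 0"
      using g by (auto simp: bounded_mat_def A4_def A4_carrier_def dvd_field_iff)
    have b: "bnd (2 * n + 1) (g $ i $ j)" "bnd (2 * n + 1) (g $ i $ j / g $ 2 $ 2)"
      "bnd (2 * n + 1) (g $ i $ j / g $ 3 $ 3)" for i j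
      using bnd_mono[of n "g $ i $ j" "2 * n + 1"]
            g bnd_mult[of n "g $ i $ j" n] unfolding bounded_mat_def divide_inverse mult_2
      by (auto intro: bnd_mono)
    have "length (corner (g $ 1 $ 4)) \<le> K + K + K + K"
      unfolding corner_def
      by (intro le_trans[OF length_mult_le] add_mono E b le_trans[OF length_inv_le]) simp_all
    then have c: "length (corner (g $ 1 $ 4)) \<le> 4 * K" by simp
    show ?thesis
      unfolding \<omega>_def
      by (intro le_trans[OF length_mult_le] add_mono E c b H_length nz)
        (use g in \<open>auto simp: bounded_mat_def\<close>)
  qed
  then show ?thesis by blast
qed

end

section \<open>Relations between the words modulo quadratic area\<close>

locale abels_families = abels_words V \<mu> \<kappa> S N + scaled_presentation "A4 :: 'k mat4 monoid" S len
  for V :: "'k::field set" and \<mu> \<kappa> S N and len :: "'i \<Rightarrow> nat"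
begin

abbreviation \<Gamma>_mult (infixl "\<odot>" 70) where
  "x \<odot> y \<equiv> x \<otimes>\<^bsub>\<Gamma>\<^esub> y"

definition lin :: "('i \<Rightarrow> nat) \<Rightarrow> bool" where
  "lin k \<longleftrightarrow> (\<exists>C. \<forall>i. k i \<le> C * len i)"

lemma lin_mono: "lin k \<Longrightarrow> (\<And>i. l i \<le> k i) \<Longrightarrow> lin l"
  unfolding lin_def by (meson le_trans)

lemma lin_const: "lin (\<lambda>_. c)"
  unfolding lin_def using len_pos by (metis mult.right_neutral mult_le_mono2)

lemma lin_add: "lin k \<Longrightarrow> lin l \<Longrightarrow> lin (\<lambda>i. k i + l i)"
  unfolding lin_def by (metis add_mono add_mult_distrib)

lemma lin_cmult: "lin k \<Longrightarrow> lin (\<lambda>i. c * k i)"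
  unfolding lin_def by (metis mult.assoc mult_le_mono2)

lemmas lin_intros = lin_const lin_add lin_cmult

definition ilin :: "('i \<Rightarrow> int) \<Rightarrow> bool" where
  "ilin k \<longleftrightarrow> lin (\<lambda>i. nat \<bar>k i\<bar>)"

lemma ilin_mono: "lin l \<Longrightarrow> (\<And>i. \<bar>k i\<bar> \<le> int (l i)) \<Longrightarrow> ilin k"
  unfolding ilin_def by (erule lin_mono) (simp add: nat_le_iff)

lemma ilin_cmult: "lin m \<Longrightarrow> ilin (\<lambda>i. c * int (m i))"
  by (rule ilin_mono[OF lin_cmult[of m "nat \<bar>c\<bar>"]]) (simp_all add: abs_mult)

lemma ilin_zero: "ilin (\<lambda>_. 0)"
  by (simp add: ilin_def lin_const)

text \<open>
  Used when two powers with linearly bounded exponents are interchanged.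
\<close>

lemma cls_eq_quadratic:
  assumes "\<And>i. close r (p i * q i) (f i) (g i)" "lin p" "lin q"
  shows "cls f = cls g"
proof -
  obtain C D where CD: "\<And>i. p i \<le> C * len i" "\<And>i. q i \<le> D * len i"
    using assms(2,3) unfolding lin_def by blast
  have "p i * q i \<le> (C * D) * (len i)\<^sup>2" for i
    using mult_le_mono[OF CD(1)[of i] CD(2)[of i]] by (simp add: power2_eq_square ac_simps)
  then show ?thesis
    by (intro cls_eqI[of r "C * D"]) (rule close_mono[OF assms(1)], auto)
qed

lemma cls_eq_linear:
  assumes "\<And>i. close r (p i) (f i) (g i)" "lin p"
  shows "cls f = cls g"
  by (rule cls_eq_quadratic[of r p "\<lambda>_. 1"]) (use assms lin_const in auto)

text \<open>
  The ring of families of bounded growth, with its units \<open>\<U>\<close> below.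
\<close>

definition \<R> :: "('i \<Rightarrow> 'k) set" where
  "\<R> = {x. \<exists>n. lin n \<and> (\<forall>i. bnd (n i) (x i))}"

lemma \<R>_I: "lin n \<Longrightarrow> (\<And>i. bnd (n i) (x i)) \<Longrightarrow> x \<in> \<R>"
  by (auto simp: \<R>_def)

lemma \<R>_E:
  assumes "x \<in> \<R>"
  obtains n where "lin n" "\<And>i. bnd (n i) (x i)"
  using assms by (auto simp: \<R>_def)

lemma \<R>_add:
  assumes "x \<in> \<R>" "y \<in> \<R>"
  shows "(\<lambda>i. x i + y i) \<in> \<R>"
proof -
  obtain n where n: "lin n" "\<And>i. bnd (n i) (x i)" using \<R>_E[OF assms(1)] by blast
  obtain m where m: "lin m" "\<And>i. bnd (m i) (y i)" using \<R>_E[OF assms(2)] by blast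
  show ?thesis
    by (rule \<R>_I[OF lin_add[OF lin_add[OF n(1) m(1)] lin_const]]) (rule bnd_add[OF n(2) m(2)])
qed

lemma \<R>_mult:
  assumes "x \<in> \<R>" "y \<in> \<R>"
  shows "(\<lambda>i. x i * y i) \<in> \<R>"
proof -
  obtain n where n: "lin n" "\<And>i. bnd (n i) (x i)" using \<R>_E[OF assms(1)] by blast
  obtain m where m: "lin m" "\<And>i. bnd (m i) (y i)" using \<R>_E[OF assms(2)] by blast
  show ?thesis
    by (rule \<R>_I[OF lin_add[OF lin_add[OF n(1) m(1)] lin_const]]) (rule bnd_mult[OF n(2) m(2)])
qed

lemma \<R>_one: "(\<lambda>_. 1) \<in> \<R>"
  by (rule \<R>_I[OF lin_const]) simp

definition \<U> :: "('i \<Rightarrow> 'k) set" where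
  "\<U> = {a. (\<forall>i. a i \<noteq> 0) \<and> a \<in> \<R> \<and> (\<lambda>i. inverse (a i)) \<in> \<R>}"

lemma \<U>_D: "a \<in> \<U> \<Longrightarrow> a i \<noteq> 0" "a \<in> \<U> \<Longrightarrow> a \<in> \<R>" "a \<in> \<U> \<Longrightarrow> (\<lambda>i. inverse (a i)) \<in> \<R>"
  by (auto simp: \<U>_def)

lemma \<U>_mult: "a \<in> \<U> \<Longrightarrow> b \<in> \<U> \<Longrightarrow> (\<lambda>i. a i * b i) \<in> \<U>"
  unfolding \<U>_def by (auto intro: \<R>_mult)

lemma \<U>_powi: "ilin k \<Longrightarrow> (\<lambda>i. \<mu> powi k i) \<in> \<U>"
proof -
  assume k: "ilin k"
  have "(\<lambda>i. \<mu> powi k i) \<in> \<R>" "(\<lambda>i. \<mu> powi (- k i)) \<in> \<R>"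
    using k bnd_powi[of "k i" for i] bnd_powi[of "- k i" for i] unfolding ilin_def by (auto intro!: \<R>_I)
  then show ?thesis using mu_nz by (simp add: \<U>_def power_int_minus)
qed

lemma wt_\<R>:
  assumes "a \<in> \<U>" "b \<in> \<U>"
  shows "(\<lambda>i. wt \<rho> (a i) (b i)) \<in> \<R>"
  using assms \<R>_mult[of a "\<lambda>i. inverse (b i)"] by (cases \<rho>) (auto simp: \<U>_def)

lemma pk_ilin:
  assumes "a \<in> \<U>"
  shows "ilin (\<lambda>i. pk (a i))"
proof -
  obtain n n' where n: "lin n" "\<And>i. bnd (n i) (a i)" "lin n'" "\<And>i. bnd (n' i) (inverse (a i))"
    using \<R>_E[OF \<U>_D(2)[OF assms]] \<R>_E[OF \<U>_D(3)[OF assms]] by metis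
  have "\<bar>pk (a i)\<bar> \<le> int ((n i + n' i) + Suc \<kappa> + 1 + \<kappa>)" for i
  proof (rule exponent_bound[where c = "pc (a i)"])
    have a: "\<mu> powi pk (a i) * pc (a i) = a i" "pc (a i) \<in> units"
      using pk_pc[of "a i"] \<U>_D(1)[OF assms] by auto
    show "bnd (n i + n' i) (\<mu> powi pk (a i) * pc (a i))"
      "bnd (n i + n' i) (inverse (\<mu> powi pk (a i) * pc (a i)))"
      using n(2,4)[of i] by (auto simp: a intro: bnd_mono)
  qed (use pk_pc(2)[of "a i"] \<U>_D(1)[OF assms] in \<open>auto simp: units_def\<close>)
  then show ?thesis
    by (rule ilin_mono[rotated]) (intro lin_intros n)
qed

text \<open>
  The classes of the three factors of a diagonal word.
\<close>

definition \<alpha> :: "('i \<Rightarrow> int) \<Rightarrow> ('i \<Rightarrow> 'k mat4 word) set" where "\<alpha> k = cls (\<lambda>i. wA [^]\<^bsub>F\<^esub> k i)"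
definition \<beta> :: "('i \<Rightarrow> int) \<Rightarrow> ('i \<Rightarrow> 'k mat4 word) set" where "\<beta> k = cls (\<lambda>i. wB [^]\<^bsub>F\<^esub> k i)"
definition \<gamma> :: "('i \<Rightarrow> 'k) \<Rightarrow> ('i \<Rightarrow> 'k) \<Rightarrow> ('i \<Rightarrow> 'k mat4 word) set" where
  "\<gamma> c d = cls (\<lambda>i. lett (dgmat (c i) (d i)))"

lemma \<alpha>\<beta>\<gamma>_closed [simp]: "\<alpha> k \<in> carrier \<Gamma>" "\<beta> k \<in> carrier \<Gamma>" "\<gamma> c d \<in> carrier \<Gamma>"
  by (auto simp: \<alpha>_def \<beta>_def \<gamma>_def intro!: cls_closed)

lemma \<alpha>_add: "\<alpha> k \<odot> \<alpha> l = \<alpha> (\<lambda>i. k i + l i)"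
  unfolding \<alpha>_def by (subst cls_mult) (auto simp: F.int_pow_mult)

lemma \<beta>_add: "\<beta> k \<odot> \<beta> l = \<beta> (\<lambda>i. k i + l i)"
  unfolding \<beta>_def by (subst cls_mult) (auto simp: F.int_pow_mult)

lemma \<alpha>\<beta>_zero: "\<alpha> (\<lambda>_. 0) = \<one>\<^bsub>\<Gamma>\<^esub>" "\<beta> (\<lambda>_. 0) = \<one>\<^bsub>\<Gamma>\<^esub>"
  by (simp_all add: \<alpha>_def \<beta>_def cls_one)

lemma close_lett:
  assumes "eval_word A4 (u \<cdot> v) = eval_word A4 (v' \<cdot> u')" "u \<in> carrier F" "u' \<in> carrier F"
    "v \<in> carrier F" "v' \<in> carrier F" "length u \<le> N" "length v \<le> N" "length u' \<le> N" "length v' \<le> N"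
  shows "close (4 * N) 1 (u \<cdot> v) (v' \<cdot> u')"
  by (rule close_relation)
    (use assms length_mult_le[of u v] length_mult_le[of v' u'] in auto)

lemma \<beta>\<alpha>: "ilin k \<Longrightarrow> ilin l \<Longrightarrow> \<beta> l \<odot> \<alpha> k = \<alpha> k \<odot> \<beta> l"
proof -
  assume kl: "ilin k" "ilin l"
  have "close (4 * N) 1 (wB \<cdot> wA) (wA \<cdot> wB)"
    by (rule close_lett) (simp_all add: eval_mult dgmat_mult)
  note c = close_commute_powers[OF this]
  have "cls (\<lambda>i. wB [^]\<^bsub>F\<^esub> l i \<cdot> wA [^]\<^bsub>F\<^esub> k i) = cls (\<lambda>i. wA [^]\<^bsub>F\<^esub> k i \<cdot> wB [^]\<^bsub>F\<^esub> l i)"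
  proof (rule cls_eq_quadratic)
    show "close (4 * N) (nat \<bar>l i\<bar> * (nat \<bar>k i\<bar> * 1)) (wB [^]\<^bsub>F\<^esub> l i \<cdot> wA [^]\<^bsub>F\<^esub> k i)
      (wA [^]\<^bsub>F\<^esub> k i \<cdot> wB [^]\<^bsub>F\<^esub> l i)" for i by (rule c) simp_all
  qed (use kl in \<open>simp_all add: ilin_def\<close>)
  then show ?thesis by (simp add: \<alpha>_def \<beta>_def cls_mult)
qed

lemma close_commute_diag:
  fixes k :: int
  assumes "c \<in> units" "d \<in> units" "u \<in> carrier F" "length u \<le> N"
    "eval_word A4 u ** dgmat c d = dgmat c d ** eval_word A4 u"
  shows "close (4 * N) (nat \<bar>k\<bar>) (lett (dgmat c d) \<cdot> u [^]\<^bsub>F\<^esub> k) (u [^]\<^bsub>F\<^esub> k \<cdot> lett (dgmat c d))"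
proof -
  have "close (4 * N) 1 (u \<cdot> lett (dgmat c d)) (lett (dgmat c d) \<cdot> u)"
    by (rule close_lett) (use assms in \<open>simp_all add: eval_mult lett_length\<close>)
  then have "close (4 * N) (nat \<bar>k\<bar> * 1) (u [^]\<^bsub>F\<^esub> k \<cdot> lett (dgmat c d)) (lett (dgmat c d) \<cdot> u [^]\<^bsub>F\<^esub> k)"
    by (intro close_intertwine_int[where w = "\<lambda>_. lett (dgmat c d)"]) (use assms in auto)
  then show ?thesis using close_sym by simp
qed

lemma \<gamma>\<alpha>:
  assumes "ilin k" "range c \<subseteq> units" "range d \<subseteq> units"
  shows "\<gamma> c d \<odot> \<alpha> k = \<alpha> k \<odot> \<gamma> c d"
proof -
  have "cls (\<lambda>i. lett (dgmat (c i) (d i)) \<cdot> wA [^]\<^bsub>F\<^esub> k i) = cls (\<lambda>i. wA [^]\<^bsub>F\<^esub> k i \<cdot> lett (dgmat (c i) (d i)))"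
    by (rule cls_eq_linear[OF close_commute_diag])
      (use assms in \<open>auto simp: dgmat_mult mult.commute ilin_def\<close>)
  then show ?thesis by (simp add: \<alpha>_def \<gamma>_def cls_mult)
qed

lemma \<gamma>\<beta>:
  assumes "ilin k" "range c \<subseteq> units" "range d \<subseteq> units"
  shows "\<gamma> c d \<odot> \<beta> k = \<beta> k \<odot> \<gamma> c d"
proof -
  have "cls (\<lambda>i. lett (dgmat (c i) (d i)) \<cdot> wB [^]\<^bsub>F\<^esub> k i) = cls (\<lambda>i. wB [^]\<^bsub>F\<^esub> k i \<cdot> lett (dgmat (c i) (d i)))"
    by (rule cls_eq_linear[OF close_commute_diag])
      (use assms in \<open>auto simp: dgmat_mult mult.commute ilin_def\<close>)
  then show ?thesis by (simp add: \<beta>_def \<gamma>_def cls_mult)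
qed

lemma cls_hword: "cls (\<lambda>i. hword (k i) (l i) (c i) (d i)) = \<alpha> k \<odot> \<beta> l \<odot> \<gamma> c d"
  by (simp add: hword_def \<alpha>_def \<beta>_def \<gamma>_def cls_mult)

text \<open>
  The discrepancy between the two bounded factors is a bounded power of \<open>\<mu>\<close>, so the relation has bounded length.
\<close>

lemma \<gamma>_mult:
  assumes "range c \<subseteq> units" "range d \<subseteq> units" "range c' \<subseteq> units" "range d' \<subseteq> units"
    "range c'' \<subseteq> units" "range d'' \<subseteq> units"
    and eq: "\<And>i. c i * c' i = \<mu> powi s i * c'' i" "\<And>i. d i * d' i = \<mu> powi t i * d'' i"
  shows "\<gamma> c d \<odot> \<gamma> c' d' = \<alpha> s \<odot> \<beta> t \<odot> \<gamma> c'' d''" "ilin s" "ilin t"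
proof -
  define K where "K = (Suc \<kappa> + Suc \<kappa> + 1) + Suc \<kappa> + 1 + \<kappa>"
  have bound: "\<bar>j\<bar> \<le> int K" if "x * x' = \<mu> powi j * x''" "x \<in> units" "x' \<in> units" "x'' \<in> units" for j x x' x''
  proof -
    have u: "bnd (Suc \<kappa> + Suc \<kappa> + 1) (x * x')" "bnd (Suc \<kappa> + Suc \<kappa> + 1) (inverse x * inverse x')"
      using that by (intro bnd_mult; simp add: units_def)+
    have x'': "x'' \<noteq> 0" "bnd (Suc \<kappa>) x''" "bnd (Suc \<kappa>) (inverse x'')"
      using that(4) by (auto simp: units_def)
    show ?thesis
      unfolding K_def
      by (rule exponent_bound[OF _ _ x''])
        (unfold that(1)[symmetric] inverse_mult_distrib, rule u, rule u)
  qed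
  have st: "\<bar>s i\<bar> \<le> int K" "\<bar>t i\<bar> \<le> int K" for i
    using assms by (intro bound[OF eq(1)] bound[OF eq(2)]; auto)+
  show "ilin s" "ilin t"
    by (rule ilin_mono[OF lin_const], rule st)+
  have "cls (\<lambda>i. lett (dgmat (c i) (d i)) \<cdot> lett (dgmat (c' i) (d' i))) =
      cls (\<lambda>i. hword (s i) (t i) (c'' i) (d'' i))"
  proof (rule cls_relation[where L = "(K + K + 1) * N + 2 * N"])
    fix i
    have u: "c i \<in> units" "d i \<in> units" "c' i \<in> units" "d' i \<in> units" "c'' i \<in> units" "d'' i \<in> units"
      using assms by auto
    show "eval_word A4 (lett (dgmat (c i) (d i)) \<cdot> lett (dgmat (c' i) (d' i))) =
        eval_word A4 (hword (s i) (t i) (c'' i) (d'' i))"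
      using u by (simp add: eval_mult eval_hword dgmat_mult eq)
    show "length (lett (dgmat (c i) (d i)) \<cdot> lett (dgmat (c' i) (d' i))) \<le> (K + K + 1) * N + 2 * N"
      using length_mult_le[of "lett (dgmat (c i) (d i))" "lett (dgmat (c' i) (d' i))"]
        lett_length[of "dgmat (c i) (d i)"] lett_length[of "dgmat (c' i) (d' i)"] by simp
    have "(nat \<bar>s i\<bar> + nat \<bar>t i\<bar> + 1) * N \<le> (K + K + 1) * N"
      using st[of i] by (intro mult_le_mono1 add_mono) (auto simp: nat_le_iff)
    then show "length (hword (s i) (t i) (c'' i) (d'' i)) \<le> (K + K + 1) * N + 2 * N"
      using hword_length[of "s i" "t i" "c'' i" "d'' i"] by linarith
  qed auto
  then show "\<gamma> c d \<odot> \<gamma> c' d' = \<alpha> s \<odot> \<beta> t \<odot> \<gamma> c'' d''"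
    unfolding cls_hword by (simp add: \<gamma>_def cls_mult)
qed

text \<open>
  Diagonal words are multiplied at quadratic cost: the powers are collected by commuting them, and the bounded
  factors are combined with \<open>\<gamma>_mult\<close>.  The decompositions \<open>\<mu>\<^sup>k c\<close> are arbitrary, so this also shows that the class of a
  diagonal word does not depend on the decomposition (lemma \<open>HH_eq\<close>).
\<close>

lemma hword_mult:
  assumes "ilin k" "ilin l" "ilin k'" "ilin l'"
    and r: "range c \<subseteq> units" "range d \<subseteq> units" "range c' \<subseteq> units" "range d' \<subseteq> units"
    "range c'' \<subseteq> units" "range d'' \<subseteq> units"
    and eq: "\<And>i. (\<mu> powi k i * c i) * (\<mu> powi k' i * c' i) = \<mu> powi k'' i * c'' i"
      "\<And>i. (\<mu> powi l i * d i) * (\<mu> powi l' i * d' i) = \<mu> powi l'' i * d'' i"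
  shows "\<alpha> k \<odot> \<beta> l \<odot> \<gamma> c d \<odot> (\<alpha> k' \<odot> \<beta> l' \<odot> \<gamma> c' d')
    = \<alpha> k'' \<odot> \<beta> l'' \<odot> \<gamma> c'' d''"
proof -
  define s where "s = (\<lambda>i. k'' i - k i - k' i)"
  define t where "t = (\<lambda>i. l'' i - l i - l' i)"
  have "c i * c' i = \<mu> powi s i * c'' i" "d i * d' i = \<mu> powi t i * d'' i" for i
    using eq[of i] mu_nz by (simp_all add: s_def t_def power_int_diff power_int_add field_simps)
  note g = \<gamma>_mult[OF r this]
  have "\<alpha> k \<odot> \<beta> l \<odot> \<gamma> c d \<odot> (\<alpha> k' \<odot> \<beta> l' \<odot> \<gamma> c' d')
    = (\<alpha> k \<odot> \<alpha> k') \<odot> ((\<beta> l \<odot> \<beta> l') \<odot> (\<gamma> c d \<odot> \<gamma> c' d'))"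
    using assms
    by (simp add: \<Gamma>.m_assoc \<gamma>\<alpha> \<gamma>\<beta> \<beta>\<alpha> \<Gamma>.m_assoc_subst[OF \<gamma>\<alpha>] \<Gamma>.m_assoc_subst[OF \<gamma>\<beta>] \<Gamma>.m_assoc_subst[OF \<beta>\<alpha>])
  also have "\<dots> = (\<alpha> k \<odot> \<alpha> k' \<odot> \<alpha> s) \<odot> ((\<beta> l \<odot> \<beta> l' \<odot> \<beta> t) \<odot> \<gamma> c'' d'')"
    using assms g(2,3)
    by (simp add: g(1) \<Gamma>.m_assoc \<Gamma>.m_assoc_subst[OF \<beta>\<alpha>])
  also have "\<dots> = \<alpha> k'' \<odot> \<beta> l'' \<odot> \<gamma> c'' d''"
    by (simp add: \<alpha>_add \<beta>_add s_def t_def \<Gamma>.m_assoc)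
  finally show ?thesis .
qed

lemma \<gamma>_one: "\<gamma> (\<lambda>_. 1) (\<lambda>_. 1) = \<one>\<^bsub>\<Gamma>\<^esub>"
proof -
  have "cls (\<lambda>_. lett (dgmat 1 1)) = cls (\<lambda>_. \<one>\<^bsub>F\<^esub>)"
    by (rule cls_relation[where L = "N"])
      (simp_all add: mu_units lett_length, simp_all add: elmat_zero free_group_def)
  then show ?thesis by (simp add: \<gamma>_def cls_one)
qed

definition HH :: "('i \<Rightarrow> 'k) \<Rightarrow> ('i \<Rightarrow> 'k) \<Rightarrow> ('i \<Rightarrow> 'k mat4 word) set" where
  "HH a b = cls (\<lambda>i. H (a i) (b i))"

lemma HH_closed [simp]: "HH a b \<in> carrier \<Gamma>"
  by (auto simp: HH_def intro!: cls_closed)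

lemma HH_pk_pc: "HH a b = \<alpha> (\<lambda>i. pk (a i)) \<odot> \<beta> (\<lambda>i. pk (b i)) \<odot> \<gamma> (\<lambda>i. pc (a i)) (\<lambda>i. pc (b i))"
  unfolding HH_def H_def by (rule cls_hword)

lemma HH_mult:
  assumes "a \<in> \<U>" "b \<in> \<U>" "a' \<in> \<U>" "b' \<in> \<U>"
  shows "HH a b \<odot> HH a' b' = HH (\<lambda>i. a i * a' i) (\<lambda>i. b i * b' i)"
  unfolding HH_pk_pc
  by (rule hword_mult) (use assms[THEN \<U>_D(1)] in \<open>auto intro!: pk_ilin assms pk_pc(2) simp: pk_pc(1)[symmetric]\<close>)

lemma HH_eq:
  assumes "ilin k" "ilin l" "range c \<subseteq> units" "range d \<subseteq> units"
  shows "HH (\<lambda>i. \<mu> powi k i * c i) (\<lambda>i. \<mu> powi l i * d i) = \<alpha> k \<odot> \<beta> l \<odot> \<gamma> c d"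
proof -
  have nz: "\<mu> powi k i * c i \<noteq> 0" "\<mu> powi l i * d i \<noteq> 0" for i
    using assms(3,4) mu_nz by (auto simp: units_def)
  have "\<alpha> k \<odot> \<beta> l \<odot> \<gamma> c d \<odot> (\<alpha> (\<lambda>_. 0) \<odot> \<beta> (\<lambda>_. 0) \<odot> \<gamma> (\<lambda>_. 1) (\<lambda>_. 1)) =
    HH (\<lambda>i. \<mu> powi k i * c i) (\<lambda>i. \<mu> powi l i * d i)"
    unfolding HH_pk_pc
    by (rule hword_mult) (use nz mu_units assms in \<open>auto intro!: pk_pc(2) ilin_zero simp: pk_pc(1)[symmetric]\<close>)
  then show ?thesis by (simp add: \<alpha>\<beta>_zero \<gamma>_one)
qed

text \<open>
  \<open>LL\<close> spells bounded families by single letters; \<open>EE\<close>, defined further below, spells all families of bounded growth.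
\<close>

definition LL :: "posroot \<Rightarrow> ('i \<Rightarrow> 'k) \<Rightarrow> ('i \<Rightarrow> 'k mat4 word) set" where
  "LL \<rho> v = cls (\<lambda>i. lett (elmat \<rho> (v i)))"

lemma LL_closed [simp]: "LL \<rho> v \<in> carrier \<Gamma>"
  by (auto simp: LL_def intro!: cls_closed)

lemma close_step:
  assumes "u \<in> carrier F" "length u \<le> N" "eval_word A4 u = dgmat a b" "a \<noteq> 0" "b \<noteq> 0"
    and "x \<in> V" "wt \<rho> a b * x \<in> V"
  shows "close (4 * N) 1 (u \<cdot> lett (elmat \<rho> x)) (lett (elmat \<rho> (wt \<rho> a b * x)) \<cdot> u)"
  by (rule close_lett) (use assms in \<open>simp_all add: eval_mult dgmat_elmat lett_length\<close>)

text \<open>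
  A power of a diagonal letter is moved across a bounded elementary letter one step at a time.  Each step
  is a relation of bounded length provided all intermediate values stay in \<open>V\<close>.
\<close>

lemma power_LL:
  assumes u: "u \<in> carrier F" "length u \<le> N" "eval_word A4 u = dgmat a b" "a \<noteq> 0" "b \<noteq> 0"
    and "ilin k" and V: "\<And>i j. j \<in> {min 0 (k i)..max 0 (k i)} \<Longrightarrow> wt \<rho> (a powi j) (b powi j) * v i \<in> V"
  shows "cls (\<lambda>i. u [^]\<^bsub>F\<^esub> k i) \<odot> LL \<rho> v =
    LL \<rho> (\<lambda>i. wt \<rho> (a powi k i) (b powi k i) * v i) \<odot> cls (\<lambda>i. u [^]\<^bsub>F\<^esub> k i)"
proof -
  let ?w = "\<lambda>i j. lett (elmat \<rho> (wt \<rho> (a powi j) (b powi j) * v i))"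
  have step: "wt \<rho> (a powi (j + 1)) (b powi (j + 1)) * x = wt \<rho> a b * (wt \<rho> (a powi j) (b powi j) * x)" for j x
    using wt_mult[of \<rho> a "a powi j" b "b powi j"] u(4,5) by (simp add: power_int_add mult.commute)
  have "close (4 * N) (nat \<bar>k i\<bar> * 1) (u [^]\<^bsub>F\<^esub> k i \<cdot> ?w i 0) (?w i (k i) \<cdot> u [^]\<^bsub>F\<^esub> k i)" for i
  proof (rule close_intertwine_int)
    fix j assume "{j, j + 1} \<subseteq> {min 0 (k i)..max 0 (k i)}"
    then have "wt \<rho> (a powi j) (b powi j) * v i \<in> V" "wt \<rho> (a powi (j + 1)) (b powi (j + 1)) * v i \<in> V"
      by (auto intro!: V simp del: power_int_add_1)
    then show "close (4 * N) 1 (u \<cdot> ?w i j) (?w i (j + 1) \<cdot> u)"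
      unfolding step by (intro close_step u)
  qed (use u(1) in simp_all)
  then have "cls (\<lambda>i. u [^]\<^bsub>F\<^esub> k i \<cdot> ?w i 0) = cls (\<lambda>i. ?w i (k i) \<cdot> u [^]\<^bsub>F\<^esub> k i)"
    by (rule cls_eq_linear) (use assms(6) in \<open>simp add: ilin_def\<close>)
  then show ?thesis using u(1) by (simp add: LL_def cls_mult)
qed

lemma \<alpha>_LL:
  assumes "ilin k" "\<And>i j. j \<in> {min 0 (k i)..max 0 (k i)} \<Longrightarrow> wt \<rho> (\<mu> powi j) 1 * v i \<in> V"
  shows "\<alpha> k \<odot> LL \<rho> v = LL \<rho> (\<lambda>i. wt \<rho> (\<mu> powi k i) 1 * v i) \<odot> \<alpha> k"
  using power_LL[of wA \<mu> 1 k \<rho> v] assms mu_nz by (simp add: \<alpha>_def)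

lemma \<beta>_LL:
  assumes "ilin k" "\<And>i j. j \<in> {min 0 (k i)..max 0 (k i)} \<Longrightarrow> wt \<rho> 1 (\<mu> powi j) * v i \<in> V"
  shows "\<beta> k \<odot> LL \<rho> v = LL \<rho> (\<lambda>i. wt \<rho> 1 (\<mu> powi k i) * v i) \<odot> \<beta> k"
  using power_LL[of wB 1 \<mu> k \<rho> v] assms mu_nz by (simp add: \<beta>_def)

lemma \<gamma>_LL:
  assumes "range c \<subseteq> units" "range d \<subseteq> units" "\<And>i. v i \<in> V" "\<And>i. wt \<rho> (c i) (d i) * v i \<in> V"
  shows "\<gamma> c d \<odot> LL \<rho> v = LL \<rho> (\<lambda>i. wt \<rho> (c i) (d i) * v i) \<odot> \<gamma> c d"
proof -
  have "close (4 * N) 1 (lett (dgmat (c i) (d i)) \<cdot> lett (elmat \<rho> (v i)))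
    (lett (elmat \<rho> (wt \<rho> (c i) (d i) * v i)) \<cdot> lett (dgmat (c i) (d i)))" for i
  proof (rule close_step)
    have "c i \<in> units" "d i \<in> units" using assms by auto
    then show "eval_word A4 (lett (dgmat (c i) (d i))) = dgmat (c i) (d i)" "c i \<noteq> 0" "d i \<noteq> 0"
      by (simp_all, auto simp: units_def)
  qed (use assms lett_length in auto)
  then have "cls (\<lambda>i. lett (dgmat (c i) (d i)) \<cdot> lett (elmat \<rho> (v i))) =
    cls (\<lambda>i. lett (elmat \<rho> (wt \<rho> (c i) (d i) * v i)) \<cdot> lett (dgmat (c i) (d i)))"
    by (rule cls_eq_linear) (rule lin_const)
  then show ?thesis by (simp add: \<gamma>_def LL_def cls_mult)
qed

lemma mu_power_V: "x \<in> V \<Longrightarrow> \<mu> ^ n * x \<in> V"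
  using bnd_mono[of 0 x n] by (simp add: bnd_def)

lemma powi_V: "x \<in> V \<Longrightarrow> 0 \<le> e \<Longrightarrow> \<mu> powi e * x \<in> V"
  using mu_power_V by (metis nonneg_int_cases power_int_of_nat)

lemma small_mult:
  assumes "bnd n y" "inverse \<mu> ^ m * v \<in> V" "n < m"
  shows "y * v \<in> V"
proof -
  have "\<mu> ^ (n + 0 + 1) * (y * (inverse \<mu> ^ m * v)) \<in> V"
    using bnd_mult[of n y 0 "inverse \<mu> ^ m * v"] assms by (simp add: bnd_def)
  then have "\<mu> ^ (m - (n + 1)) * (\<mu> ^ (n + 0 + 1) * (y * (inverse \<mu> ^ m * v))) \<in> V"
    by (rule mu_power_V)
  moreover have "\<mu> ^ (m - (n + 1)) * (\<mu> ^ (n + 0 + 1) * (y * (inverse \<mu> ^ m * v))) =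
      (\<mu> ^ (m - (n + 1) + (n + 1)) * inverse \<mu> ^ m) * (y * v)"
    by (simp only: power_add power_0 mult_1_left mult_1_right ac_simps)
  moreover have "m - (n + 1) + (n + 1) = m" using assms(3) by simp
  moreover have "\<mu> ^ m * inverse \<mu> ^ m = 1" using mu_nz by (simp add: power_inverse)
  ultimately show ?thesis by (simp only: mult_1_left)
qed

lemma wt_mult3:
  "wt \<rho> a 1 * (wt \<rho> 1 b * (wt \<rho> c d * v)) = wt \<rho> (a * c) (b * d) * v"
  using wt_mult[of \<rho> 1 c b d] wt_mult[of \<rho> a c 1 "b * d"] by (simp add: mult.assoc)

lemma wt_mult2: "wt \<rho> a 1 * (wt \<rho> 1 b * v) = wt \<rho> a b * v"
  using wt_mult3[of \<rho> a b 1 1 v] by (simp only: wt_one mult_1_left mult_1_right)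

text \<open>
  If \<open>v\<close> is small enough compared with \<open>a\<close> and \<open>b\<close>, no intermediate value leaves \<open>V\<close>, so the three factors of the
  diagonal word can be moved across in turn.
\<close>

lemma HH_LL_small:
  assumes "a \<in> \<U>" "b \<in> \<U>"
  obtains m where "lin m" "\<And>v. (\<And>i. inverse \<mu> ^ m i * v i \<in> V) \<Longrightarrow>
    HH a b \<odot> LL \<rho> v = LL \<rho> (\<lambda>i. wt \<rho> (a i) (b i) * v i) \<odot> HH a b"
proof
  define k where "k = (\<lambda>i. pk (a i))"
  define l where "l = (\<lambda>i. pk (b i))"
  define c where "c = (\<lambda>i. pc (a i))"
  define d where "d = (\<lambda>i. pc (b i))"
  have kl: "ilin k" "ilin l" using pk_ilin assms by (auto simp: k_def l_def)
  have cd: "range c \<subseteq> units" "range d \<subseteq> units"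
    using pk_pc(2) assms[THEN \<U>_D(1)] by (auto simp: c_def d_def)
  have ab: "a i = \<mu> powi k i * c i" "b i = \<mu> powi l i * d i" for i
    using pk_pc(1) assms[THEN \<U>_D(1)] by (auto simp: k_def c_def l_def d_def)
  \<comment> \<open>Bounds the sizes of the diagonal entries at every intermediate stage, and of their inverses.\<close>
  define n where "n = (\<lambda>i. (nat \<bar>k i\<bar> + nat \<bar>l i\<bar> + Suc \<kappa> + 1) + (nat \<bar>k i\<bar> + nat \<bar>l i\<bar> + Suc \<kappa> + 1))"
  define m where "m = (\<lambda>i. 2 * n i + 2)"
  show "lin m"
    unfolding m_def n_def by (intro lin_intros kl[unfolded ilin_def])
  fix v assume v: "\<And>i. inverse \<mu> ^ m i * v i \<in> V"
  have small: "wt \<rho> (\<mu> powi j * x) (\<mu> powi j' * x') * v i \<in> V"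
    if j: "\<bar>j\<bar> \<le> \<bar>k i\<bar>" "\<bar>j'\<bar> \<le> \<bar>l i\<bar>" and x: "x \<in> units" "x' \<in> units" for i j j' x x'
  proof (rule small_mult[OF wt_bnd v])
    have *: "bnd (n i) (\<mu> powi h * y)" if "\<bar>h\<bar> \<le> \<bar>k i\<bar> + \<bar>l i\<bar>" "bnd (Suc \<kappa>) y" for h y
    proof -
      have "nat \<bar>h\<bar> \<le> nat \<bar>k i\<bar> + nat \<bar>l i\<bar>"
        using that(1) by (simp add: nat_le_iff)
      then show ?thesis
        by (intro bnd_mono[OF bnd_mult[OF bnd_powi that(2)]]) (simp add: n_def)
    qed
    show "bnd (n i) (\<mu> powi j * x)" "bnd (n i) (\<mu> powi j' * x')"
      using j x by (auto intro!: * simp: units_def)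
    have "bnd (n i) (\<mu> powi (- j) * inverse x)" "bnd (n i) (\<mu> powi (- j') * inverse x')"
      using j x by (auto intro!: * simp: units_def simp del: power_int_minus)
    then show "bnd (n i) (inverse (\<mu> powi j * x))" "bnd (n i) (inverse (\<mu> powi j' * x'))"
      by (simp_all add: power_int_minus)
    show "2 * n i + 1 < m i" by (simp add: m_def)
  qed
  have cdi: "c i \<in> units" "d i \<in> units" for i using cd by auto
  let ?v1 = "\<lambda>i. wt \<rho> (c i) (d i) * v i"
  let ?v2 = "\<lambda>i. wt \<rho> 1 (\<mu> powi l i) * ?v1 i"
  have 1: "\<gamma> c d \<odot> LL \<rho> v = LL \<rho> ?v1 \<odot> \<gamma> c d"
    by (rule \<gamma>_LL[OF cd]) (use small[of 0 _ 0 1 1] small[of 0 _ 0, OF _ _ cdi] mu_units in auto)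
  have 2: "\<beta> l \<odot> LL \<rho> ?v1 = LL \<rho> ?v2 \<odot> \<beta> l"
  proof (rule \<beta>_LL[OF kl(2)])
    fix i j assume "j \<in> {min 0 (l i)..max 0 (l i)}"
    then have "wt \<rho> (\<mu> powi 0 * c i) (\<mu> powi j * d i) * v i \<in> V"
      by (intro small cdi) auto
    then show "wt \<rho> 1 (\<mu> powi j) * ?v1 i \<in> V"
      using wt_mult3[of \<rho> 1 "\<mu> powi j" "c i" "d i" "v i"]
      by (simp only: wt_one mult_1_left power_int_0_right)
  qed
  have 3: "\<alpha> k \<odot> LL \<rho> ?v2 = LL \<rho> (\<lambda>i. wt \<rho> (\<mu> powi k i) 1 * ?v2 i) \<odot> \<alpha> k"
  proof (rule \<alpha>_LL[OF kl(1)])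
    fix i j assume "j \<in> {min 0 (k i)..max 0 (k i)}"
    then have "wt \<rho> (\<mu> powi j * c i) (\<mu> powi l i * d i) * v i \<in> V"
      by (intro small cdi) auto
    then show "wt \<rho> (\<mu> powi j) 1 * ?v2 i \<in> V"
      unfolding wt_mult3 .
  qed
  have "HH a b = \<alpha> k \<odot> \<beta> l \<odot> \<gamma> c d"
    unfolding HH_pk_pc k_def l_def c_def d_def ..
  moreover have "LL \<rho> (\<lambda>i. wt \<rho> (\<mu> powi k i) 1 * ?v2 i) = LL \<rho> (\<lambda>i. wt \<rho> (a i) (b i) * v i)"
    by (simp only: wt_mult3 ab)
  ultimately show "HH a b \<odot> LL \<rho> v = LL \<rho> (\<lambda>i. wt \<rho> (a i) (b i) * v i) \<odot> HH a b"
    using 1 3 by (simp add: \<Gamma>.m_assoc \<Gamma>.m_assoc_subst[OF 2])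
      (simp add: \<Gamma>.m_assoc[symmetric])
qed

text \<open>
  Here only contracting steps occur, so no smallness of \<open>v\<close> is required.
\<close>

lemma HH_LL_contract:
  assumes "lin m" "\<And>i. v i \<in> V"
    and "a = (\<lambda>i. \<mu> powi (cp \<rho> * int (m i)))" "b = (\<lambda>i. \<mu> powi (cq \<rho> * int (m i)))"
  shows "HH a b \<odot> LL \<rho> v = LL \<rho> (\<lambda>i. \<mu> ^ m i * v i) \<odot> HH a b"
proof -
  define k where "k = (\<lambda>i. cp \<rho> * int (m i))"
  define l where "l = (\<lambda>i. cq \<rho> * int (m i))"
  have kl: "ilin k" "ilin l" using assms(1) by (auto simp: k_def l_def intro: ilin_cmult)
  have HH: "HH a b = \<alpha> k \<odot> \<beta> l"
    using HH_eq[OF kl, of "\<lambda>_. 1" "\<lambda>_. 1"] mu_units by (simp add: \<gamma>_one assms(3,4) k_def l_def)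
  have 1: "\<beta> l \<odot> LL \<rho> v = LL \<rho> (\<lambda>i. wt \<rho> 1 (\<mu> powi l i) * v i) \<odot> \<beta> l"
  proof (rule \<beta>_LL[OF kl(2)])
    fix i j assume "j \<in> {min 0 (l i)..max 0 (l i)}"
    then have "0 \<le> w2 \<rho> * j" by (cases \<rho>) (auto simp: l_def)
    then show "wt \<rho> 1 (\<mu> powi j) * v i \<in> V"
      using powi_V[OF assms(2)] wt_powi[OF mu_nz, of \<rho> 0 j] by simp
  qed
  have 2: "\<alpha> k \<odot> LL \<rho> (\<lambda>i. wt \<rho> 1 (\<mu> powi l i) * v i) =
      LL \<rho> (\<lambda>i. wt \<rho> (\<mu> powi k i) 1 * (wt \<rho> 1 (\<mu> powi l i) * v i)) \<odot> \<alpha> k"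
  proof (rule \<alpha>_LL[OF kl(1)])
    fix i j assume "j \<in> {min 0 (k i)..max 0 (k i)}"
    then have "0 \<le> w1 \<rho> * j + w2 \<rho> * l i" by (cases \<rho>) (auto simp: l_def k_def)
    then show "wt \<rho> (\<mu> powi j) 1 * (wt \<rho> 1 (\<mu> powi l i) * v i) \<in> V"
      unfolding wt_mult2 wt_powi[OF mu_nz] by (rule powi_V[OF assms(2)])
  qed
  have e: "wt \<rho> (\<mu> powi k i) 1 * (wt \<rho> 1 (\<mu> powi l i) * v i) = \<mu> ^ m i * v i" for i
    using wt_contract[of \<rho> "int (m i)"] by (simp add: wt_mult2 k_def l_def)
  show ?thesis
    using 2[unfolded e] 1 by (simp add: HH \<Gamma>.m_assoc) (simp add: \<Gamma>.m_assoc[symmetric])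
qed

text \<open>
  Along the word for \<open>diag(1,a,b,1)\<close> the intermediate values may be large although both ends lie in \<open>V\<close>.  Therefore first contract
  far enough, then apply \<open>HH_LL_small\<close>, and undo the contraction at the other end.  This works because
  diagonal words commute at quadratic cost.
\<close>

lemma HH_LL:
  assumes "a \<in> \<U>" "b \<in> \<U>" and v: "\<And>i. v i \<in> V" "\<And>i. wt \<rho> (a i) (b i) * v i \<in> V"
  shows "HH a b \<odot> LL \<rho> v = LL \<rho> (\<lambda>i. wt \<rho> (a i) (b i) * v i) \<odot> HH a b"
proof -
  obtain m where m: "lin m" "\<And>v. (\<And>i. inverse \<mu> ^ m i * v i \<in> V) \<Longrightarrow>
    HH a b \<odot> LL \<rho> v = LL \<rho> (\<lambda>i. wt \<rho> (a i) (b i) * v i) \<odot> HH a b"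
    using HH_LL_small[OF assms(1,2)] by blast
  define p where "p = (\<lambda>i. \<mu> powi (cp \<rho> * int (m i)))"
  define q where "q = (\<lambda>i. \<mu> powi (cq \<rho> * int (m i)))"
  have pq: "p \<in> \<U>" "q \<in> \<U>" using m(1) by (auto simp: p_def q_def intro!: \<U>_powi ilin_cmult)
  let ?v = "\<lambda>i. wt \<rho> (a i) (b i) * v i"
  have c: "HH p q \<odot> LL \<rho> v = LL \<rho> (\<lambda>i. \<mu> ^ m i * v i) \<odot> HH p q"
    "HH p q \<odot> LL \<rho> ?v = LL \<rho> (\<lambda>i. \<mu> ^ m i * ?v i) \<odot> HH p q"
    by (rule HH_LL_contract[OF m(1) _ p_def q_def], rule v)+
  have s: "HH a b \<odot> LL \<rho> (\<lambda>i. \<mu> ^ m i * v i) = LL \<rho> (\<lambda>i. \<mu> ^ m i * ?v i) \<odot> HH a b"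
  proof -
    have "inverse \<mu> ^ m i * (\<mu> ^ m i * v i) \<in> V" for i
      using mu_nz v(1) by (simp add: power_inverse mult.assoc[symmetric])
    from m(2)[OF this] show ?thesis
      by (simp only: mult.left_commute)
  qed
  have comm: "HH p q \<odot> HH a b = HH a b \<odot> HH p q"
    using assms(1,2) pq by (simp add: HH_mult mult.commute)
  have "HH p q \<odot> (HH a b \<odot> LL \<rho> v) = HH p q \<odot> (LL \<rho> ?v \<odot> HH a b)"
    by (simp add: \<Gamma>.m_assoc \<Gamma>.m_assoc_subst[OF comm] \<Gamma>.m_assoc_subst[OF s] \<Gamma>.m_assoc_subst[OF c(2)] c(1) comm)
  then show ?thesis by simp
qed

definition EE :: "posroot \<Rightarrow> ('i \<Rightarrow> 'k) \<Rightarrow> ('i \<Rightarrow> 'k mat4 word) set" where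
  "EE \<rho> x = cls (\<lambda>i. E \<rho> (x i))"

lemma EE_closed [simp]: "EE \<rho> x \<in> carrier \<Gamma>"
  by (auto simp: EE_def intro!: cls_closed)

lemma EE_eq:
  assumes "x \<in> \<R>"
  obtains p q v where "p \<in> \<U>" "q \<in> \<U>" "\<And>i. v i \<in> V" "\<And>i. x i = wt \<rho> (p i) (q i) * v i"
    "EE \<rho> x = HH p q \<odot> LL \<rho> v \<odot> inv\<^bsub>\<Gamma>\<^esub> (HH p q)"
proof
  define m where "m = (\<lambda>i. level (x i))"
  define p where "p = (\<lambda>i. \<mu> powi (- cp \<rho> * int (m i)))"
  define q where "q = (\<lambda>i. \<mu> powi (- cq \<rho> * int (m i)))"
  define v where "v = (\<lambda>i. \<mu> ^ m i * x i)"
  obtain n where n: "lin n" "\<And>i. bnd (n i) (x i)" using \<R>_E[OF assms] by blast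
  have m: "lin m" using lin_mono[OF n(1)] level_le[OF n(2)] by (auto simp: m_def)
  have il: "ilin (\<lambda>i. - cp \<rho> * int (m i))" "ilin (\<lambda>i. - cq \<rho> * int (m i))"
    by (rule ilin_cmult[OF m])+
  show "p \<in> \<U>" "q \<in> \<U>" unfolding p_def q_def by (intro \<U>_powi il)+
  show "v i \<in> V" for i using bnd_level[of "x i"] by (simp add: v_def m_def bnd_def)
  show "x i = wt \<rho> (p i) (q i) * v i" for i
    using wt_contract[of \<rho> "- int (m i)"] mu_nz
    by (simp add: p_def q_def v_def power_int_minus mult.assoc[symmetric])
  have "HH p q = cls (\<lambda>i. Tw \<rho> (m i))"
    unfolding Tw_def cls_hword using HH_eq[OF il, of "\<lambda>_. 1" "\<lambda>_. 1"] mu_units by (simp add: p_def q_def)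
  then show "EE \<rho> x = HH p q \<odot> LL \<rho> v \<odot> inv\<^bsub>\<Gamma>\<^esub> (HH p q)"
    by (simp add: EE_def E_def LL_def cls_mult cls_inv v_def m_def)
qed

text \<open>
  Write both elementary words as conjugates \<open>h s h\<^sup>-\<^sup>1\<close> and \<open>h' s' h'\<^sup>-\<^sup>1\<close> of bounded letters.  The claim becomes that the
  diagonal element \<open>h'\<^sup>-\<^sup>1 d h\<close> carries \<open>s\<close> to \<open>s'\<close>, which is \<open>HH_LL\<close>.
\<close>

lemma HH_EE:
  assumes "a \<in> \<U>" "b \<in> \<U>" "x \<in> \<R>"
  shows "HH a b \<odot> EE \<rho> x = EE \<rho> (\<lambda>i. wt \<rho> (a i) (b i) * x i) \<odot> HH a b"
proof -
  let ?x = "\<lambda>i. wt \<rho> (a i) (b i) * x i"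
  have x': "?x \<in> \<R>" by (intro \<R>_mult wt_\<R> assms)
  obtain p q v where v: "p \<in> \<U>" "q \<in> \<U>" "\<And>i. v i \<in> V" "\<And>i. x i = wt \<rho> (p i) (q i) * v i"
    "EE \<rho> x = HH p q \<odot> LL \<rho> v \<odot> inv\<^bsub>\<Gamma>\<^esub> (HH p q)"
    by (rule EE_eq[OF assms(3), of \<rho>], rule that)
  obtain p' q' v' where v': "p' \<in> \<U>" "q' \<in> \<U>" "\<And>i. v' i \<in> V" "\<And>i. ?x i = wt \<rho> (p' i) (q' i) * v' i"
    "EE \<rho> ?x = HH p' q' \<odot> LL \<rho> v' \<odot> inv\<^bsub>\<Gamma>\<^esub> (HH p' q')"
    by (rule EE_eq[OF x', of \<rho>], rule that)
  define c where "c = (\<lambda>i. inverse (p' i) * (a i * p i))"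
  define d where "d = (\<lambda>i. inverse (q' i) * (b i * q i))"
  have inv: "(\<lambda>i. inverse (p' i)) \<in> \<U>" "(\<lambda>i. inverse (q' i)) \<in> \<U>"
    using v'(1,2) by (auto simp: \<U>_def)
  have cd: "c \<in> \<U>" "d \<in> \<U>"
    unfolding c_def d_def by (intro \<U>_mult inv assms v)+
  have "wt \<rho> (p' i) (q' i) * (wt \<rho> (c i) (d i) * v i) = wt \<rho> (p' i) (q' i) * v' i" for i
  proof -
    have "p' i * c i = a i * p i" "q' i * d i = b i * q i"
      using v'(1,2)[THEN \<U>_D(1)] by (simp_all add: c_def d_def)
    then have "wt \<rho> (p' i) (q' i) * (wt \<rho> (c i) (d i) * v i) = wt \<rho> (a i) (b i) * (wt \<rho> (p i) (q i) * v i)"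
      using wt_mult[of \<rho> "p' i" "c i" "q' i" "d i"] wt_mult[of \<rho> "a i" "p i" "b i" "q i"]
      by (simp add: mult.assoc[symmetric])
    then show ?thesis by (simp only: v(4)[symmetric] v'(4)[symmetric])
  qed
  then have vv: "wt \<rho> (c i) (d i) * v i = v' i" for i
    using v'(1,2)[THEN \<U>_D(1)] wt_nonzero by (metis mult_left_cancel)
  have 1: "HH c d \<odot> LL \<rho> v = LL \<rho> v' \<odot> HH c d"
    using HH_LL[OF cd v(3), of \<rho>] v'(3) by (simp add: vv)
  have 2: "HH a b \<odot> HH p q = HH p' q' \<odot> HH c d"
    using assms v(1,2) v'(1,2) cd v'(1,2)[THEN \<U>_D(1)]
    by (simp add: HH_mult) (simp add: c_def d_def mult.assoc[symmetric])
  have 3: "HH c d \<odot> inv\<^bsub>\<Gamma>\<^esub> (HH p q) = inv\<^bsub>\<Gamma>\<^esub> (HH p' q') \<odot> HH a b"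
  proof -
    have "HH c d = inv\<^bsub>\<Gamma>\<^esub> (HH p' q') \<odot> (HH a b \<odot> HH p q)"
      unfolding 2 by (simp add: \<Gamma>.m_assoc[symmetric])
    then show ?thesis by (simp add: \<Gamma>.m_assoc)
  qed
  show ?thesis
    unfolding v(5) v'(5)
    by (simp add: \<Gamma>.m_assoc \<Gamma>.m_assoc_subst[OF 2] \<Gamma>.m_assoc_subst[OF 1] 3)
qed

lemma EE_eq_LL:
  assumes "\<And>i. x i \<in> V"
  shows "EE \<rho> x = LL \<rho> x"
  unfolding EE_def LL_def
proof (rule cls_relation[where L = "(2 * 0 + 3) * N"])
  show "length (E \<rho> (x i)) \<le> (2 * 0 + 3) * N" for i
    by (rule E_length) (simp add: assms)
  show "length (lett (elmat \<rho> (x i))) \<le> (2 * 0 + 3) * N" for i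
    using lett_length[of "elmat \<rho> (x i)"] by simp
qed (simp_all add: eval_E assms)

lemma LL_commute:
  assumes "\<And>i. x i \<in> V" "\<And>i. y i \<in> V" "\<And>s t. elmat \<rho> s ** elmat \<sigma> t = elmat \<sigma> t ** (elmat \<rho> s :: 'k mat4)"
  shows "LL \<rho> x \<odot> LL \<sigma> y = LL \<sigma> y \<odot> LL \<rho> x"
proof -
  have "cls (\<lambda>i. lett (elmat \<rho> (x i)) \<cdot> lett (elmat \<sigma> (y i))) =
      cls (\<lambda>i. lett (elmat \<sigma> (y i)) \<cdot> lett (elmat \<rho> (x i)))"
    by (rule cls_relation[where L = "N + N"])
      (simp_all add: eval_mult assms(1,2), rule assms(3),
       (intro le_trans[OF length_mult_le] le_trans[OF add_mono[OF lett_length lett_length]], simp)+)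
  then show ?thesis by (simp add: LL_def cls_mult)
qed

lemma LL_bracket:
  assumes "\<And>i. x i \<in> V" "\<And>i. y i \<in> V" "\<And>i. x i * y i \<in> V"
    "\<And>s t. elmat \<rho> s ** elmat \<sigma> t = elmat \<tau> (s * t) ** (elmat \<sigma> t ** (elmat \<rho> s :: 'k mat4))"
  shows "LL \<rho> x \<odot> LL \<sigma> y = LL \<tau> (\<lambda>i. x i * y i) \<odot> (LL \<sigma> y \<odot> LL \<rho> x)"
proof -
  have "cls (\<lambda>i. lett (elmat \<rho> (x i)) \<cdot> lett (elmat \<sigma> (y i))) =
      cls (\<lambda>i. lett (elmat \<tau> (x i * y i)) \<cdot> (lett (elmat \<sigma> (y i)) \<cdot> lett (elmat \<rho> (x i))))"
  proof (rule cls_relation[where L = "N + (N + N)"])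
    fix i
    show "length (lett (elmat \<rho> (x i)) \<cdot> lett (elmat \<sigma> (y i))) \<le> N + (N + N)"
      by (intro le_trans[OF length_mult_le] le_trans[OF add_mono[OF lett_length lett_length]]) simp
    show "length (lett (elmat \<tau> (x i * y i)) \<cdot> (lett (elmat \<sigma> (y i)) \<cdot> lett (elmat \<rho> (x i)))) \<le> N + (N + N)"
      by (intro le_trans[OF length_mult_le] add_mono lett_length)
  qed (simp_all add: eval_mult assms(1-3), rule assms(4))
  then show ?thesis by (simp add: LL_def cls_mult)
qed

lemma LL_add:
  assumes "\<And>i. x i \<in> V" "\<And>i. y i \<in> V" "\<And>i. x i + y i \<in> V"
  shows "LL \<rho> x \<odot> LL \<rho> y = LL \<rho> (\<lambda>i. x i + y i)"
proof -
  have "cls (\<lambda>i. lett (elmat \<rho> (x i)) \<cdot> lett (elmat \<rho> (y i))) = cls (\<lambda>i. lett (elmat \<rho> (x i + y i)))"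
    by (rule cls_relation[where L = "N + N"])
      (simp_all add: eval_mult assms elmat_add,
       (intro le_trans[OF length_mult_le] le_trans[OF add_mono[OF lett_length lett_length]], simp),
       rule le_trans[OF lett_length], simp)
  then show ?thesis by (simp add: LL_def cls_mult)
qed

text \<open>
  The diagonal matrix with exponents \<open>p\<close>, \<open>q\<close> of \<open>\<mu>\<close> contracts the given position.  A set of positions is tame if one pair
  \<open>(p,q)\<close> is positive on all of them.
\<close>

definition pos :: "int \<Rightarrow> int \<Rightarrow> posroot \<Rightarrow> bool" where
  "pos p q \<rho> \<longleftrightarrow> 1 \<le> w1 \<rho> * p + w2 \<rho> * q"

lemma wt_contracts:
  assumes "pos p q \<rho>" "bnd m x"
  shows "wt \<rho> (\<mu> powi (p * int m)) (\<mu> powi (q * int m)) * x \<in> V"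
proof -
  let ?w = "w1 \<rho> * p + w2 \<rho> * q"
  have "wt \<rho> (\<mu> powi (p * int m)) (\<mu> powi (q * int m)) * x = \<mu> powi (?w * int m) * x"
    by (simp add: wt_powi mu_nz algebra_simps)
  also have "?w * int m = (?w - 1) * int m + int m"
    by (simp add: algebra_simps)
  also have "\<mu> powi ((?w - 1) * int m + int m) * x = \<mu> powi ((?w - 1) * int m) * (\<mu> ^ m * x)"
    by (simp only: power_int_add[OF disjI1[OF mu_nz]] power_int_of_nat mult.assoc)
  also have "\<dots> \<in> V"
    using assms by (intro powi_V) (simp_all add: bnd_def pos_def)
  finally show ?thesis .
qed

lemma contracting_pair:
  assumes "\<And>x. x \<in> X \<Longrightarrow> x \<in> \<R>" "finite X"
  obtains a b where "a \<in> \<U>" "b \<in> \<U>" "\<And>\<rho> x i. pos p q \<rho> \<Longrightarrow> x \<in> X \<Longrightarrow> wt \<rho> (a i) (b i) * x i \<in> V"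
proof -
  have "\<exists>m. lin m \<and> (\<forall>x\<in>X. \<forall>i. bnd (m i) (x i))"
    using assms(2,1)
  proof (induction X)
    case empty
    then show ?case using lin_const by blast
  next
    case (insert y X)
    then obtain m where m: "lin m" "\<forall>x\<in>X. \<forall>i. bnd (m i) (x i)" by auto
    obtain n where n: "lin n" "\<And>i. bnd (n i) (y i)" using \<R>_E[OF insert.prems, of y] by auto
    have "\<forall>x\<in>insert y X. \<forall>i. bnd (m i + n i) (x i)"
      using m(2) n(2) bnd_mono by (metis insert_iff le_add1 le_add2)
    then show ?case using lin_add[OF m(1) n(1)] by blast
  qed
  then obtain m where m: "lin m" "\<And>x i. x \<in> X \<Longrightarrow> bnd (m i) (x i)" by blast
  show thesis
    by (rule that[OF \<U>_powi[OF ilin_cmult[OF m(1), of p]] \<U>_powi[OF ilin_cmult[OF m(1), of q]]])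
      (rule wt_contracts[OF _ m(2)])
qed

lemma HH_transfer:
  assumes "HH a b \<odot> X = Z \<odot> HH a b" "HH a b \<odot> Y = Z \<odot> HH a b"
    "X \<in> carrier \<Gamma>" "Y \<in> carrier \<Gamma>"
  shows "X = Y"
proof -
  have "HH a b \<odot> X = HH a b \<odot> Y" using assms(1,2) by simp
  then show ?thesis using assms(3,4) by simp
qed

text \<open>
  Tame relations hold in \<open>\<Gamma>\<close>: conjugate by a diagonal element that contracts all positions involved until the
  parameters lie in \<open>V\<close>, and use the relation between letters there.
\<close>

lemma EE_commute:
  assumes "x \<in> \<R>" "y \<in> \<R>" "pos p q \<rho>" "pos p q \<sigma>"
    and m: "\<And>s t. elmat \<rho> s ** elmat \<sigma> t = elmat \<sigma> t ** (elmat \<rho> s :: 'k mat4)"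
  shows "EE \<rho> x \<odot> EE \<sigma> y = EE \<sigma> y \<odot> EE \<rho> x"
proof -
  obtain a b where ab: "a \<in> \<U>" "b \<in> \<U>" "\<And>\<rho> z i. pos p q \<rho> \<Longrightarrow> z \<in> {x, y} \<Longrightarrow> wt \<rho> (a i) (b i) * z i \<in> V"
    by (rule contracting_pair[of "{x, y}" p q], use assms(1,2) in blast, simp, rule that)
  let ?x = "\<lambda>i. wt \<rho> (a i) (b i) * x i" and ?y = "\<lambda>i. wt \<sigma> (a i) (b i) * y i"
  have V: "?x i \<in> V" "?y i \<in> V" for i using ab(3) assms(3,4) by auto
  have eq: "EE \<rho> ?x = LL \<rho> ?x" "EE \<sigma> ?y = LL \<sigma> ?y" by (rule EE_eq_LL[OF V(1)], rule EE_eq_LL[OF V(2)])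
  note h = HH_EE[OF ab(1,2) assms(1), of \<rho>] HH_EE[OF ab(1,2) assms(2), of \<sigma>]
  show ?thesis
  proof (rule HH_transfer)
    show "HH a b \<odot> (EE \<rho> x \<odot> EE \<sigma> y) = (EE \<rho> ?x \<odot> EE \<sigma> ?y) \<odot> HH a b"
      by (simp add: \<Gamma>.m_assoc \<Gamma>.m_assoc_subst[OF h(1)] h)
    have "EE \<rho> ?x \<odot> EE \<sigma> ?y = EE \<sigma> ?y \<odot> EE \<rho> ?x"
      unfolding eq by (rule LL_commute[OF V m])
    then show "HH a b \<odot> (EE \<sigma> y \<odot> EE \<rho> x) = (EE \<rho> ?x \<odot> EE \<sigma> ?y) \<odot> HH a b"
      by (simp add: \<Gamma>.m_assoc \<Gamma>.m_assoc_subst[OF h(2)] h)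
  qed simp_all
qed

lemma EE_bracket:
  assumes "x \<in> \<R>" "y \<in> \<R>" "pos p q \<rho>" "pos p q \<sigma>" "pos p q \<tau>"
    and w: "\<And>a b. a \<noteq> 0 \<Longrightarrow> b \<noteq> 0 \<Longrightarrow> wt \<tau> a b = wt \<rho> a b * (wt \<sigma> a b :: 'k)"
    and m: "\<And>s t. elmat \<rho> s ** elmat \<sigma> t = elmat \<tau> (s * t) ** (elmat \<sigma> t ** (elmat \<rho> s :: 'k mat4))"
  shows "EE \<rho> x \<odot> EE \<sigma> y = EE \<tau> (\<lambda>i. x i * y i) \<odot> (EE \<sigma> y \<odot> EE \<rho> x)"
proof -
  let ?xy = "\<lambda>i. x i * y i"
  have xy: "?xy \<in> \<R>" by (rule \<R>_mult[OF assms(1,2)])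
  obtain a b where ab: "a \<in> \<U>" "b \<in> \<U>" "\<And>\<rho> z i. pos p q \<rho> \<Longrightarrow> z \<in> {x, y, ?xy} \<Longrightarrow> wt \<rho> (a i) (b i) * z i \<in> V"
    by (rule contracting_pair[of "{x, y, ?xy}" p q], use assms(1,2) xy in blast, simp, rule that)
  let ?x = "\<lambda>i. wt \<rho> (a i) (b i) * x i" and ?y = "\<lambda>i. wt \<sigma> (a i) (b i) * y i"
  let ?z = "\<lambda>i. wt \<tau> (a i) (b i) * ?xy i"
  have V: "?x i \<in> V" "?y i \<in> V" "?z i \<in> V" for i using ab(3) assms(3-5) by auto
  have z: "?z i = ?x i * ?y i" for i using ab(1,2)[THEN \<U>_D(1)] by (simp add: w ac_simps)
  have eq: "EE \<rho> ?x = LL \<rho> ?x" "EE \<sigma> ?y = LL \<sigma> ?y" "EE \<tau> ?z = LL \<tau> ?z"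
    by (rule EE_eq_LL[OF V(1)], rule EE_eq_LL[OF V(2)], rule EE_eq_LL[OF V(3)])
  note h = HH_EE[OF ab(1,2) assms(1), of \<rho>] HH_EE[OF ab(1,2) assms(2), of \<sigma>] HH_EE[OF ab(1,2) xy, of \<tau>]
  show ?thesis
  proof (rule HH_transfer)
    show "HH a b \<odot> (EE \<rho> x \<odot> EE \<sigma> y) = (EE \<rho> ?x \<odot> EE \<sigma> ?y) \<odot> HH a b"
      by (simp add: \<Gamma>.m_assoc \<Gamma>.m_assoc_subst[OF h(1)] h)
    have "EE \<rho> ?x \<odot> EE \<sigma> ?y = EE \<tau> ?z \<odot> (EE \<sigma> ?y \<odot> EE \<rho> ?x)"
      unfolding eq unfolding z
      by (rule LL_bracket[OF V(1,2) _ m]) (use V(3) in \<open>simp only: z\<close>)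
    then show "HH a b \<odot> (EE \<tau> ?xy \<odot> (EE \<sigma> y \<odot> EE \<rho> x)) = (EE \<rho> ?x \<odot> EE \<sigma> ?y) \<odot> HH a b"
      by (simp add: \<Gamma>.m_assoc \<Gamma>.m_assoc_subst[OF h(2)] \<Gamma>.m_assoc_subst[OF h(3)] h(1))
  qed simp_all
qed

lemma EE_add:
  assumes "x \<in> \<R>" "y \<in> \<R>"
  shows "EE \<rho> x \<odot> EE \<rho> y = EE \<rho> (\<lambda>i. x i + y i)"
proof -
  let ?xy = "\<lambda>i. x i + y i"
  have pos: "pos (cp \<rho>) (cq \<rho>) \<rho>" by (cases \<rho>) (auto simp: pos_def)
  have xy: "?xy \<in> \<R>" by (rule \<R>_add[OF assms])
  obtain a b where ab: "a \<in> \<U>" "b \<in> \<U>"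
    "\<And>\<sigma> z i. pos (cp \<rho>) (cq \<rho>) \<sigma> \<Longrightarrow> z \<in> {x, y, ?xy} \<Longrightarrow> wt \<sigma> (a i) (b i) * z i \<in> V"
    by (rule contracting_pair[of "{x, y, ?xy}" "cp \<rho>" "cq \<rho>"], use assms xy in blast, simp, rule that)
  let ?x = "\<lambda>i. wt \<rho> (a i) (b i) * x i" and ?y = "\<lambda>i. wt \<rho> (a i) (b i) * y i"
  let ?z = "\<lambda>i. wt \<rho> (a i) (b i) * ?xy i"
  have V: "?x i \<in> V" "?y i \<in> V" "?z i \<in> V" for i using ab(3)[OF pos] by auto
  have z: "?z i = ?x i + ?y i" for i by (simp add: distrib_left)
  have eq: "EE \<rho> ?x = LL \<rho> ?x" "EE \<rho> ?y = LL \<rho> ?y" "EE \<rho> ?z = LL \<rho> ?z"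
    by (rule EE_eq_LL[OF V(1)], rule EE_eq_LL[OF V(2)], rule EE_eq_LL[OF V(3)])
  note h = HH_EE[OF ab(1,2) assms(1), of \<rho>] HH_EE[OF ab(1,2) assms(2), of \<rho>] HH_EE[OF ab(1,2) xy, of \<rho>]
  show ?thesis
  proof (rule HH_transfer)
    show "HH a b \<odot> (EE \<rho> x \<odot> EE \<rho> y) = (EE \<rho> ?x \<odot> EE \<rho> ?y) \<odot> HH a b"
      by (simp add: \<Gamma>.m_assoc \<Gamma>.m_assoc_subst[OF h(1)] h(2))
    have "EE \<rho> ?x \<odot> EE \<rho> ?y = EE \<rho> ?z"
      unfolding eq unfolding z
      by (rule LL_add[OF V(1,2)]) (use V(3) in \<open>simp only: z\<close>)
    then show "HH a b \<odot> EE \<rho> ?xy = (EE \<rho> ?x \<odot> EE \<rho> ?y) \<odot> HH a b"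
      by (simp only: h(3))
  qed simp_all
qed

text \<open>
  The pairs \<open>(-1,-2)\<close>, \<open>(2,1)\<close>, \<open>(1,-1)\<close> and \<open>(-1,1)\<close> contract the positions \<open>{12,13,23}\<close>, \<open>{23,24,34}\<close>, \<open>{13,23,24}\<close> and
  \<open>{12,34}\<close>.
\<close>

sublocale amal: unipotent_amalgam \<Gamma> \<R> "EE R12" "EE R13" "EE R23" "EE R24" "EE R34"
proof
  show "(1 :: 'i \<Rightarrow> 'k) \<in> \<R>" using \<R>_one by (simp add: one_fun_def)
  fix x y assume xy: "x \<in> \<R>" "y \<in> \<R>"
  show "x + y \<in> \<R>" "x * y \<in> \<R>"
    using \<R>_add[OF xy] \<R>_mult[OF xy] by (simp_all add: plus_fun_def times_fun_def)
  show "EE R12 x \<odot> EE R12 y = EE R12 (x + y)" "EE R13 x \<odot> EE R13 y = EE R13 (x + y)"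
    "EE R23 x \<odot> EE R23 y = EE R23 (x + y)" "EE R24 x \<odot> EE R24 y = EE R24 (x + y)"
    "EE R34 x \<odot> EE R34 y = EE R34 (x + y)"
    unfolding plus_fun_def by (rule EE_add[OF xy])+
  show "EE R12 x \<odot> EE R23 y = EE R13 (x * y) \<odot> (EE R23 y \<odot> EE R12 x)"
    unfolding times_fun_def
    by (rule EE_bracket[OF xy, of "-1" "-2"])
      (simp_all add: pos_def elmat_relations field_simps)
  show "EE R23 x \<odot> EE R34 y = EE R24 (x * y) \<odot> (EE R34 y \<odot> EE R23 x)"
    unfolding times_fun_def
    by (rule EE_bracket[OF xy, of 2 1])
      (simp_all add: pos_def elmat_relations field_simps)
  show "EE R12 x \<odot> EE R13 y = EE R13 y \<odot> EE R12 x" "EE R23 x \<odot> EE R13 y = EE R13 y \<odot> EE R23 x"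
    by (rule EE_commute[OF xy, of "-1" "-2"]; simp add: pos_def elmat_relations)+
  show "EE R12 x \<odot> EE R34 y = EE R34 y \<odot> EE R12 x"
    by (rule EE_commute[OF xy, of "-1" 1]; simp add: pos_def elmat_relations)
  show "EE R23 x \<odot> EE R24 y = EE R24 y \<odot> EE R23 x" "EE R34 x \<odot> EE R24 y = EE R24 y \<odot> EE R34 x"
    by (rule EE_commute[OF xy, of 2 1]; simp add: pos_def elmat_relations)+
  show "EE R13 x \<odot> EE R24 y = EE R24 y \<odot> EE R13 x"
    by (rule EE_commute[OF xy, of 1 "-1"]; simp add: pos_def elmat_relations)
qed simp_all

text \<open>
  The corner has trivial character: conjugation turns the commutator with parameters \<open>(x, 1)\<close> into the one with
  parameters \<open>(x/b, b)\<close>, and only the product of the parameters matters.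
\<close>

lemma HH_e14:
  assumes "a \<in> \<U>" "b \<in> \<U>" "x \<in> \<R>"
  shows "HH a b \<odot> amal.e14 x = amal.e14 x \<odot> HH a b"
proof -
  let ?x = "\<lambda>i. inverse (b i) * x i"
  have x: "?x \<in> \<R>" "b \<in> \<R>" using assms by (auto intro: \<R>_mult dest: \<U>_D)
  have "?x * b = x"
    using \<U>_D(1)[OF assms(2)] by (auto simp: times_fun_def)
  note m = amal.comm1334[OF assms(3) amal.R_one] amal.comm1334[OF x, unfolded this]
  note h = HH_EE[OF assms, of R13, simplified] HH_EE[OF assms(1,2) amal.R_one, of R34, simplified]
  have "HH a b \<odot> (EE R13 x \<odot> EE R34 1) = amal.e14 x \<odot> HH a b \<odot> (EE R34 1 \<odot> EE R13 x)"
    by (simp add: \<Gamma>.m_assoc \<Gamma>.m_assoc_subst[OF h(1)] \<Gamma>.m_assoc_subst[OF h(2)] h \<Gamma>.m_assoc_subst[OF m(2)])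
  moreover have "HH a b \<odot> (EE R13 x \<odot> EE R34 1) = HH a b \<odot> amal.e14 x \<odot> (EE R34 1 \<odot> EE R13 x)"
    using m(1) by (simp add: \<Gamma>.m_assoc)
  ultimately show ?thesis
    by (metis (no_types, lifting) EE_closed HH_closed \<Gamma>.m_closed \<Gamma>.right_cancel amal.e14_closed)
qed

definition unip_part :: "('i \<Rightarrow> 'k mat4) \<Rightarrow> ('i \<Rightarrow> 'k mat4 word) set" where
  "unip_part g = amal.unip (\<lambda>i. g i $ 1 $ 4) (\<lambda>i. g i $ 2 $ 4) (\<lambda>i. g i $ 3 $ 4)
    (\<lambda>i. g i $ 1 $ 3 / g i $ 3 $ 3) (\<lambda>i. g i $ 2 $ 3 / g i $ 3 $ 3) (\<lambda>i. g i $ 1 $ 2 / g i $ 2 $ 2)"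

lemma cls_\<omega>: "cls (\<lambda>i. \<omega> (g i)) = unip_part g \<odot> HH (\<lambda>i. g i $ 2 $ 2) (\<lambda>i. g i $ 3 $ 3)"
  by (simp add: unip_part_def \<omega>_def corner_def amal.unip_def amal.e14_def EE_def HH_def cls_mult cls_inv one_fun_def)

lemma HH_unip:
  assumes [simp]: "a \<in> \<U>" "b \<in> \<U>" "x14 \<in> \<R>" "x24 \<in> \<R>" "x34 \<in> \<R>" "x13 \<in> \<R>" "x23 \<in> \<R>" "x12 \<in> \<R>"
  shows "HH a b \<odot> amal.unip x14 x24 x34 x13 x23 x12 =
    amal.unip x14 (\<lambda>i. wt R24 (a i) (b i) * x24 i) (\<lambda>i. wt R34 (a i) (b i) * x34 i)
      (\<lambda>i. wt R13 (a i) (b i) * x13 i) (\<lambda>i. wt R23 (a i) (b i) * x23 i) (\<lambda>i. wt R12 (a i) (b i) * x12 i)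
    \<odot> HH a b"
  by (simp add: amal.unip_def \<Gamma>.m_assoc \<Gamma>.m_assoc_subst[OF HH_e14] \<Gamma>.m_assoc_subst[OF HH_EE] HH_EE del: wt.simps)

definition bounded_family :: "('i \<Rightarrow> 'k mat4) \<Rightarrow> bool" where
  "bounded_family g \<longleftrightarrow> (\<exists>n. lin n \<and> (\<forall>i. bounded_mat (n i) (g i)))"

lemma bounded_familyD:
  assumes "bounded_family g"
  shows "g i \<in> carrier A4" "(\<lambda>i. g i $ j $ k) \<in> \<R>" "(\<lambda>i. g i $ 2 $ 2) \<in> \<U>" "(\<lambda>i. g i $ 3 $ 3) \<in> \<U>"
proof -
  obtain n where n: "lin n" "\<And>i. bounded_mat (n i) (g i)"
    using assms by (auto simp: bounded_family_def)
  show c: "g i \<in> carrier A4" for i using n(2)[of i] by (simp add: bounded_mat_def)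
  show R: "(\<lambda>i. g i $ j $ k) \<in> \<R>" for j k
    by (rule \<R>_I[OF n(1)]) (use n(2) in \<open>simp add: bounded_mat_def\<close>)
  have "(\<lambda>i. inverse (g i $ 2 $ 2)) \<in> \<R>" "(\<lambda>i. inverse (g i $ 3 $ 3)) \<in> \<R>"
    by (rule \<R>_I[OF n(1)]; use n(2) in \<open>simp add: bounded_mat_def\<close>)+
  then show "(\<lambda>i. g i $ 2 $ 2) \<in> \<U>" "(\<lambda>i. g i $ 3 $ 3) \<in> \<U>"
    using R c by (auto simp: \<U>_def A4_def A4_carrier_def dvd_field_iff)
qed

lemma \<R>_divide: "x \<in> \<R> \<Longrightarrow> a \<in> \<U> \<Longrightarrow> (\<lambda>i. x i / a i) \<in> \<R>"
  using \<R>_mult[of x "\<lambda>i. inverse (a i)"] by (simp add: \<U>_def divide_inverse)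

text \<open>
  Move the diagonal part of \<open>g\<close> across the unipotent part of \<open>h\<close>, then multiply unipotent parts by \<open>unip_mult\<close> and
  diagonal parts by \<open>HH_mult\<close>.
\<close>

theorem cls_\<omega>_mult:
  assumes "bounded_family g" "bounded_family h"
  shows "cls (\<lambda>i. \<omega> (g i)) \<odot> cls (\<lambda>i. \<omega> (h i)) = cls (\<lambda>i. \<omega> (g i ** h i))"
proof -
  note g = bounded_familyD[OF assms(1)] and h = bounded_familyD[OF assms(2)]
  note R = g(2) h(2) \<R>_divide[OF g(2) g(3)] \<R>_divide[OF g(2) g(4)] \<R>_divide[OF h(2) h(3)] \<R>_divide[OF h(2) h(4)]
  have nz: "g i $ 2 $ 2 \<noteq> 0" "g i $ 3 $ 3 \<noteq> 0" "h i $ 2 $ 2 \<noteq> 0" "h i $ 3 $ 3 \<noteq> 0" for i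
    using \<U>_D(1)[OF g(3)] \<U>_D(1)[OF g(4)] \<U>_D(1)[OF h(3)] \<U>_D(1)[OF h(4)] by auto
  have wtR: "(\<lambda>i. wt \<rho> (g i $ 2 $ 2) (g i $ 3 $ 3) * x i) \<in> \<R>" if "x \<in> \<R>" for \<rho> x
    by (rule \<R>_mult[OF wt_\<R>[OF g(3,4)] that])
  let ?Hg = "HH (\<lambda>i. g i $ 2 $ 2) (\<lambda>i. g i $ 3 $ 3)" and ?Hh = "HH (\<lambda>i. h i $ 2 $ 2) (\<lambda>i. h i $ 3 $ 3)"
  let ?w = "\<lambda>\<rho> x. (\<lambda>i. wt \<rho> (g i $ 2 $ 2) (g i $ 3 $ 3) * x i)"
  let ?vh = "amal.unip (\<lambda>i. h i $ 1 $ 4) (?w R24 (\<lambda>i. h i $ 2 $ 4)) (?w R34 (\<lambda>i. h i $ 3 $ 4))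
      (?w R13 (\<lambda>i. h i $ 1 $ 3 / h i $ 3 $ 3)) (?w R23 (\<lambda>i. h i $ 2 $ 3 / h i $ 3 $ 3)) (?w R12 (\<lambda>i. h i $ 1 $ 2 / h i $ 2 $ 2))"
  have c [simp]: "amal.unip x1 x2 x3 x4 x5 x6 \<in> carrier \<Gamma>" "unip_part f \<in> carrier \<Gamma>" for x1 x2 x3 x4 x5 x6 f
    by (simp_all add: amal.unip_def unip_part_def)
  have unip_cong: "amal.unip x1 x2 x3 x4 x5 x6 = amal.unip y1 y2 y3 y4 y5 y6"
    if "x1 = y1" "x2 = y2" "x3 = y3" "x4 = y4" "x5 = y5" "x6 = y6" for x1 x2 x3 x4 x5 x6 y1 y2 y3 y4 y5 y6
    using that by simp
  have H: "?Hg \<odot> unip_part h = ?vh \<odot> ?Hg"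
    unfolding unip_part_def by (rule HH_unip) (intro g(3,4) R)+
  have "cls (\<lambda>i. \<omega> (g i)) \<odot> cls (\<lambda>i. \<omega> (h i)) = (unip_part g \<odot> ?vh) \<odot> (?Hg \<odot> ?Hh)"
    unfolding cls_\<omega> by (simp add: \<Gamma>.m_assoc \<Gamma>.m_assoc_subst[OF H] del: wt.simps)
  also have "?Hg \<odot> ?Hh = HH (\<lambda>i. (g i ** h i) $ 2 $ 2) (\<lambda>i. (g i ** h i) $ 3 $ 3)"
  proof -
    have "(g i ** h i) $ 2 $ 2 = g i $ 2 $ 2 * h i $ 2 $ 2" "(g i ** h i) $ 3 $ 3 = g i $ 3 $ 3 * h i $ 3 $ 3" for i
      using g(1)[of i] h(1)[of i] by (auto simp: A4_def A4_carrier_def matrix_matrix_mult_def sum_4)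
    then show ?thesis by (simp add: HH_mult[OF g(3,4) h(3,4)])
  qed
  also have "unip_part g \<odot> ?vh = unip_part (\<lambda>i. g i ** h i)"
  proof -
    have e: "g i $ 1 $ 1 = 1" "g i $ 2 $ 1 = 0" "g i $ 3 $ 1 = 0" "g i $ 3 $ 2 = 0" "h i $ 3 $ 2 = 0"
      "h i $ 4 $ j = (if j = 4 then 1 else 0)" for i j
      using g(1)[of i] h(1)[of i] forall_4[of "\<lambda>j. h i $ 4 $ j = (if j = 4 then 1 else 0)"]
      by (auto simp: A4_def A4_carrier_def)
    show ?thesis
      unfolding unip_part_def
      by (rule trans[OF amal.unip_mult], (rule R wtR | rule wtR, rule R)+, intro unip_cong)
        (simp_all add: fun_eq_iff matrix_matrix_mult_def sum_4 e nz field_simps)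
  qed
  finally show ?thesis unfolding cls_\<omega> .
qed

end

context abels_words
begin

lemma bounded_mat_one: "bounded_mat n (mat 1)"
  using A4.one_closed by (auto simp: bounded_mat_def mat_def)

text \<open>
  The constants are uniform because the result is applied to the one family of all pairs of matrices, indexed by
  themselves together with their size.
\<close>

theorem triangle_area:
  "\<exists>r C. \<forall>n\<ge>1. \<forall>g h. bounded_mat n g \<longrightarrow> bounded_mat n h \<longrightarrow>
    close r (C * n\<^sup>2) (\<omega> g \<cdot> \<omega> h) (\<omega> (g ** h))"
proof -
  \<comment> \<open>Configurations of size \<open>0\<close>, which the claim does not concern, are given length \<open>1\<close>, and pairs
    that are too large are replaced by the identity.\<close>
  define len where "len = (\<lambda>t::nat \<times> 'k mat4 \<times> 'k mat4. max 1 (fst t))"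
  interpret fam: abels_families V \<mu> \<kappa> S N len
    by unfold_locales (simp add: len_def)
  define ok where "ok = (\<lambda>t::nat \<times> 'k mat4 \<times> 'k mat4.
    bounded_mat (fst t) (fst (snd t)) \<and> bounded_mat (fst t) (snd (snd t)))"
  define g where "g = (\<lambda>t. if ok t then fst (snd t) else mat 1)"
  define h where "h = (\<lambda>t. if ok t then snd (snd t) else mat 1)"
  have lin: "fam.lin fst"
    unfolding fam.lin_def by (intro exI[of _ 1]) (simp add: len_def)
  have "fam.bounded_family g" "fam.bounded_family h"
    unfolding fam.bounded_family_def
    by (rule exI[of _ fst], use lin bounded_mat_one in \<open>simp add: g_def h_def ok_def\<close>)+
  then have "fam.cls (\<lambda>t. \<omega> (g t)) \<otimes>\<^bsub>fam.\<Gamma>\<^esub> fam.cls (\<lambda>t. \<omega> (h t)) = fam.cls (\<lambda>t. \<omega> (g t ** h t))"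
    by (rule fam.cls_\<omega>_mult)
  then have "fam.cls (\<lambda>t. \<omega> (g t) \<cdot> \<omega> (h t)) = fam.cls (\<lambda>t. \<omega> (g t ** h t))"
    by (simp add: fam.cls_mult)
  then obtain r C where rC: "\<And>t. close r (C * (len t)\<^sup>2) (\<omega> (g t) \<cdot> \<omega> (h t)) (\<omega> (g t ** h t))"
    by (rule fam.cls_eqD) (simp, simp, rule that)
  have "close r (C * n\<^sup>2) (\<omega> a \<cdot> \<omega> b) (\<omega> (a ** b))" if "n \<ge> 1" "bounded_mat n a" "bounded_mat n b" for n a b
    using rC[of "(n, a, b)"] that by (simp add: g_def h_def ok_def len_def max_def)
  then show ?thesis by blast
qed

end

section \<open>From triangles to arbitrary relations\<close>

context presentation
begin

lemma mult_eq_append: "reduced (u @ v) \<Longrightarrow> u \<cdot> v = u @ v"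
proof -
  assume "reduced (u @ v)"
  then have "foldr cancel_Cons u v = u @ v"
  proof (induction u)
    case (Cons a u)
    then show ?case by (cases "u @ v") (auto simp: reduced_Cons)
  qed simp
  then show ?thesis by (simp add: free_group_def)
qed

lemma reduced_append: "reduced (u @ v) \<Longrightarrow> reduced u" "reduced (u @ v) \<Longrightarrow> reduced v"
  by (simp_all add: reduced_def successively_append_iff)

lemma split_word:
  assumes "w \<in> carrier F"
  shows "take p w \<in> carrier F" "drop p w \<in> carrier F" "take p w \<cdot> drop p w = w"
proof -
  have w: "reduced w" "set w \<subseteq> S \<times> UNIV" using assms by (auto simp: free_group_def)
  then have "reduced (take p w)" "reduced (drop p w)"
    using reduced_append[of "take p w" "drop p w"] by simp_all
  then show "take p w \<in> carrier F" "drop p w \<in> carrier F"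
    using w(2) set_take_subset[of p w] set_drop_subset[of p w] by (auto simp: free_group_def)
  show "take p w \<cdot> drop p w = w"
    using mult_eq_append[of "take p w" "drop p w"] w(1) by simp
qed

text \<open>
  The cross term \<open>2Apq\<close> pays for the triangle, since \<open>(p + q)\<^sup>2 \<le> 6pq\<close> for the two halves.
\<close>

lemma halving_inequality:
  fixes p q A D :: nat
  assumes "1 \<le> p" "p \<le> q" "q \<le> p + 1" "3 * D \<le> A"
  shows "A * p\<^sup>2 + A * q\<^sup>2 + D * (p + q)\<^sup>2 \<le> A * (p + q)\<^sup>2"
proof -
  have "(p + q)\<^sup>2 \<le> 6 * (p * q)"
  proof (cases "q = p")
    case False
    then have q: "q = p + 1" using assms by simp
    have "p * 1 \<le> p * p" using assms(1) by (intro mult_le_mono) simp_all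
    then show ?thesis using assms(1) by (simp add: q power2_eq_square algebra_simps)
  qed (simp add: power2_eq_square algebra_simps)
  then have "D * (p + q)\<^sup>2 \<le> D * (6 * (p * q))" by (rule mult_le_mono2)
  also have "\<dots> = (3 * D) * (2 * (p * q))" by simp
  also have "\<dots> \<le> A * (2 * (p * q))" using assms(4) by (rule mult_le_mono1)
  finally have "D * (p + q)\<^sup>2 \<le> A * (2 * (p * q))" .
  moreover have "A * (p + q)\<^sup>2 = A * p\<^sup>2 + A * q\<^sup>2 + A * (2 * (p * q))"
    by (simp add: power2_eq_square algebra_simps)
  ultimately show ?thesis by simp
qed

text \<open>
  Gromov's subdivision argument for a combing \<open>\<omega>\<close>.  The predicate \<open>B n\<close> stands for a ball of radius \<open>n\<close>; it is only
  required to contain the elements spelled by nonempty words of length at most \<open>n\<close>.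
\<close>

lemma area_of_combing:
  fixes B :: "nat \<Rightarrow> 'g \<Rightarrow> bool" and \<omega> :: "'g \<Rightarrow> 'g word"
  assumes triangle: "\<And>n g h. 1 \<le> n \<Longrightarrow> B n g \<Longrightarrow> B n h \<Longrightarrow>
      close r (D * n\<^sup>2) (\<omega> g \<cdot> \<omega> h) (\<omega> (g \<otimes>\<^bsub>G\<^esub> h))"
    and words: "\<And>n w. w \<in> carrier F \<Longrightarrow> w \<noteq> [] \<Longrightarrow> length w \<le> n \<Longrightarrow> B n (eval_word G w)"
    and letters: "\<And>w. w \<in> carrier F \<Longrightarrow> length w = 1 \<Longrightarrow> close r 1 w (\<omega> (eval_word G w))"
    and "w \<in> carrier F" "w \<noteq> []"
  shows "close r ((3 * D + 1) * (length w)\<^sup>2) w (\<omega> (eval_word G w))"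
  using assms(4,5)
proof (induction "length w" arbitrary: w rule: less_induct)
  case less
  let ?A = "3 * D + 1"
  show ?case
  proof (cases "length w = 1")
    case True
    then show ?thesis using close_mono[OF letters[OF less.prems(1) True]] by simp
  next
    case False
    define p where "p = length w div 2"
    define u where "u = take p w"
    define v where "v = drop p w"
    have "length w \<ge> 2" using False less.prems(2) by (cases w) (auto simp: Suc_le_eq)
    then have p: "1 \<le> p" "p \<le> length w - p" "length w - p \<le> p + 1" "p < length w"
      unfolding p_def by presburger+
    have len: "length u = p" "length v = length w - p" using p by (simp_all add: u_def v_def)
    have uv: "u \<in> carrier F" "v \<in> carrier F" "u \<cdot> v = w" "u \<noteq> []" "v \<noteq> []"
      using split_word[OF less.prems(1), of p] p len by (auto simp: u_def v_def)
    have "close r (?A * (length u)\<^sup>2) u (\<omega> (eval_word G u))" "close r (?A * (length v)\<^sup>2) v (\<omega> (eval_word G v))"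
      using less.hyps[of u] less.hyps[of v] uv len p by auto
    from close_mult[OF this] have 1: "close r (?A * p\<^sup>2 + ?A * (length w - p)\<^sup>2) w (\<omega> (eval_word G u) \<cdot> \<omega> (eval_word G v))"
      by (simp add: uv len)
    have "close r (D * (length w)\<^sup>2) (\<omega> (eval_word G u) \<cdot> \<omega> (eval_word G v)) (\<omega> (eval_word G u \<otimes>\<^bsub>G\<^esub> eval_word G v))"
      by (rule triangle[OF _ words[OF uv(1,4)] words[OF uv(2,5)]]) (use p len in simp_all)
    from close_trans[OF 1 this]
    have "close r (?A * p\<^sup>2 + ?A * (length w - p)\<^sup>2 + D * (length w)\<^sup>2) w (\<omega> (eval_word G w))"
      using eval_mult[OF uv(1,2)] by (simp add: uv(3))
    moreover have "?A * p\<^sup>2 + ?A * (length w - p)\<^sup>2 + D * (p + (length w - p))\<^sup>2 \<le> ?A * (p + (length w - p))\<^sup>2"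
      using p by (intro halving_inequality) auto
    then have "?A * p\<^sup>2 + ?A * (length w - p)\<^sup>2 + D * (length w)\<^sup>2 \<le> ?A * (length w)\<^sup>2"
      using p by simp
    ultimately show ?thesis by (rule close_mono[OF _ order_refl])
  qed
qed

lemma conj_relators_kernel: "generate F (conj_relators G S r) \<subseteq> rel_kernel G S"
proof
  fix x assume "x \<in> generate F (conj_relators G S r)"
  moreover have "c \<in> rel_kernel G S" if "c \<in> conj_relators G S r" for c
    using that by (auto simp: conj_relators_def relators_iff rel_kernel_iff eval_mult ev.hom_inv)
  ultimately show "x \<in> rel_kernel G S"
    by (induction rule: generate.induct) (auto simp: rel_kernel_iff eval_mult ev.hom_inv)
qed

text \<open>
  The summand \<open>1\<close> leaves room for the normal form of the identity, which need not be the empty word.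
\<close>

lemma quadratic_area_imp_dehn:
  assumes area: "\<And>w. w \<in> rel_kernel G S \<Longrightarrow> area_le r (A * (length w)\<^sup>2 + 1) w"
  shows "presented_by G S r \<and> at_most_quadratic (dehn_function G S r)"
proof
  show "presented_by G S r"
    unfolding presented_by_def
    using conj_relators_kernel area_le_imp_generate[OF area] by blast
  have bound: "dehn_function G S r n \<le> enat (A * n\<^sup>2 + 1)" for n
    unfolding dehn_function_def
  proof (rule SUP_least)
    fix w assume "w \<in> {w \<in> rel_kernel G S. word_length F (free_gens S) w \<le> enat n}"
    then have w: "w \<in> rel_kernel G S" "length w \<le> n"
      by (auto simp: rel_kernel_iff word_length_free_group)
    have "area G S r w \<le> enat (A * (length w)\<^sup>2 + 1)"
      by (rule area_le_imp[OF area[OF w(1)]])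
    also have "\<dots> \<le> enat (A * n\<^sup>2 + 1)"
      using w(2) by (simp add: power_mono)
    finally show "area G S r w \<le> enat (A * n\<^sup>2 + 1)" .
  qed
  have fin: "dehn_function G S r n \<noteq> \<infinity>" for n
    using bound[of n] by (metis enat_ord_simps(5) infinity_ileE)
  have "(\<lambda>n. real (the_enat (dehn_function G S r n))) \<in> O(\<lambda>n. real n ^ 2)"
  proof (rule bigoI[of _ "real (A + 1)"])
    have "real (the_enat (dehn_function G S r n)) \<le> real (A + 1) * real n ^ 2" if "n \<ge> 1" for n
    proof -
      have "the_enat (dehn_function G S r n) \<le> A * n\<^sup>2 + 1"
        using bound[of n] fin[of n] by (cases "dehn_function G S r n") auto
      also have "\<dots> \<le> (A + 1) * n\<^sup>2" using that by simp
      finally show ?thesis by (metis of_nat_le_iff of_nat_mult of_nat_power)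
    qed
    then show "\<forall>\<^sub>F n in sequentially. norm (real (the_enat (dehn_function G S r n))) \<le> real (A + 1) * norm (real n ^ 2)"
      unfolding eventually_sequentially by (intro exI[of _ 1]) auto
  qed
  then show "at_most_quadratic (dehn_function G S r)"
    using fin by (simp add: at_most_quadratic_def)
qed

end

context abels_words
begin

lemma bnd_add_same: "bnd n x \<Longrightarrow> bnd n y \<Longrightarrow> bnd (Suc n) (x + y)"
  using add_V[of "\<mu> ^ n * x" "\<mu> ^ n * y"] by (simp add: bnd_def algebra_simps)

text \<open>
  The sizes add up to an additive constant, so the size of a product of \<open>n\<close> generators is \<open>O(n)\<close>.  This needs
  \<open>bnd_add_same\<close>, because \<open>bnd_add\<close> doubles the size.
\<close>

lemma bounded_mat_mult:
  assumes "bounded_mat n g" "bounded_mat m h"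
  shows "bounded_mat (n + m + 4) (g ** h)"
proof -
  have A4: "g \<in> carrier A4" "h \<in> carrier A4" using assms by (auto simp: bounded_mat_def)
  have "bnd (n + m + 4) ((g ** h) $ i $ j)" for i j
  proof -
    have p: "bnd (n + m + 1) (g $ i $ k * h $ k $ j)" for k
      using assms by (intro bnd_mult) (auto simp: bounded_mat_def)
    have "bnd (Suc (Suc (n + m + 1))) ((g $ i $ 1 * h $ 1 $ j + g $ i $ 2 * h $ 2 $ j) + (g $ i $ 3 * h $ 3 $ j + g $ i $ 4 * h $ 4 $ j))"
      by (intro bnd_add_same p)
    then show ?thesis
      by (simp add: matrix_matrix_mult_def sum_4 add.assoc) (erule bnd_mono, simp)
  qed
  moreover have d: "(g ** h) $ 2 $ 2 = g $ 2 $ 2 * h $ 2 $ 2" "(g ** h) $ 3 $ 3 = g $ 3 $ 3 * h $ 3 $ 3"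
    using A4 by (auto simp: A4_def A4_carrier_def matrix_matrix_mult_def sum_4)
  have "bnd (n + m + 1) (inverse (g $ 2 $ 2) * inverse (h $ 2 $ 2))"
    "bnd (n + m + 1) (inverse (g $ 3 $ 3) * inverse (h $ 3 $ 3))"
    by (rule bnd_mult; use assms in \<open>simp add: bounded_mat_def\<close>)+
  then have "bnd (n + m + 4) (inverse ((g ** h) $ 2 $ 2))" "bnd (n + m + 4) (inverse ((g ** h) $ 3 $ 3))"
    by (auto simp: d elim!: bnd_mono)
  moreover have "g ** h \<in> carrier A4" using A4.m_closed[OF A4] by simp
  ultimately show ?thesis by (simp add: bounded_mat_def)
qed

lemma bounded_mat_mono: "bounded_mat n g \<Longrightarrow> n \<le> m \<Longrightarrow> bounded_mat m g"
  unfolding bounded_mat_def using bnd_mono by blast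

text \<open>
  A relation \<open>w\<close> is compared with the normal form of the identity by \<open>area_of_combing\<close>.  The relator length must be large
  enough for the triangles and for the bounded relations between a generator and its normal form.
\<close>

theorem quadratic_dehn_of_bounded_gens:
  assumes gens: "\<And>s. s \<in> S \<Longrightarrow> bounded_mat m s" "\<And>s. s \<in> S \<Longrightarrow> inv\<^bsub>A4\<^esub> s \<in> S"
  shows "\<exists>r0\<ge>1. \<forall>r\<ge>r0. presented_by A4 S r \<and> at_most_quadratic (dehn_function A4 S r)"
proof -
  define K where "K = m + 4"
  have words: "bounded_mat (K * n) (eval_word A4 w)" if "set w \<subseteq> S \<times> UNIV" "w \<noteq> []" "length w \<le> n" for w n
    using that
  proof (induction w arbitrary: n)
    case (Cons x w)
    obtain s b where x: "x = (s, b)" by (cases x)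
    define t where "t = (if b then inv\<^bsub>A4\<^esub> s else s)"
    have t: "bounded_mat m t" using Cons.prems(1) gens by (auto simp: t_def x)
    have e: "eval_word A4 (x # w) = t ** eval_word A4 w" by (simp add: eval_word_def x t_def)
    obtain n' where n: "n = Suc n'" "length w \<le> n'" using Cons.prems(3) by (cases n) auto
    show ?case
    proof (cases "w = []")
      case True
      then show ?thesis using t e n by (auto simp: eval_word_def K_def elim: bounded_mat_mono)
    next
      case False
      then have "bounded_mat (K * n') (eval_word A4 w)" using Cons n by auto
      from bounded_mat_mult[OF t this] show ?thesis by (simp add: e n K_def algebra_simps)
    qed
  qed simp
  obtain r1 C where tri: "\<And>n g h. n \<ge> 1 \<Longrightarrow> bounded_mat n g \<Longrightarrow> bounded_mat n h \<Longrightarrow>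
      close r1 (C * n\<^sup>2) (\<omega> g \<cdot> \<omega> h) (\<omega> (g ** h))"
    using triangle_area by blast
  obtain L where L: "\<And>g. bounded_mat K g \<Longrightarrow> length (\<omega> g) \<le> L"
    using \<omega>_length by blast
  define r0 where "r0 = r1 + L + 1"
  have "presented_by A4 S r \<and> at_most_quadratic (dehn_function A4 S r)" if r: "r \<ge> r0" for r
  proof (rule quadratic_area_imp_dehn)
    fix w assume w: "w \<in> rel_kernel A4 S"
    then have wF: "w \<in> carrier F" "eval_word A4 w = mat 1" by (auto simp: rel_kernel_iff)
    have one: "area_le r 1 (\<omega> (mat 1))"
      using L[OF bounded_mat_one] r A4.one_closed eval_\<omega>[of "mat 1"]
      by (intro relators_area_le) (auto simp: rel_kernel_iff r0_def)
    let ?A = "3 * (C * K\<^sup>2) + 1"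
    show "area_le r (?A * (length w)\<^sup>2 + 1) w"
    proof (cases "w = []")
      case True
      then show ?thesis using area_le.one[of r] by (simp add: free_group_def)
    next
      case False
      have "close r (?A * (length w)\<^sup>2) w (\<omega> (eval_word A4 w))"
      proof (rule area_of_combing[where B = "\<lambda>n. bounded_mat (K * n)"])
        fix n g h assume "1 \<le> n" "bounded_mat (K * n) g" "bounded_mat (K * n) h"
        then have "close r1 (C * (K * n)\<^sup>2) (\<omega> g \<cdot> \<omega> h) (\<omega> (g ** h))"
          by (intro tri) (auto simp: K_def)
        then show "close r (C * K\<^sup>2 * n\<^sup>2) (\<omega> g \<cdot> \<omega> h) (\<omega> (g \<otimes>\<^bsub>A4\<^esub> h))"
          unfolding A4_mult by (rule close_mono) (use r in \<open>auto simp: r0_def power_mult_distrib\<close>)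
      next
        fix n u assume "u \<in> carrier F" "u \<noteq> []" "length u \<le> n"
        then show "bounded_mat (K * n) (eval_word A4 u)"
          by (intro words) (auto simp: free_group_def)
      next
        fix u assume u: "u \<in> carrier F" "length u = 1"
        then have "bounded_mat (K * 1) (eval_word A4 u)"
          by (intro words) (auto simp: free_group_def)
        then have "length (\<omega> (eval_word A4 u)) \<le> L" using L by simp
        then show "close r 1 u (\<omega> (eval_word A4 u))"
          using u r eval_\<omega> eval_closed by (intro close_relation) (auto simp: r0_def)
      qed (use wF False in auto)
      then have "area_le r (?A * (length w)\<^sup>2) (w \<cdot> inv\<^bsub>F\<^esub> (\<omega> (mat 1)))"
        by (simp add: close_def wF(2))
      from area_le_mult[OF this one] show ?thesis
        using wF(1) by (simp add: F.m_assoc)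
    qed
  qed
  then show ?thesis by (intro exI[of _ r0]) (auto simp: r0_def)
qed

end

section \<open>Compact generating sets\<close>

lemma Baire_countable_closed_cover:
  fixes X :: "nat \<Rightarrow> 'k::t2_space set"
  assumes lc: "locally_compact_space (euclidean :: 'k topology)"
    and X: "\<And>n. closed (X n)" "(\<Union>n. X n) = UNIV"
  obtains n U where "open U" "U \<noteq> {}" "U \<subseteq> X n"
proof -
  have "\<exists>U W. open U \<and> open W \<and> x \<in> U \<and> y \<in> W \<and> disjnt U W" if "x \<noteq> y" for x y :: 'k
    using hausdorff[OF that] by (simp only: disjnt_def)
  then have "Hausdorff_space (euclidean :: 'k topology)"
    by (simp add: Hausdorff_space_def)
  then have reg: "regular_space (euclidean :: 'k topology)"
    by (rule locally_compact_Hausdorff_imp_regular_space[OF lc])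
  have "\<exists>n. (euclidean :: 'k topology) interior_of X n \<noteq> {}"
  proof (rule ccontr)
    assume "\<not> ?thesis"
    then have 1: "closedin euclidean T \<and> (euclidean :: 'k topology) interior_of T = {}" if "T \<in> range X" for T
      using X(1) that by (auto simp only: closed_closedin[symmetric])
    have "(euclidean :: 'k topology) interior_of \<Union>(range X) = {}"
      by (rule Baire_category_alt[OF disjI2[OF conjI[OF lc reg]] _ 1]) simp_all
    moreover have "\<Union>(range X) = topspace (euclidean :: 'k topology)" using X(2) by simp
    ultimately show False by (simp only: interior_of_topspace) simp
  qed
  then obtain n where n: "(euclidean :: 'k topology) interior_of X n \<noteq> {}" ..
  have "openin euclidean ((euclidean :: 'k topology) interior_of X n)" by (rule openin_interior_of)
  then have "open ((euclidean :: 'k topology) interior_of X n)" by (simp only: open_openin)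
  then show thesis by (rule that[OF _ n interior_of_subset])
qed

lemma continuous_on_elmat_entry:
  "continuous_on A (\<lambda>x. elmat \<rho> (f x) $ i $ j)"
  if "continuous_on A f" for f :: "'b::topological_space \<Rightarrow> 'k::{field, t2_space}"
  using that by (cases "i = j"; cases "(i, j) = root_pos \<rho>") (auto simp: elmat_def intro: continuous_on_const)

lemma continuous_on_dgmat_entry:
  "continuous_on A (\<lambda>x. dgmat (f x) (g x) $ i $ j)"
  if "continuous_on A f" "continuous_on A g" for f g :: "'b::topological_space \<Rightarrow> 'k::{field, t2_space}"
  using that by (cases "i = j"; cases "i = 2"; cases "i = 3") (auto simp: dgmat_def intro: continuous_on_const)

lemma continuous_on_matrixI:
  assumes "\<And>i j. continuous_on A (\<lambda>x. f x $ i $ j)"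
  shows "continuous_on A (f :: _ \<Rightarrow> 'k::topological_space ^ 4 ^ 4)"
proof -
  have "continuous_on A (\<lambda>x. \<chi> i j. f x $ i $ j)"
    by (intro continuous_on_vec_lambda assms)
  then show ?thesis by simp
qed

text \<open>
  The inclusion \<open>f\<close> of a coordinate is a section of an entry map and has closed range, so the preimage of a compact set
  is the image of a compact set under the entry map.
\<close>

lemma closed_section_vimage:
  fixes f :: "'k::t2_space \<Rightarrow> 'k mat4"
  assumes "compact P" and f: "\<And>x. f x $ i $ j = x"
    "\<And>k l. continuous_on UNIV (\<lambda>A::'k mat4. f (A $ i $ j) $ k $ l)"
  shows "closed {x. f x \<in> P}"
proof -
  have "closed {A. \<forall>k l. f (A $ i $ j) $ k $ l = A $ k $ l}"
    by (intro closed_Collect_all closed_Collect_eq f continuous_intros)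
  then have "compact (P \<inter> {A. \<forall>k l. f (A $ i $ j) $ k $ l = A $ k $ l})"
    by (rule compact_Int_closed[OF assms(1)])
  moreover have "continuous_on X (\<lambda>A::'k mat4. A $ i $ j)" for X
    by (intro continuous_intros)
  ultimately have "compact ((\<lambda>A. A $ i $ j) ` (P \<inter> {A. \<forall>k l. f (A $ i $ j) $ k $ l = A $ k $ l}))"
    by (rule compact_continuous_image[rotated])
  moreover have "(\<lambda>A. A $ i $ j) ` (P \<inter> {A. \<forall>k l. f (A $ i $ j) $ k $ l = A $ k $ l}) = {x. f x \<in> P}"
  proof (intro equalityI subsetI)
    fix x assume "x \<in> (\<lambda>A. A $ i $ j) ` (P \<inter> {A. \<forall>k l. f (A $ i $ j) $ k $ l = A $ k $ l})"
    then obtain A where A: "A \<in> P" "\<forall>k l. f (A $ i $ j) $ k $ l = A $ k $ l" "x = A $ i $ j" by blast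
    then have "f x = A" by (simp add: vec_eq_iff)
    then show "x \<in> {x. f x \<in> P}" using A by simp
  next
    fix x assume "x \<in> {x. f x \<in> P}"
    then show "x \<in> (\<lambda>A. A $ i $ j) ` (P \<inter> {A. \<forall>k l. f (A $ i $ j) $ k $ l = A $ k $ l})"
      by (intro image_eqI[of _ _ "f x"]) (simp_all add: f)
  qed
  ultimately show ?thesis using compact_imp_closed by simp
qed

text \<open>
  The elements that are products of at most \<open>n\<close> generators.
\<close>

fun word_ball :: "('k::field ^ 4 ^ 4) set \<Rightarrow> nat \<Rightarrow> 'k mat4 set" where
  "word_ball S 0 = {mat 1}"
| "word_ball S (Suc n) = word_ball S n \<union> (\<lambda>p. fst p ** snd p) ` (S \<times> word_ball S n)"

lemma continuous_on_matrix_mult: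
  "continuous_on A (\<lambda>p::('k::{field, t2_space, topological_ab_group_add, topological_semigroup_mult} ^ 4 ^ 4) \<times> 'k mat4. fst p ** snd p)"
proof (rule continuous_on_matrixI)
  fix i j
  have "continuous_on A (\<lambda>p::'k mat4 \<times> 'k mat4. fst p $ i $ k * snd p $ k $ j)" for k
    by (intro continuous_on_mult_topological continuous_intros)
  then show "continuous_on A (\<lambda>p::'k mat4 \<times> 'k mat4. (fst p ** snd p) $ i $ j)"
    unfolding matrix_matrix_mult_def by (simp add: sum_4) (intro continuous_on_add)
qed

lemma compact_word_ball:
  fixes S :: "('k::{field, t2_space, topological_ab_group_add, topological_semigroup_mult} ^ 4 ^ 4) set"
  assumes "compact S"
  shows "compact (word_ball S n)"
proof (induction n)
  case (Suc n)
  then show ?case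
    using compact_continuous_image[OF continuous_on_matrix_mult compact_Times[OF assms Suc]]
    by (simp add: compact_Un)
qed simp

lemma word_ball_mono: "n \<le> m \<Longrightarrow> word_ball S n \<subseteq> word_ball S m"
  by (induction rule: dec_induct) auto

lemma word_ball_mult: "g \<in> word_ball S n \<Longrightarrow> h \<in> word_ball S m \<Longrightarrow> g ** h \<in> word_ball S (n + m)"
proof (induction n arbitrary: g)
  case (Suc n)
  then show ?case by (force simp: matrix_mul_assoc[symmetric])
qed simp

lemma word_ball_gen: "s \<in> S \<Longrightarrow> s \<in> word_ball S 1"
  by force

lemma word_ball_covers:
  assumes "generate A4 S = carrier A4" "\<And>s. s \<in> S \<Longrightarrow> inv\<^bsub>A4\<^esub> s \<in> S" "g \<in> carrier A4"
  shows "\<exists>n. g \<in> word_ball S n"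
proof -
  have "g \<in> generate A4 S" using assms by simp
  then show ?thesis
  proof (induction rule: generate.induct)
    case one
    then show ?case by (intro exI[of _ 0]) simp
  next
    case (eng g h)
    then show ?case using word_ball_mult by (metis A4_mult)
  qed (use word_ball_gen assms(2) in blast)+
qed

lemma (in presentation) eval_word_generate:
  "w \<in> carrier F \<Longrightarrow> eval_word G w \<in> generate G S"
proof (induction w)
  case Nil
  then show ?case by (simp add: eval_word_def generate.one)
next
  case (Cons x w)
  obtain s b where x: "x = (s, b)" by (cases x)
  have "w \<in> carrier F" "s \<in> S" using Cons.prems by (auto simp: free_group_def reduced_Cons x)
  moreover have "eval_word G (x # w) = (if b then inv\<^bsub>G\<^esub> s else s) \<otimes>\<^bsub>G\<^esub> eval_word G w"
    by (simp add: eval_word_def x)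
  ultimately show ?case
    using Cons.IH by (auto intro: generate.intros)
qed

lemma (in presentation) gen_word:
  assumes "s \<in> S"
  shows "[(s, False)] \<in> carrier F" "eval_word G [(s, False)] = s"
  using assms S_carrier by (auto simp: free_group_def reduced_Cons eval_word_def)

lemma word_ball_word:
  assumes "S \<subseteq> carrier A4" "g \<in> word_ball S n"
  shows "\<exists>w\<in>carrier (free_group S). eval_word A4 w = g \<and> length w \<le> n"
proof -
  interpret presentation A4 S
    by unfold_locales (rule assms(1))
  show ?thesis using assms(2)
  proof (induction n arbitrary: g)
    case 0
    then show ?case by (intro bexI[of _ "\<one>\<^bsub>F\<^esub>"]) (auto simp: free_group_def eval_word_def)
  next
    case (Suc n)
    show ?case
    proof (cases "g \<in> word_ball S n")
      case False
      then obtain s h where g: "g = s ** h" "s \<in> S" "h \<in> word_ball S n" using Suc.prems by auto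
      obtain w where w: "w \<in> carrier F" "eval_word A4 w = h" "length w \<le> n" using Suc.IH[OF g(3)] by blast
      have "length ([(s, False)] \<cdot> w) \<le> Suc n"
        using length_mult_le[of "[(s, False)]" w] w(3) by simp
      then show ?thesis
        using w g gen_word[OF g(2)] by (intro bexI[of _ "[(s, False)] \<cdot> w"]) (simp_all add: eval_mult)
    qed (use Suc.IH le_SucI in blast)
  qed
qed

lemma compact_uniform_word_ball:
  assumes "compact B" "\<And>b. b \<in> B \<Longrightarrow> \<exists>U n. open U \<and> b \<in> U \<and> (\<forall>x\<in>U. f x \<in> word_ball S n)"
  shows "\<exists>n. \<forall>b\<in>B. f b \<in> word_ball S n"
proof -
  obtain U n where U: "\<And>b. b \<in> B \<Longrightarrow> open (U b)" "\<And>b. b \<in> B \<Longrightarrow> b \<in> U b"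
    "\<And>b x. b \<in> B \<Longrightarrow> x \<in> U b \<Longrightarrow> f x \<in> word_ball S (n b)"
    using assms(2) by metis
  obtain C where C: "C \<subseteq> B" "finite C" "B \<subseteq> (\<Union>c\<in>C. U c)"
    by (rule compactE_image[OF assms(1), of B U]) (use U in blast)+
  have "f b \<in> word_ball S (\<Sum>c\<in>C. n c)" if b: "b \<in> B" for b
  proof -
    obtain c where c: "c \<in> C" "b \<in> U c" using C b by blast
    then have "n c \<le> (\<Sum>c\<in>C. n c)" using C(2) by (intro member_le_sum) auto
    then show ?thesis using U(3)[of c b] c C(1) word_ball_mono by blast
  qed
  then show ?thesis by blast
qed

text \<open>
  The union of the compact sets \<open>word_ball S n\<close> is the whole group.  Restricted to a one-parameter subgroup, one of them
  has interior points by Baire's theorem, and translating an open subset of it shows that compact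
  parts of the subgroup have bounded word length.
\<close>

locale compactly_generated =
  fixes S :: "('k::{field, t2_space, topological_ab_group_add, topological_semigroup_mult} ^ 4 ^ 4) set"
  assumes lc: "locally_compact_space (euclidean :: 'k topology)"
    and nd: "\<not> open {0 :: 'k}"
    and gens: "compact S" "\<And>s. s \<in> S \<Longrightarrow> inv\<^bsub>A4\<^esub> s \<in> S" "generate A4 S = carrier A4"
begin

lemma elmat_uniform:
  assumes "compact B"
  shows "\<exists>n. \<forall>b\<in>B. elmat \<rho> b \<in> word_ball S n"
proof -
  obtain i j where ij: "root_pos \<rho> = (i, j)" by (cases "root_pos \<rho>")
  have "i \<noteq> j" using ij by (cases \<rho>) auto
  then have e: "elmat \<rho> x $ i $ j = x" for x :: 'k by (simp add: elmat_def ij)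
  have "closed {x. elmat \<rho> x \<in> word_ball S n}" for n
    by (rule closed_section_vimage[OF compact_word_ball[OF gens(1)] e])
      (intro continuous_on_elmat_entry continuous_intros)
  moreover have "(\<Union>n. {x. elmat \<rho> x \<in> word_ball S n}) = UNIV"
    using word_ball_covers[OF gens(3,2)] elmat_in_A4 by blast
  ultimately obtain n U where U: "open U" "U \<noteq> {}" "U \<subseteq> {x. elmat \<rho> x \<in> word_ball S n}"
    by (rule Baire_countable_closed_cover[OF lc])
  then obtain u where u: "u \<in> U" by blast
  show ?thesis
  proof (rule compact_uniform_word_ball[OF assms])
    fix b assume "b \<in> B"
    obtain m where m: "elmat \<rho> (b - u) \<in> word_ball S m"
      using word_ball_covers[OF gens(3,2)] elmat_in_A4 by blast
    have "open ((\<lambda>x. x - (b - u)) -` U)"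
      by (rule open_vimage[OF U(1)]) (intro continuous_intros)
    moreover have "elmat \<rho> x \<in> word_ball S (m + n)" if "x - (b - u) \<in> U" for x
      using word_ball_mult[OF m, of "elmat \<rho> (x - (b - u))" n] that U(3) by (auto simp: elmat_add)
    ultimately show "\<exists>U n. open U \<and> b \<in> U \<and> (\<forall>x\<in>U. elmat \<rho> x \<in> word_ball S n)"
      using u by (intro exI[of _ "(\<lambda>x. x - (b - u)) -` U"] exI[of _ "m + n"]) auto
  qed
qed

text \<open>
  The multiplicative version.  The point \<open>0\<close> is added to the closed sets so that they cover the field, and is removed
  from the open set that Baire's theorem provides.
\<close>

lemma torus_uniform:
  fixes f :: "'k \<Rightarrow> 'k mat4"
  assumes "compact B" "0 \<notin> B"
    and f: "\<And>x. f x $ i $ i = x" "\<And>k l. continuous_on UNIV (\<lambda>A::'k mat4. f (A $ i $ i) $ k $ l)"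
      "\<And>x y. f x ** f y = f (x * y)" "\<And>x. x \<noteq> 0 \<Longrightarrow> f x \<in> carrier A4"
  shows "\<exists>n. \<forall>b\<in>B. f b \<in> word_ball S n"
proof -
  have "closed (insert 0 {x. f x \<in> word_ball S n})" for n
    by (rule closed_insert, rule closed_section_vimage[OF compact_word_ball[OF gens(1)] f(1,2)])
  moreover have "(\<Union>n. insert 0 {x. f x \<in> word_ball S n}) = UNIV"
    using word_ball_covers[OF gens(3,2) f(4)] by blast
  ultimately obtain n U where U: "open U" "U \<noteq> {}" "U \<subseteq> insert 0 {x. f x \<in> word_ball S n}"
    by (rule Baire_countable_closed_cover[OF lc])
  have "U \<noteq> {0}" using U(1) nd by metis
  then obtain u where u: "u \<in> U" "u \<noteq> 0" using U(2) by blast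
  show ?thesis
  proof (rule compact_uniform_word_ball[OF assms(1)])
    fix b assume "b \<in> B"
    then have b: "b \<noteq> 0" using assms(2) by blast
    obtain m where m: "f (b / u) \<in> word_ball S m"
      using word_ball_covers[OF gens(3,2) f(4)[of "b / u"]] b u by auto
    let ?g = "\<lambda>x. x * (u / b)"
    have "continuous_on UNIV ?g"
      by (intro continuous_on_mult_topological continuous_intros)
    then have "open (?g -` (U - {0}))"
      using U(1) by (intro open_vimage open_Diff) auto
    moreover have "f x \<in> word_ball S (m + n)" if "?g x \<in> U - {0}" for x
      using word_ball_mult[OF m, of "f (?g x)" n] that U(3) b u by (auto simp: f(3))
    ultimately show "\<exists>U n. open U \<and> b \<in> U \<and> (\<forall>x\<in>U. f x \<in> word_ball S n)"
      using u b by (intro exI[of _ "?g -` (U - {0})"] exI[of _ "m + n"]) auto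
  qed
qed

lemma dgmat_uniform:
  assumes "compact B" "0 \<notin> B"
  shows "\<exists>n. \<forall>a\<in>B. \<forall>b\<in>B. dgmat a b \<in> word_ball S n"
proof -
  have "\<exists>n. \<forall>b\<in>B. dgmat b 1 \<in> word_ball S n"
    by (rule torus_uniform[OF assms, where i = 2])
      (simp add: dgmat_def, intro continuous_on_dgmat_entry continuous_intros, simp add: dgmat_mult, simp add: dgmat_in_A4)
  then obtain n where n: "\<And>b. b \<in> B \<Longrightarrow> dgmat b 1 \<in> word_ball S n" by blast
  have "\<exists>n. \<forall>b\<in>B. dgmat 1 b \<in> word_ball S n"
    by (rule torus_uniform[OF assms, where i = 3])
      (simp add: dgmat_def, intro continuous_on_dgmat_entry continuous_intros, simp add: dgmat_mult, simp add: dgmat_in_A4)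
  then obtain m where m: "\<And>b. b \<in> B \<Longrightarrow> dgmat 1 b \<in> word_ball S m" by blast
  have "dgmat a b \<in> word_ball S (n + m)" if "a \<in> B" "b \<in> B" for a b
    using word_ball_mult[OF n m] that by (simp add: dgmat_mult)
  then show ?thesis by blast
qed

end

text \<open>
  The set is a projection of the part of the closed hyperbola \<open>cd = 1\<close> in a compact square.
\<close>

lemma compact_units:
  fixes V :: "'k::{field, t2_space, topological_ab_group_add, topological_semigroup_mult} set"
  assumes "scaled_field V \<mu> \<kappa>" "compact V"
  shows "compact (scaled_field.units V \<mu> \<kappa>)" "0 \<notin> scaled_field.units V \<mu> \<kappa>"
proof -
  interpret scaled_field V \<mu> \<kappa> by fact
  show "0 \<notin> units" by (simp add: units_def)
  define W where "W = (\<lambda>x. inverse \<mu> ^ Suc \<kappa> * x) ` V"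
  have W: "bnd (Suc \<kappa>) x \<longleftrightarrow> x \<in> W" for x
  proof -
    have inv: "inverse \<mu> ^ Suc \<kappa> * (\<mu> ^ Suc \<kappa> * y) = y" "\<mu> ^ Suc \<kappa> * (inverse \<mu> ^ Suc \<kappa> * y) = y" for y
      using mu_nz by (simp_all add: mult.assoc[symmetric] power_mult_distrib[symmetric] del: power_Suc)
    show ?thesis
    proof
      assume "bnd (Suc \<kappa>) x"
      then show "x \<in> W" unfolding W_def bnd_def using inv(1)[of x] by (metis image_eqI)
    next
      assume "x \<in> W"
      then obtain v where "v \<in> V" "x = inverse \<mu> ^ Suc \<kappa> * v" unfolding W_def by blast
      then show "bnd (Suc \<kappa>) x" unfolding bnd_def using inv(2)[of v] by metis
    qed
  qed
  have "compact W"
    unfolding W_def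
    by (intro compact_continuous_image continuous_on_mult_topological continuous_intros assms(2))
  moreover have "closed {p::'k \<times> 'k. fst p * snd p = 1}"
    by (intro closed_Collect_eq continuous_on_times_pair continuous_intros)
  ultimately have "compact ((W \<times> W) \<inter> {p. fst p * snd p = 1})"
    by (intro compact_Int_closed compact_Times)
  then have "compact (fst ` ((W \<times> W) \<inter> {p. fst p * snd p = 1}))"
    by (rule compact_continuous_image[rotated]) (intro continuous_intros)
  moreover have "fst ` ((W \<times> W) \<inter> {p. fst p * snd p = 1}) = units"
  proof (intro equalityI subsetI)
    fix c assume "c \<in> fst ` ((W \<times> W) \<inter> {p. fst p * snd p = 1})"
    then obtain d where d: "c \<in> W" "d \<in> W" "c * d = 1" by auto
    then have "c \<noteq> 0" "inverse c = d" by (auto simp: inverse_unique)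
    then show "c \<in> units" using d by (simp add: units_def W)
  next
    fix c assume "c \<in> units"
    then show "c \<in> fst ` ((W \<times> W) \<inter> {p. fst p * snd p = 1})"
      by (intro image_eqI[of _ _ "(c, inverse c)"]) (auto simp: units_def W)
  qed
  ultimately show "compact units" by simp
qed

text \<open>
  The matrices that the normal forms use as letters.  They generate because the words \<open>\<omega> g\<close> are words in them.
\<close>

lemma standard_compact_gen_set:
  fixes V :: "'k::{field, t2_space, topological_ab_group_add, topological_semigroup_mult} set"
  assumes "scaled_field V \<mu> \<kappa>" "compact V"
  shows "\<exists>S :: 'k mat4 set. compact_gen_set A4 A4_topology S"
proof -
  interpret scaled_field V \<mu> \<kappa> by fact
  define S where "S = (\<Union>\<rho>\<in>{R12, R13, R23, R24, R34}. elmat \<rho> ` V) \<union> (\<lambda>p. dgmat (fst p) (snd p)) ` (units \<times> units)"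
  have S: "S \<subseteq> carrier A4"
    by (auto simp: S_def units_def intro: dgmat_in_A4)
  have in_S: "elmat \<rho> v \<in> S" if "v \<in> V" for \<rho> v
    using that by (cases \<rho>) (auto simp: S_def)
  have dg_S: "dgmat a b \<in> S" if "a \<in> units" "b \<in> units" for a b
    unfolding S_def by (rule UnI2, rule image_eqI[of _ _ "(a, b)"]) (use that in simp_all)
  have "compact (elmat \<rho> ` V)" for \<rho>
    by (intro compact_continuous_image continuous_on_matrixI continuous_on_elmat_entry continuous_intros assms(2))
  moreover have "compact ((\<lambda>p. dgmat (fst p) (snd p)) ` (units \<times> units))"
    by (intro compact_continuous_image continuous_on_matrixI continuous_on_dgmat_entry continuous_intros
        compact_Times compact_units assms)
  ultimately have "compact S"
    unfolding S_def by (intro compact_Un compact_UN) auto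
  moreover have "inv\<^bsub>A4\<^esub> s \<in> S" if s: "s \<in> S" for s
  proof -
    consider \<rho> v where "s = elmat \<rho> v" "v \<in> V" | a b where "s = dgmat a b" "a \<in> units" "b \<in> units"
      using s unfolding S_def by auto
    then show ?thesis
    proof cases
      case 1
      then show ?thesis by (simp add: inv_elmat in_S minus_V)
    next
      case 2
      then show ?thesis by (auto simp: inv_dgmat units_def intro!: dg_S)
    qed
  qed
  moreover have "generate A4 S = carrier A4"
  proof
    interpret presentation A4 S by unfold_locales (rule S)
    interpret abels_words V \<mu> \<kappa> S 1
    proof
      show "\<exists>w\<in>carrier F. eval_word A4 w = elmat \<rho> v \<and> length w \<le> 1" if "v \<in> V" for v \<rho>
        using gen_word[OF in_S[OF that]] by (intro bexI[of _ "[(elmat \<rho> v, False)]"]) auto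
      show "\<exists>w\<in>carrier F. eval_word A4 w = dgmat a b \<and> length w \<le> 1" if "a \<in> units" "b \<in> units" for a b
        using gen_word[OF dg_S[OF that]] by (intro bexI[of _ "[(dgmat a b, False)]"]) auto
    qed
    show "carrier A4 \<subseteq> generate A4 S"
      using eval_word_generate[OF words_closed(6)] eval_\<omega> by (metis subsetI)
    show "generate A4 S \<subseteq> carrier A4"
      by (rule A4.generate_incl[OF S])
  qed
  ultimately have "compact_gen_set A4 A4_topology S"
    using S by (simp add: compact_gen_set_def A4_topology_def compactin_subtopology A4_def)
  then show ?thesis by blast
qed

theorem theorem1p1:
  assumes inverse_continuous:
    "continuous_on (UNIV - {0})
      (inverse :: 'k::{field, t2_space, topological_ab_group_add, topological_semigroup_mult} \<Rightarrow> 'k)"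
    and locally_compact: "locally_compact_space (euclidean :: 'k topology)"
    and nondiscrete: "(euclidean :: 'k topology) \<noteq> discrete_topology UNIV"
  shows "quadratic_dehn_function (A4 :: ('k ^ 4 ^ 4) monoid) A4_topology"
proof -
  obtain V :: "'k set" and \<mu> \<kappa> where V: "scaled_field V \<mu> \<kappa>" "compact V"
    and bounded: "\<And>B. compact B \<Longrightarrow> \<exists>n. \<forall>b\<in>B. \<mu> ^ n * b \<in> V"
    using scaled_field_exists[OF assms] by metis
  interpret scaled_field V \<mu> \<kappa> by fact
  have quadratic: "\<exists>r0\<ge>1. \<forall>r\<ge>r0. presented_by A4 S r \<and> at_most_quadratic (dehn_function A4 S r)"
    if "compact_gen_set A4 A4_topology S" for S :: "('k ^ 4 ^ 4) set"
  proof -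
    have S: "S \<subseteq> carrier A4" "compact S" "\<And>s. s \<in> S \<Longrightarrow> inv\<^bsub>A4\<^esub> s \<in> S" "generate A4 S = carrier A4"
      using that by (auto simp: compact_gen_set_def A4_topology_def compactin_subtopology)
    interpret compactly_generated S
      by unfold_locales (fact locally_compact, rule nondiscrete_imp_not_open_0[OF nondiscrete], fact+)
    obtain n where n: "\<And>\<rho> v. v \<in> V \<Longrightarrow> elmat \<rho> v \<in> word_ball S (n \<rho>)"
      using elmat_uniform[OF V(2)] by metis
    obtain m where m: "\<And>a b. a \<in> units \<Longrightarrow> b \<in> units \<Longrightarrow> dgmat a b \<in> word_ball S m"
      using dgmat_uniform[OF compact_units[OF V]] by metis
    define N where "N = n R12 + n R13 + n R23 + n R24 + n R34 + m"
    have nN: "n \<rho> \<le> N" "m \<le> N" for \<rho> by (cases \<rho>) (auto simp: N_def)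
    interpret presentation A4 S by unfold_locales (rule S(1))
    interpret abels_words V \<mu> \<kappa> S N
    proof
      show "\<exists>w\<in>carrier F. eval_word A4 w = elmat \<rho> v \<and> length w \<le> N" if "v \<in> V" for v \<rho>
        using word_ball_word[OF S(1) n[OF that]] nN(1) le_trans by blast
      show "\<exists>w\<in>carrier F. eval_word A4 w = dgmat a b \<and> length w \<le> N" if "a \<in> units" "b \<in> units" for a b
        using word_ball_word[OF S(1) m[OF that]] nN(2) le_trans by blast
    qed
    have "\<exists>k. \<forall>s\<in>S. bnd k (s $ i $ j)" for i j
    proof -
      have "compact ((\<lambda>s. s $ i $ j) ` S)"
        by (intro compact_continuous_image continuous_intros S(2))
      from bounded[OF this] show ?thesis by (auto simp: bnd_def)
    qed
    then obtain k where k: "\<And>i j s. s \<in> S \<Longrightarrow> bnd (k i j) (s $ i $ j)" by metis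
    define K where "K = (\<Sum>i\<in>UNIV. \<Sum>j\<in>UNIV. k i j)"
    have kK: "k i j \<le> K" for i j
    proof -
      have "k i j \<le> (\<Sum>j\<in>UNIV. k i j)" by (rule member_le_sum) auto
      also have "\<dots> \<le> K" unfolding K_def by (rule member_le_sum[of i UNIV "\<lambda>i. \<Sum>j\<in>UNIV. k i j"]) auto
      finally show ?thesis .
    qed
    have "bounded_mat K s" if s: "s \<in> S" for s
    proof -
      have sA: "s \<in> carrier A4" "inv\<^bsub>A4\<^esub> s \<in> carrier A4" using S(1,3) s by auto
      have "s ** inv\<^bsub>A4\<^esub> s = mat 1" using A4.r_inv[OF sA(1)] by simp
      then have "(s ** inv\<^bsub>A4\<^esub> s) $ 2 $ 2 = 1" "(s ** inv\<^bsub>A4\<^esub> s) $ 3 $ 3 = 1" by (simp_all add: mat_def)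
      moreover have "(s ** inv\<^bsub>A4\<^esub> s) $ 2 $ 2 = s $ 2 $ 2 * (inv\<^bsub>A4\<^esub> s) $ 2 $ 2"
        "(s ** inv\<^bsub>A4\<^esub> s) $ 3 $ 3 = s $ 3 $ 3 * (inv\<^bsub>A4\<^esub> s) $ 3 $ 3"
        using sA by (auto simp: A4_def A4_carrier_def matrix_matrix_mult_def sum_4)
      ultimately have "inverse (s $ 2 $ 2) = (inv\<^bsub>A4\<^esub> s) $ 2 $ 2" "inverse (s $ 3 $ 3) = (inv\<^bsub>A4\<^esub> s) $ 3 $ 3"
        by (simp_all add: inverse_unique)
      then show ?thesis
        using sA(1) bnd_mono[OF k[OF s] kK] bnd_mono[OF k[OF S(3)[OF s]] kK] by (simp add: bounded_mat_def)
    qed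
    then show ?thesis by (rule quadratic_dehn_of_bounded_gens[OF _ S(3)])
  qed
  moreover obtain S :: "('k ^ 4 ^ 4) set" where "compact_gen_set A4 A4_topology S"
    using standard_compact_gen_set[OF V] by blast
  ultimately show ?thesis
    unfolding quadratic_dehn_function_def compactly_presented_def by blast
qed

end
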